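(* Let $A$ be a finite-dimensional Frobenius $k$-algebra with Nakayama automorphism $\nu$. Then $$\underline{\operatorname{Hom}}_{A^{\mathrm e}}(A,\mathrm DA)\;\cong\;Z_\nu(A)/H_\nu(A),$$ where $Z_\nu(A)=\{z\in A:\ z\,\nu(a)=a\,z\ \ \forall a\in A\}\cong\mathrm D(A/[A,A])$ is the $\nu$-twisted center and $$H_\nu(A)=\Bigl\{\textstyle\sum_ix_iy_i\ :\ \sum_ix_i\otimes y_i\in A\otimes_kA,\ \ \sum_iax_i\otimes y_i=\sum_ix_i\otimes y_i\nu(a)\ \ \forall a\in A\Bigr\}$$ is the $\nu$-twisted Higman ideal.
   Context: $k$ is a field, $\mathrm D=\operatorname{Hom}_k(-,k)$, $A^{\mathrm e}=A\otimes_kA^{\mathrm{op}}$, bimodules are left $A^{\mathrm e}$-modules, $A/\operatorname{rad}A$ is assumed separable over $k$, and $\mathrm DA$ has bimodule structure $(afb)(x)=f(bxa)$. A Nakayama automorphism $\nu$ is normalized by $\mathrm DA\cong{}_1A_\nu$ as bimodules, where ${}_1A_\nu$ is $A$ with $a\cdot x\cdot b=ax\nu(b)$. $\underline{\operatorname{Hom}}_{A^{\mathrm e}}(U,V)$ is $\operatorname{Hom}_{A^{\mathrm e}}(U,V)$ modulo the maps factoring through a projective $A^{\mathrm e}$-module; $[A,A]$ is the $k$-span of commutators. *)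

theory Defs
  imports "HOL-Algebra.Module" "HOL-Algebra.QuotRing"
begin

section \<open>Left modules over a not necessarily commutative ring\<close>

text \<open>
  The library locale \<^locale>\<open>module\<close> requires a commutative ring of scalars, whereas the enveloping
  algebra is noncommutative. The library locale \<^locale>\<open>submodule\<close> has no such restriction and is
  used as it is. The fields \<open>mult\<close> and \<open>one\<close> of a module record are irrelevant unless
  the record is used as an algebra.
\<close>

locale left_module = R?: ring R + M?: abelian_group M
  for R :: "('r, 'z) ring_scheme" (structure) and M :: "('r, 'm, 'y) module_scheme" (structure) +
  assumes smult_closed:
      "\<lbrakk>r \<in> carrier R; x \<in> carrier M\<rbrakk> \<Longrightarrow> r \<odot>\<^bsub>M\<^esub> x \<in> carrier M"
    and smult_l_distr:
      "\<lbrakk>r \<in> carrier R; s \<in> carrier R; x \<in> carrier M\<rbrakk> \<Longrightarrow>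
        (r \<oplus>\<^bsub>R\<^esub> s) \<odot>\<^bsub>M\<^esub> x = r \<odot>\<^bsub>M\<^esub> x \<oplus>\<^bsub>M\<^esub> s \<odot>\<^bsub>M\<^esub> x"
    and smult_r_distr:
      "\<lbrakk>r \<in> carrier R; x \<in> carrier M; y \<in> carrier M\<rbrakk> \<Longrightarrow>
        r \<odot>\<^bsub>M\<^esub> (x \<oplus>\<^bsub>M\<^esub> y) = r \<odot>\<^bsub>M\<^esub> x \<oplus>\<^bsub>M\<^esub> r \<odot>\<^bsub>M\<^esub> y"
    and smult_assoc:
      "\<lbrakk>r \<in> carrier R; s \<in> carrier R; x \<in> carrier M\<rbrakk> \<Longrightarrow>
        (r \<otimes>\<^bsub>R\<^esub> s) \<odot>\<^bsub>M\<^esub> x = r \<odot>\<^bsub>M\<^esub> (s \<odot>\<^bsub>M\<^esub> x)"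
    and smult_one: "x \<in> carrier M \<Longrightarrow> \<one>\<^bsub>R\<^esub> \<odot>\<^bsub>M\<^esub> x = x"

text \<open>Homomorphisms are extensional, so that equality of homomorphisms is equality of functions.\<close>

definition mod_hom ::
  "('r, 'z) ring_scheme \<Rightarrow> ('r, 'u, 'x) module_scheme \<Rightarrow> ('r, 'v, 'y) module_scheme \<Rightarrow> ('u \<Rightarrow> 'v) set"
  where "mod_hom R U V =
    {f \<in> carrier U \<rightarrow>\<^sub>E carrier V.
      (\<forall>x\<in>carrier U. \<forall>y\<in>carrier U. f (x \<oplus>\<^bsub>U\<^esub> y) = f x \<oplus>\<^bsub>V\<^esub> f y) \<and>
      (\<forall>r\<in>carrier R. \<forall>x\<in>carrier U. f (r \<odot>\<^bsub>U\<^esub> x) = r \<odot>\<^bsub>V\<^esub> f x)}"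

definition mod_isomorphic ::
  "('r, 'z) ring_scheme \<Rightarrow> ('r, 'u, 'x) module_scheme \<Rightarrow> ('r, 'v, 'y) module_scheme \<Rightarrow> bool"
  where "mod_isomorphic R U V \<longleftrightarrow> (\<exists>f\<in>mod_hom R U V. bij_betw f (carrier U) (carrier V))"

definition lin_span :: "('r, 'z) ring_scheme \<Rightarrow> ('r, 'm, 'y) module_scheme \<Rightarrow> 'm set \<Rightarrow> 'm set"
  where "lin_span R M S = \<Inter>{N. submodule N R M \<and> S \<subseteq> N}"

text \<open>
  The quotient of a module by a submodule. If \<open>M\<close> is an algebra and \<open>N\<close> an ideal, this is
  the quotient algebra; its ring part agrees with \<^const>\<open>FactRing\<close>.
\<close>

definition quot_mod :: "('r, 'm, 'y) module_scheme \<Rightarrow> 'm set \<Rightarrow> ('r, 'm set) module"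
  where "quot_mod M N =
    \<lparr>carrier = a_rcosets\<^bsub>M\<^esub> N, mult = rcoset_mult M N, one = N +>\<^bsub>M\<^esub> \<one>\<^bsub>M\<^esub>,
     zero = N, add = set_add M,
     smult = (\<lambda>r C. \<Union>x\<in>C. N +>\<^bsub>M\<^esub> (r \<odot>\<^bsub>M\<^esub> x))\<rparr>"

text \<open>A ring as a left module over itself; for commutative \<open>R\<close> also \<open>R\<close> as an \<open>R\<close>-algebra.\<close>

definition left_regular :: "('r, 'z) ring_scheme \<Rightarrow> ('r, 'r) module"
  where "left_regular R =
    \<lparr>carrier = carrier R, mult = mult R, one = one R, zero = zero R, add = add R,
     smult = mult R\<rparr>"

text \<open>The free left module with basis indexed by \<open>I\<close>: finitely supported functions.\<close>

definition free_mod :: "('r, 'z) ring_scheme \<Rightarrow> 'i set \<Rightarrow> ('r, 'i \<Rightarrow> 'r) module"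
  where "free_mod R I =
    \<lparr>carrier = {f. (\<forall>i\<in>I. f i \<in> carrier R) \<and> (\<forall>i. i \<notin> I \<longrightarrow> f i = \<zero>\<^bsub>R\<^esub>) \<and> finite {i. f i \<noteq> \<zero>\<^bsub>R\<^esub>}},
     mult = undefined, one = undefined,
     zero = (\<lambda>i. \<zero>\<^bsub>R\<^esub>), add = (\<lambda>f g i. f i \<oplus>\<^bsub>R\<^esub> g i),
     smult = (\<lambda>r f i. r \<otimes>\<^bsub>R\<^esub> f i)\<rparr>"

text \<open>
  Projective means direct summand of a free module. Taking the basis to be indexed by a set of
  elements of the carrier type of \<open>P\<close> is no restriction: a direct summand of any free
  module is a direct summand of the free module on its own underlying set.
\<close>

definition projective :: "('r, 'z) ring_scheme \<Rightarrow> ('r, 'p) module \<Rightarrow> bool"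
  where "projective R P \<longleftrightarrow> left_module R P \<and>
    (\<exists>(I :: 'p set). \<exists>i \<in> mod_hom R P (free_mod R I). \<exists>q \<in> mod_hom R (free_mod R I) P.
      \<forall>x\<in>carrier P. q (i x) = x)"

section \<open>Algebras over a field\<close>

locale k_algebra = K?: field k + A?: ring A + module k A
  for k :: "('k, 'z) ring_scheme" (structure) and A :: "('k, 'a, 'y) module_scheme" (structure) +
  assumes smult_mult_left:
      "\<lbrakk>c \<in> carrier k; x \<in> carrier A; y \<in> carrier A\<rbrakk> \<Longrightarrow>
        (c \<odot>\<^bsub>A\<^esub> x) \<otimes>\<^bsub>A\<^esub> y = c \<odot>\<^bsub>A\<^esub> (x \<otimes>\<^bsub>A\<^esub> y)"
    and smult_mult_right:
      "\<lbrakk>c \<in> carrier k; x \<in> carrier A; y \<in> carrier A\<rbrakk> \<Longrightarrow>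
        x \<otimes>\<^bsub>A\<^esub> (c \<odot>\<^bsub>A\<^esub> y) = c \<odot>\<^bsub>A\<^esub> (x \<otimes>\<^bsub>A\<^esub> y)"

definition finite_dimensional :: "('k, 'z) ring_scheme \<Rightarrow> ('k, 'm) module \<Rightarrow> bool"
  where "finite_dimensional k M \<longleftrightarrow>
    (\<exists>S. finite S \<and> S \<subseteq> carrier M \<and> lin_span k M S = carrier M)"

definition op_alg :: "('k, 'a) module \<Rightarrow> ('k, 'a) module"
  where "op_alg A = A\<lparr>mult := (\<lambda>x y. y \<otimes>\<^bsub>A\<^esub> x)\<rparr>"

text \<open>The Jacobson radical: the intersection of all maximal left ideals.\<close>

definition maximal_left_ideal :: "('a, 'z) ring_scheme \<Rightarrow> 'a set \<Rightarrow> bool"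
  where "maximal_left_ideal A L \<longleftrightarrow>
    submodule L A (left_regular A) \<and> L \<noteq> carrier A \<and>
    (\<forall>J. submodule J A (left_regular A) \<longrightarrow> L \<subseteq> J \<longrightarrow> J = L \<or> J = carrier A)"

definition jacobson_radical :: "('a, 'z) ring_scheme \<Rightarrow> 'a set"
  where "jacobson_radical A = {x \<in> carrier A. \<forall>L. maximal_left_ideal A L \<longrightarrow> x \<in> L}"

definition commutator_space :: "('k, 'z) ring_scheme \<Rightarrow> ('k, 'a) module \<Rightarrow> 'a set"
  where "commutator_space k A =
    lin_span k A {x \<otimes>\<^bsub>A\<^esub> y \<ominus>\<^bsub>A\<^esub> y \<otimes>\<^bsub>A\<^esub> x | x y. x \<in> carrier A \<and> y \<in> carrier A}"

text \<open>
  The \<open>k\<close>-vector space of homomorphisms between left modules over a \<open>k\<close>-algebra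
  \<open>E\<close>, where \<open>k\<close> acts on modules through \<open>k \<rightarrow> E\<close>.
\<close>

definition hom_space ::
  "('k, 'e) module \<Rightarrow> ('e, 'u) module \<Rightarrow> ('e, 'v) module \<Rightarrow> ('k, 'u \<Rightarrow> 'v) module"
  where "hom_space E U V =
    \<lparr>carrier = mod_hom E U V, mult = undefined, one = undefined,
     zero = (\<lambda>x\<in>carrier U. \<zero>\<^bsub>V\<^esub>),
     add = (\<lambda>f g. \<lambda>x\<in>carrier U. f x \<oplus>\<^bsub>V\<^esub> g x),
     smult = (\<lambda>c f. \<lambda>x\<in>carrier U. (c \<odot>\<^bsub>E\<^esub> \<one>\<^bsub>E\<^esub>) \<odot>\<^bsub>V\<^esub> f x)\<rparr>"

text \<open>The dual \<open>D M = Hom\<^sub>k(M, k)\<close>.\<close>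

definition dual :: "('k, 'z) ring_scheme \<Rightarrow> ('k, 'm) module \<Rightarrow> ('k, 'm \<Rightarrow> 'k) module"
  where "dual k M = hom_space (left_regular k) M (left_regular k)"

section \<open>Tensor products and the enveloping algebra\<close>

text \<open>
  The tensor product algebra of \<open>A\<close> and \<open>B\<close> is the monoid algebra of the multiplicative
  monoid of \<open>A \<times> B\<close>, i.e. the free vector space on pairs with \<open>(a, b)(a', b') = (a a', b b')\<close>,
  modulo the bilinearity relations.
\<close>

definition monoid_alg :: "('k, 'z) ring_scheme \<Rightarrow> ('g, 'y) monoid_scheme \<Rightarrow> ('k, 'g \<Rightarrow> 'k) module"
  where "monoid_alg k G = (free_mod k (carrier G))
    \<lparr>mult := (\<lambda>f g p. \<Oplus>\<^bsub>k\<^esub>r \<in> {(q, q'). f q \<noteq> \<zero>\<^bsub>k\<^esub> \<and> g q' \<noteq> \<zero>\<^bsub>k\<^esub> \<and> q \<otimes>\<^bsub>G\<^esub> q' = p}.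
        f (fst r) \<otimes>\<^bsub>k\<^esub> g (snd r)),
     one := (\<lambda>p. if p = \<one>\<^bsub>G\<^esub> then \<one>\<^bsub>k\<^esub> else \<zero>\<^bsub>k\<^esub>)\<rparr>"

definition single :: "('k, 'z) ring_scheme \<Rightarrow> 'g \<Rightarrow> 'g \<Rightarrow> 'k"
  where "single k p = (\<lambda>q. if q = p then \<one>\<^bsub>k\<^esub> else \<zero>\<^bsub>k\<^esub>)"

definition tensor_rels ::
  "('k, 'z) ring_scheme \<Rightarrow> ('k, 'a) module \<Rightarrow> ('k, 'b) module \<Rightarrow> ('a \<times> 'b \<Rightarrow> 'k) set"
  where "tensor_rels k A B = (let F = monoid_alg k (A \<times>\<times> B); s = (\<lambda>x y. single k (x, y)) in
      {s (x \<oplus>\<^bsub>A\<^esub> x') y \<ominus>\<^bsub>F\<^esub> (s x y \<oplus>\<^bsub>F\<^esub> s x' y) | x x' y.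
        x \<in> carrier A \<and> x' \<in> carrier A \<and> y \<in> carrier B} \<union>
      {s x (y \<oplus>\<^bsub>B\<^esub> y') \<ominus>\<^bsub>F\<^esub> (s x y \<oplus>\<^bsub>F\<^esub> s x y') | x y y'.
        x \<in> carrier A \<and> y \<in> carrier B \<and> y' \<in> carrier B} \<union>
      {s (c \<odot>\<^bsub>A\<^esub> x) y \<ominus>\<^bsub>F\<^esub> c \<odot>\<^bsub>F\<^esub> s x y | c x y.
        c \<in> carrier k \<and> x \<in> carrier A \<and> y \<in> carrier B} \<union>
      {s x (c \<odot>\<^bsub>B\<^esub> y) \<ominus>\<^bsub>F\<^esub> c \<odot>\<^bsub>F\<^esub> s x y | c x y.
        c \<in> carrier k \<and> x \<in> carrier A \<and> y \<in> carrier B})"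

definition tensor_kernel ::
  "('k, 'z) ring_scheme \<Rightarrow> ('k, 'a) module \<Rightarrow> ('k, 'b) module \<Rightarrow> ('a \<times> 'b \<Rightarrow> 'k) set"
  where "tensor_kernel k A B = lin_span k (monoid_alg k (A \<times>\<times> B)) (tensor_rels k A B)"

definition tensor ::
  "('k, 'z) ring_scheme \<Rightarrow> ('k, 'a) module \<Rightarrow> ('k, 'b) module \<Rightarrow> ('k, ('a \<times> 'b \<Rightarrow> 'k) set) module"
  where "tensor k A B = quot_mod (monoid_alg k (A \<times>\<times> B)) (tensor_kernel k A B)"

definition pure_tensor ::
  "('k, 'z) ring_scheme \<Rightarrow> ('k, 'a) module \<Rightarrow> ('k, 'b) module \<Rightarrow> 'a \<Rightarrow> 'b \<Rightarrow> ('a \<times> 'b \<Rightarrow> 'k) set"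
  where "pure_tensor k A B x y =
    tensor_kernel k A B +>\<^bsub>monoid_alg k (A \<times>\<times> B)\<^esub> single k (x, y)"

definition env :: "('k, 'z) ring_scheme \<Rightarrow> ('k, 'a) module \<Rightarrow> ('k, ('a \<times> 'a \<Rightarrow> 'k) set) module"
  where "env k A = tensor k A (op_alg A)"

section \<open>Bimodules\<close>

record ('k, 'a, 'm) bimodule = "('k, 'm) module" +
  lact :: "'a \<Rightarrow> 'm \<Rightarrow> 'm"
  ract :: "'m \<Rightarrow> 'a \<Rightarrow> 'm"

text \<open>
  An \<open>A\<close>-bimodule as a left module over the enveloping algebra:
  \<open>(\<Sum> c\<^sub>i x\<^sub>i \<otimes> y\<^sub>i) m = \<Sum> c\<^sub>i x\<^sub>i m y\<^sub>i\<close>. An element \<open>t\<close> of the enveloping algebra is a coset of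
  finitely supported functions on pairs; for a bimodule the sum below is the same for every
  representative \<open>f \<in> t\<close>, so that the image is a singleton.
\<close>

definition env_mod ::
  "('k, 'z) ring_scheme \<Rightarrow> ('k, 'a) module \<Rightarrow> ('k, 'a, 'm) bimodule \<Rightarrow>
    (('a \<times> 'a \<Rightarrow> 'k) set, 'm) module"
  where "env_mod k A M =
    \<lparr>carrier = carrier M, mult = mult M, one = one M, zero = zero M, add = add M,
     smult = (\<lambda>t m. the_elem
       ((\<lambda>f. \<Oplus>\<^bsub>M\<^esub>p \<in> {p. f p \<noteq> \<zero>\<^bsub>k\<^esub>}. f p \<odot>\<^bsub>M\<^esub> lact M (fst p) (ract M m (snd p))) ` t))\<rparr>"

definition left_mod :: "('k, 'a, 'm) bimodule \<Rightarrow> ('a, 'm) module"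
  where "left_mod M =
    \<lparr>carrier = carrier M, mult = mult M, one = one M, zero = zero M, add = add M,
     smult = lact M\<rparr>"

text \<open>The bimodule \<open>\<^sub>1A\<^sub>\<nu>\<close>, with \<open>a \<cdot> x \<cdot> b = a x \<nu>(b)\<close>.\<close>

definition twisted_bimod :: "('k, 'a) module \<Rightarrow> ('a \<Rightarrow> 'a) \<Rightarrow> ('k, 'a, 'a) bimodule"
  where "twisted_bimod A \<nu> =
    \<lparr>carrier = carrier A, mult = mult A, one = one A, zero = zero A, add = add A,
     smult = smult A, lact = (\<lambda>a x. a \<otimes>\<^bsub>A\<^esub> x), ract = (\<lambda>x b. x \<otimes>\<^bsub>A\<^esub> \<nu> b)\<rparr>"

definition regular_bimod :: "('k, 'a) module \<Rightarrow> ('k, 'a, 'a) bimodule"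
  where "regular_bimod A = twisted_bimod A (\<lambda>x. x)"

text \<open>The bimodule \<open>D A\<close>, with \<open>(a f b)(x) = f(b x a)\<close>.\<close>

definition dual_bimod :: "('k, 'z) ring_scheme \<Rightarrow> ('k, 'a) module \<Rightarrow> ('k, 'a, 'a \<Rightarrow> 'k) bimodule"
  where "dual_bimod k A =
    \<lparr>carrier = carrier (dual k A), mult = mult (dual k A), one = one (dual k A),
     zero = zero (dual k A), add = add (dual k A), smult = smult (dual k A),
     lact = (\<lambda>a f. \<lambda>x\<in>carrier A. f (x \<otimes>\<^bsub>A\<^esub> a)),
     ract = (\<lambda>f b. \<lambda>x\<in>carrier A. f (b \<otimes>\<^bsub>A\<^esub> x))\<rparr>"

text \<open>\<open>A\<close> is separable if it is projective as a module over its enveloping algebra.\<close>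

definition separable_algebra :: "('k, 'z) ring_scheme \<Rightarrow> ('k, 'a) module \<Rightarrow> bool"
  where "separable_algebra k A \<longleftrightarrow>
    k_algebra k A \<and> projective (env k A) (env_mod k A (regular_bimod A))"

definition frobenius_algebra :: "('k, 'z) ring_scheme \<Rightarrow> ('k, 'a) module \<Rightarrow> bool"
  where "frobenius_algebra k A \<longleftrightarrow>
    k_algebra k A \<and> finite_dimensional k A \<and>
    mod_isomorphic A (left_regular A) (left_mod (dual_bimod k A))"

definition nakayama_automorphism ::
  "('k, 'z) ring_scheme \<Rightarrow> ('k, 'a) module \<Rightarrow> ('a \<Rightarrow> 'a) \<Rightarrow> bool"
  where "nakayama_automorphism k A \<nu> \<longleftrightarrow>
    \<nu> \<in> ring_iso A A \<and> (\<forall>c\<in>carrier k. \<forall>x\<in>carrier A. \<nu> (c \<odot>\<^bsub>A\<^esub> x) = c \<odot>\<^bsub>A\<^esub> \<nu> x) \<and>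
    mod_isomorphic (env k A) (env_mod k A (dual_bimod k A)) (env_mod k A (twisted_bimod A \<nu>))"

section \<open>Stable homomorphisms, twisted center and twisted Higman ideal\<close>

text \<open>
  The argument \<open>TYPE('p)\<close> is the universe: the projective modules range over those whose
  underlying set is a subset of \<open>'p\<close>. For \<open>'p = 'i \<Rightarrow> 'e\<close> these include
  all free \<open>E\<close>-modules with a basis indexed by a subset of \<open>'i\<close>, and their summands.
\<close>

definition proj_maps ::
  "'p itself \<Rightarrow> ('e, 'z) ring_scheme \<Rightarrow> ('e, 'u) module \<Rightarrow> ('e, 'v) module \<Rightarrow> ('u \<Rightarrow> 'v) set"
  where "proj_maps T E U V =
    {f. \<exists>(P :: ('e, 'p) module). projective E P \<and>
      (\<exists>g\<in>mod_hom E U P. \<exists>h\<in>mod_hom E P V. f = compose (carrier U) h g)}"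

definition stable_hom ::
  "'p itself \<Rightarrow> ('k, 'e) module \<Rightarrow> ('e, 'u) module \<Rightarrow> ('e, 'v) module \<Rightarrow> ('k, ('u \<Rightarrow> 'v) set) module"
  where "stable_hom T E U V = quot_mod (hom_space E U V) (proj_maps T E U V)"

definition twisted_center :: "('a, 'z) ring_scheme \<Rightarrow> ('a \<Rightarrow> 'a) \<Rightarrow> 'a set"
  where "twisted_center A \<nu> =
    {z \<in> carrier A. \<forall>a\<in>carrier A. z \<otimes>\<^bsub>A\<^esub> \<nu> a = a \<otimes>\<^bsub>A\<^esub> z}"

definition twisted_higman :: "('k, 'z) ring_scheme \<Rightarrow> ('k, 'a) module \<Rightarrow> ('a \<Rightarrow> 'a) \<Rightarrow> 'a set"
  where "twisted_higman k A \<nu> =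
    {(\<Oplus>\<^bsub>A\<^esub>i \<in> {..<n}. x i \<otimes>\<^bsub>A\<^esub> y i) | (n :: nat) x y.
      (\<forall>i<n. x i \<in> carrier A \<and> y i \<in> carrier A) \<and>
      (\<forall>a\<in>carrier A.
        (\<Oplus>\<^bsub>tensor k A A\<^esub>i \<in> {..<n}. pure_tensor k A A (a \<otimes>\<^bsub>A\<^esub> x i) (y i)) =
        (\<Oplus>\<^bsub>tensor k A A\<^esub>i \<in> {..<n}. pure_tensor k A A (x i) (y i \<otimes>\<^bsub>A\<^esub> \<nu> a)))}"

end

theory Submission
  imports Defs
begin

text \<open>
  Let \<open>\<phi> : DA \<rightarrow> \<^sub>1A\<^sub>\<nu>\<close> be a bimodule isomorphism. A bimodule map \<open>f : A \<rightarrow> DA\<close> is determined by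
  \<open>\<phi> (f 1)\<close>, which can be any element of the \<open>\<nu>\<close>-twisted center; and \<open>\<phi>\<close> identifies the elements
  of the twisted center with the functionals satisfying \<open>f (x y) = f (y x)\<close>, that is, with \<open>D(A/[A,A])\<close>.

  A bimodule map from \<open>A\<close> to a free \<open>A\<^sup>e\<close>-module is given by Casimir elements
  \<open>t = \<Sum> x\<^sub>i \<otimes> y\<^sub>i\<close>, \<open>a t = t a\<close>, and a map from the free module sends each of them to some
  \<open>t z = \<Sum> x\<^sub>i z \<nu>(y\<^sub>i)\<close> in \<open>\<^sub>1A\<^sub>\<nu>\<close>. This lies in the Higman ideal because
  \<open>\<Sum> x\<^sub>i z \<otimes> \<nu>(y\<^sub>i)\<close> is a twisted Casimir element. Conversely, applying \<open>\<nu>\<^sup>-\<^sup>1\<close> to the second factor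
  turns a twisted Casimir element into a Casimir element, and \<open>z = 1\<close> shows that each element of the
  Higman ideal comes from a map that factors through \<open>A\<^sup>e\<close> itself.
\<close>

section \<open>Linear maps and submodules\<close>

text \<open>Multiplicativity of \<nu> is what makes the two kinds of Casimir elements match: the
  linear map x \<otimes> y \<mapsto> x z \<otimes> \<nu>(y) commutes with left multiplication of the
  first factor by a, and turns right multiplication of the second factor by a into right
  multiplication by \<nu>(a). The balancing condition is thus carried along by linear maps, without
  touching a representing sum. Elements of A^e are cosets of finitely supported functions. A map out
  of A^e therefore has to come from a bilinear map, and two such maps are compared on pure tensors.
  The second factor of A^e is opposite, so that t a is the left multiple of t by 1 \<otimes> a. Maps
  through projectives are not added by forming direct sums. They turn out to be the preimage of the
  Higman ideal under f \<mapsto> \<phi> (f 1), and this is why they form a subspace.\<close>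

definition linear_map ::
  "('r, 'z) ring_scheme \<Rightarrow> ('r, 'u, 'x) module_scheme \<Rightarrow> ('r, 'v, 'y) module_scheme \<Rightarrow> ('u \<Rightarrow> 'v) \<Rightarrow> bool"
  where "linear_map R U V f \<longleftrightarrow> f \<in> carrier U \<rightarrow> carrier V \<and>
      (\<forall>x\<in>carrier U. \<forall>y\<in>carrier U. f (x \<oplus>\<^bsub>U\<^esub> y) = f x \<oplus>\<^bsub>V\<^esub> f y) \<and>
      (\<forall>r\<in>carrier R. \<forall>x\<in>carrier U. f (r \<odot>\<^bsub>U\<^esub> x) = r \<odot>\<^bsub>V\<^esub> f x)"

lemma linear_mapI:
  assumes "\<And>x. x \<in> carrier U \<Longrightarrow> f x \<in> carrier V"
    and "\<And>x y. \<lbrakk>x \<in> carrier U; y \<in> carrier U\<rbrakk> \<Longrightarrow> f (x \<oplus>\<^bsub>U\<^esub> y) = f x \<oplus>\<^bsub>V\<^esub> f y"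
    and "\<And>r x. \<lbrakk>r \<in> carrier R; x \<in> carrier U\<rbrakk> \<Longrightarrow> f (r \<odot>\<^bsub>U\<^esub> x) = r \<odot>\<^bsub>V\<^esub> f x"
  shows "linear_map R U V f"
  using assms by (auto simp: linear_map_def)

lemma linear_mapD:
  assumes "linear_map R U V f"
  shows linear_map_closed: "x \<in> carrier U \<Longrightarrow> f x \<in> carrier V"
    and linear_map_add: "\<lbrakk>x \<in> carrier U; y \<in> carrier U\<rbrakk> \<Longrightarrow> f (x \<oplus>\<^bsub>U\<^esub> y) = f x \<oplus>\<^bsub>V\<^esub> f y"
    and linear_map_smult: "\<lbrakk>r \<in> carrier R; x \<in> carrier U\<rbrakk> \<Longrightarrow> f (r \<odot>\<^bsub>U\<^esub> x) = r \<odot>\<^bsub>V\<^esub> f x"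
  using assms by (auto simp: linear_map_def)

text \<open>Splits off extensionality: composites of \<open>linear_map\<close>s need no
  \<open>restrict\<close>, so the arguments run on linear maps and pass to the extensional
  representative at the end.\<close>

lemma mod_hom_eq: "mod_hom R U V = {f. linear_map R U V f \<and> f \<in> extensional (carrier U)}"
  by (auto simp: mod_hom_def linear_map_def PiE_def)

lemma mod_hom_linear: "f \<in> mod_hom R U V \<Longrightarrow> linear_map R U V f"
  by (simp add: mod_hom_eq)

lemma mod_hom_extensional: "f \<in> mod_hom R U V \<Longrightarrow> f \<in> extensional (carrier U)"
  by (simp add: mod_hom_eq)

lemma linear_map_comp:
  "\<lbrakk>linear_map R U V f; linear_map R V W g\<rbrakk> \<Longrightarrow> linear_map R U W (\<lambda>x. g (f x))"
  by (auto simp: linear_map_def Pi_iff)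

lemma linear_map_inv_into:
  assumes f: "linear_map R U V f" and bij: "bij_betw f (carrier U) (carrier V)" and U: "left_module R U"
  shows "linear_map R V U (inv_into (carrier U) f)"
proof -
  interpret U: left_module R U by (rule U)
  let ?g = "inv_into (carrier U) f"
  have g: "?g y \<in> carrier U" "f (?g y) = y" if "y \<in> carrier V" for y
    using bij that by (auto simp: bij_betw_def intro: inv_into_into f_inv_into_f)
  have fg: "?g (f x) = x" if "x \<in> carrier U" for x
    using bij that by (simp add: bij_betw_def)
  show ?thesis
  proof (rule linear_mapI)
    fix x y assume xy: "x \<in> carrier V" "y \<in> carrier V"
    have "?g (x \<oplus>\<^bsub>V\<^esub> y) = ?g (f (?g x \<oplus>\<^bsub>U\<^esub> ?g y))"
      using xy g linear_map_add[OF f] by simp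
    then show "?g (x \<oplus>\<^bsub>V\<^esub> y) = ?g x \<oplus>\<^bsub>U\<^esub> ?g y" using fg g xy by simp
  next
    fix r x assume rx: "r \<in> carrier R" "x \<in> carrier V"
    have "?g (r \<odot>\<^bsub>V\<^esub> x) = ?g (f (r \<odot>\<^bsub>U\<^esub> ?g x))"
      using rx g linear_map_smult[OF f] by simp
    then show "?g (r \<odot>\<^bsub>V\<^esub> x) = r \<odot>\<^bsub>U\<^esub> ?g x" using fg g rx U.smult_closed by simp
  qed (use g in auto)
qed

lemma module_imp_left_module: "module R M \<Longrightarrow> left_module R M"
  by (auto simp: module_def left_module_def module_axioms_def left_module_axioms_def cring_def)

lemma left_module_imp_module: "\<lbrakk>cring R; left_module R M\<rbrakk> \<Longrightarrow> module R M"
  by (auto simp: module_def left_module_def module_axioms_def left_module_axioms_def)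

lemma left_moduleI:
  fixes R (structure) and M (structure)
  assumes "ring R" and "abelian_group M"
    and "\<And>r x. \<lbrakk>r \<in> carrier R; x \<in> carrier M\<rbrakk> \<Longrightarrow> r \<odot>\<^bsub>M\<^esub> x \<in> carrier M"
    and "\<And>r s x. \<lbrakk>r \<in> carrier R; s \<in> carrier R; x \<in> carrier M\<rbrakk> \<Longrightarrow>
      (r \<oplus> s) \<odot>\<^bsub>M\<^esub> x = r \<odot>\<^bsub>M\<^esub> x \<oplus>\<^bsub>M\<^esub> s \<odot>\<^bsub>M\<^esub> x"
    and "\<And>r x y. \<lbrakk>r \<in> carrier R; x \<in> carrier M; y \<in> carrier M\<rbrakk> \<Longrightarrow>
      r \<odot>\<^bsub>M\<^esub> (x \<oplus>\<^bsub>M\<^esub> y) = r \<odot>\<^bsub>M\<^esub> x \<oplus>\<^bsub>M\<^esub> r \<odot>\<^bsub>M\<^esub> y"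
    and "\<And>r s x. \<lbrakk>r \<in> carrier R; s \<in> carrier R; x \<in> carrier M\<rbrakk> \<Longrightarrow>
      (r \<otimes> s) \<odot>\<^bsub>M\<^esub> x = r \<odot>\<^bsub>M\<^esub> (s \<odot>\<^bsub>M\<^esub> x)"
    and "\<And>x. x \<in> carrier M \<Longrightarrow> \<one> \<odot>\<^bsub>M\<^esub> x = x"
  shows "left_module R M"
  using assms by (simp add: left_module_def left_module_axioms_def)

context left_module
begin

lemma smult_zero_left: "x \<in> carrier M \<Longrightarrow> \<zero>\<^bsub>R\<^esub> \<odot>\<^bsub>M\<^esub> x = \<zero>\<^bsub>M\<^esub>"
  by (metis M.add.r_cancel_one' R.zero_closed R.l_zero smult_closed smult_l_distr)

lemma smult_zero_right: "r \<in> carrier R \<Longrightarrow> r \<odot>\<^bsub>M\<^esub> \<zero>\<^bsub>M\<^esub> = \<zero>\<^bsub>M\<^esub>"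
  by (metis M.add.r_cancel_one' M.zero_closed M.l_zero smult_closed smult_r_distr)

lemma smult_neg_one: "x \<in> carrier M \<Longrightarrow> (\<ominus>\<^bsub>R\<^esub> \<one>\<^bsub>R\<^esub>) \<odot>\<^bsub>M\<^esub> x = \<ominus>\<^bsub>M\<^esub> x"
  by (metis M.add.inv_equality R.add.inv_closed R.l_neg R.one_closed smult_closed smult_l_distr
      smult_one smult_zero_left)

lemma minus_eq_zeroD:
  assumes "x \<ominus>\<^bsub>M\<^esub> y = \<zero>\<^bsub>M\<^esub>" and xy: "x \<in> carrier M" "y \<in> carrier M"
  shows "x = y"
proof -
  have "\<ominus>\<^bsub>M\<^esub> (\<ominus>\<^bsub>M\<^esub> y) = x"
    using assms by (intro M.minus_equality) (auto simp: a_minus_def)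
  then show ?thesis using xy M.minus_minus by simp
qed

text \<open>Closure under negatives is automatic, since -x = (-1) x.\<close>

lemma submoduleI:
  assumes "H \<subseteq> carrier M" and "\<zero>\<^bsub>M\<^esub> \<in> H"
    and "\<And>x y. \<lbrakk>x \<in> H; y \<in> H\<rbrakk> \<Longrightarrow> x \<oplus>\<^bsub>M\<^esub> y \<in> H"
    and "\<And>r x. \<lbrakk>r \<in> carrier R; x \<in> H\<rbrakk> \<Longrightarrow> r \<odot>\<^bsub>M\<^esub> x \<in> H"
  shows "submodule H R M"
proof (intro submodule.intro subgroup.intro submodule_axioms.intro)
  fix x assume "x \<in> H"
  then show "inv\<^bsub>add_monoid M\<^esub> x \<in> H"
    using assms(1,4) smult_neg_one[of x] by (metis R.add.inv_closed R.one_closed a_inv_def subsetD)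
qed (use assms in auto)

lemma submoduleD:
  assumes "submodule H R M"
  shows "H \<subseteq> carrier M" and "\<zero>\<^bsub>M\<^esub> \<in> H"
    and "\<lbrakk>x \<in> H; y \<in> H\<rbrakk> \<Longrightarrow> x \<oplus>\<^bsub>M\<^esub> y \<in> H"
    and "\<lbrakk>r \<in> carrier R; x \<in> H\<rbrakk> \<Longrightarrow> r \<odot>\<^bsub>M\<^esub> x \<in> H"
    and "x \<in> H \<Longrightarrow> \<ominus>\<^bsub>M\<^esub> x \<in> H"
  using assms by (auto simp: submodule_def subgroup_def submodule_axioms_def a_inv_def)

text \<open>The whole carrier is one of the submodules intersected, which keeps the intersection
  inside the carrier.\<close>

lemma lin_span_submodule:
  assumes "S \<subseteq> carrier M"
  shows "submodule (lin_span R M S) R M"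
proof (rule submoduleI)
  have "submodule (carrier M) R M"
    by (rule submoduleI) (auto simp: smult_closed)
  then show "lin_span R M S \<subseteq> carrier M"
    using assms by (auto simp: lin_span_def)
qed (auto simp: lin_span_def dest: submoduleD)

text \<open>Turns a subset into a module in its own right; the twisted center is used in this
  form.\<close>

lemma submodule_left_module:
  assumes "submodule H R M"
  shows "left_module R (M\<lparr>carrier := H\<rparr>)"
proof (rule left_moduleI)
  note D = submoduleD[OF assms]
  have sub: "x \<in> H \<Longrightarrow> x \<in> carrier M" for x using D(1) by auto
  show "abelian_group (M\<lparr>carrier := H\<rparr>)"
  proof (rule abelian_groupI)
    fix x assume "x \<in> carrier (M\<lparr>carrier := H\<rparr>)"
    then show "\<exists>y\<in>carrier (M\<lparr>carrier := H\<rparr>). y \<oplus>\<^bsub>M\<lparr>carrier := H\<rparr>\<^esub> x = \<zero>\<^bsub>M\<lparr>carrier := H\<rparr>\<^esub>"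
      using D(5) sub M.l_neg by auto
  qed (use D(2,3) sub in \<open>auto simp: M.a_ac\<close>)
qed (use submoduleD[OF assms] in \<open>auto simp: R.ring_axioms smult_l_distr smult_r_distr smult_assoc smult_one subset_iff\<close>)

end

lemma linear_map_zero:
  assumes "linear_map R U V f" "left_module R U" "left_module R V"
  shows "f \<zero>\<^bsub>U\<^esub> = \<zero>\<^bsub>V\<^esub>"
proof -
  interpret U: left_module R U by fact
  interpret V: left_module R V by fact
  show ?thesis
    by (metis U.l_zero U.zero_closed V.add.r_cancel_one' assms(1) linear_map_add linear_map_closed)
qed

lemma linear_map_a_inv:
  assumes "linear_map R U V f" "left_module R U" "left_module R V" "x \<in> carrier U"
  shows "f (\<ominus>\<^bsub>U\<^esub> x) = \<ominus>\<^bsub>V\<^esub> f x"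
proof -
  interpret U: left_module R U by fact
  interpret V: left_module R V by fact
  show ?thesis
    using assms linear_map_smult[OF assms(1), of "\<ominus>\<^bsub>R\<^esub> \<one>\<^bsub>R\<^esub>" x] linear_map_closed[OF assms(1)]
    by (simp add: U.smult_neg_one V.smult_neg_one)
qed

lemma linear_map_minus:
  assumes "linear_map R U V f" "left_module R U" "left_module R V" "x \<in> carrier U" "y \<in> carrier U"
  shows "f (x \<ominus>\<^bsub>U\<^esub> y) = f x \<ominus>\<^bsub>V\<^esub> f y"
proof -
  interpret U: left_module R U by fact
  interpret V: left_module R V by fact
  show ?thesis
    using assms linear_map_add[OF assms(1)] by (simp add: a_minus_def linear_map_a_inv[OF assms(1-3)])
qed

lemma linear_map_finsum:
  assumes f: "linear_map R U V f" and U: "left_module R U" and V: "left_module R V"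
    and "finite S" "g \<in> S \<rightarrow> carrier U"
  shows "f (\<Oplus>\<^bsub>U\<^esub>i\<in>S. g i) = (\<Oplus>\<^bsub>V\<^esub>i\<in>S. f (g i))"
proof -
  interpret U: left_module R U by fact
  interpret V: left_module R V by fact
  show ?thesis
    using assms(4,5)
    by (induction S rule: finite_induct)
      (auto simp: linear_map_zero[OF f U V] linear_map_add[OF f] linear_map_closed[OF f] Pi_iff)
qed

lemma submodule_vimage:
  assumes f: "linear_map R U V f" and U: "left_module R U" and V: "left_module R V"
    and N: "submodule N R V"
  shows "submodule {x \<in> carrier U. f x \<in> N} R U"
proof -
  interpret U: left_module R U by fact
  interpret V: left_module R V by fact
  show ?thesis
    by (rule U.submoduleI)
      (auto simp: linear_map_zero[OF f U V] linear_map_add[OF f] linear_map_smult[OF f] U.smult_closed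
        intro: V.submoduleD[OF N])
qed

lemma submodule_image:
  assumes f: "linear_map R U V f" and U: "left_module R U" and V: "left_module R V"
    and N: "submodule N R U"
  shows "submodule (f ` N) R V"
proof -
  interpret U: left_module R U by fact
  interpret V: left_module R V by fact
  note N = U.submoduleD[OF N]
  have sub: "x \<in> N \<Longrightarrow> x \<in> carrier U" for x using N(1) by auto
  show ?thesis
  proof (rule V.submoduleI)
    show "f ` N \<subseteq> carrier V" using sub linear_map_closed[OF f] by auto
    show "\<zero>\<^bsub>V\<^esub> \<in> f ` N" using N(2) linear_map_zero[OF f U V] by (metis imageI)
    show "x \<oplus>\<^bsub>V\<^esub> y \<in> f ` N" if "x \<in> f ` N" "y \<in> f ` N" for x y
      using that sub N(3) by (auto simp: linear_map_add[OF f, symmetric])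
    show "r \<odot>\<^bsub>V\<^esub> x \<in> f ` N" if "r \<in> carrier R" "x \<in> f ` N" for r x
      using that sub N(4) by (auto simp: linear_map_smult[OF f, symmetric])
  qed
qed

lemma submodule_equalizer:
  assumes f: "linear_map R U V f" and g: "linear_map R U V g"
    and U: "left_module R U" and V: "left_module R V"
  shows "submodule {x \<in> carrier U. f x = g x} R U"
proof -
  interpret U: left_module R U by fact
  interpret V: left_module R V by fact
  show ?thesis
    by (rule U.submoduleI)
      (auto simp: linear_map_zero[OF f U V] linear_map_zero[OF g U V] linear_map_add[OF f]
        linear_map_add[OF g] linear_map_smult[OF f] linear_map_smult[OF g] U.smult_closed)
qed

lemma lin_span_superset: "S \<subseteq> lin_span R M S"
  by (auto simp: lin_span_def)

lemma lin_span_least: "\<lbrakk>submodule N R M; S \<subseteq> N\<rbrakk> \<Longrightarrow> lin_span R M S \<subseteq> N"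
  by (auto simp: lin_span_def)

section \<open>Quotient modules\<close>

locale quotient = left_module R M for R and M (structure) + fixes N assumes N: "submodule N R M"
begin

lemma abelian_subgroup_N: "abelian_subgroup N M"
  using N by (intro abelian_subgroupI3 additive_subgroup.intro)
    (auto simp: submodule_def M.abelian_group_axioms)

sublocale N: abelian_subgroup N M by (rule abelian_subgroup_N)

lemma quot_carrier: "carrier (quot_mod M N) = (\<lambda>x. N +>\<^bsub>M\<^esub> x) ` carrier M"
  by (auto simp: quot_mod_def A_RCOSETS_def')

lemma quot_zero: "\<zero>\<^bsub>quot_mod M N\<^esub> = N"
  by (simp add: quot_mod_def)

lemma quot_add: "\<lbrakk>x \<in> carrier M; y \<in> carrier M\<rbrakk> \<Longrightarrow>
    (N +>\<^bsub>M\<^esub> x) \<oplus>\<^bsub>quot_mod M N\<^esub> (N +>\<^bsub>M\<^esub> y) = N +>\<^bsub>M\<^esub> (x \<oplus>\<^bsub>M\<^esub> y)"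
  by (simp add: quot_mod_def N.a_rcos_sum)

lemma coset_mem: "x \<in> carrier M \<Longrightarrow> y \<in> N +>\<^bsub>M\<^esub> x \<longleftrightarrow> y \<in> carrier M \<and> y \<ominus>\<^bsub>M\<^esub> x \<in> N"
  by (metis N.a_rcos_module N.a_elemrcos_carrier a_minus_def)

lemma coset_eq: "\<lbrakk>x \<in> carrier M; y \<in> carrier M\<rbrakk> \<Longrightarrow> N +>\<^bsub>M\<^esub> x = N +>\<^bsub>M\<^esub> y \<longleftrightarrow> x \<ominus>\<^bsub>M\<^esub> y \<in> N"
  using coset_mem N.a_repr_independence' N.a_repr_independenceD by metis

lemma coset_self: "x \<in> carrier M \<Longrightarrow> x \<in> N +>\<^bsub>M\<^esub> x"
  by (rule N.a_rcos_self)

text \<open>The scalar multiple in \<open>quot_mod\<close> is a union over all representatives y of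
  the coset. All cosets in this union agree, because r (y - x) lies in \<open>N\<close> whenever y -
  x does.\<close>

lemma quot_smult:
  assumes "r \<in> carrier R" "x \<in> carrier M"
  shows "r \<odot>\<^bsub>quot_mod M N\<^esub> (N +>\<^bsub>M\<^esub> x) = N +>\<^bsub>M\<^esub> (r \<odot>\<^bsub>M\<^esub> x)"
proof -
  have eq: "N +>\<^bsub>M\<^esub> (r \<odot>\<^bsub>M\<^esub> y) = N +>\<^bsub>M\<^esub> (r \<odot>\<^bsub>M\<^esub> x)" if y: "y \<in> N +>\<^bsub>M\<^esub> x" for y
  proof -
    have yc: "y \<in> carrier M" and "y \<ominus>\<^bsub>M\<^esub> x \<in> N" using y assms coset_mem by auto
    then have "r \<odot>\<^bsub>M\<^esub> (y \<ominus>\<^bsub>M\<^esub> x) \<in> N" using assms submoduleD[OF N] by auto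
    moreover have "r \<odot>\<^bsub>M\<^esub> (y \<ominus>\<^bsub>M\<^esub> x) = r \<odot>\<^bsub>M\<^esub> y \<ominus>\<^bsub>M\<^esub> r \<odot>\<^bsub>M\<^esub> x"
    proof -
      have "r \<odot>\<^bsub>M\<^esub> (\<ominus>\<^bsub>M\<^esub> x) \<oplus>\<^bsub>M\<^esub> r \<odot>\<^bsub>M\<^esub> x = \<zero>\<^bsub>M\<^esub>"
        using assms by (simp add: smult_r_distr[symmetric] M.l_neg smult_zero_right)
      then have "r \<odot>\<^bsub>M\<^esub> (\<ominus>\<^bsub>M\<^esub> x) = \<ominus>\<^bsub>M\<^esub> (r \<odot>\<^bsub>M\<^esub> x)"
        using assms by (intro M.minus_equality[symmetric]) (auto simp: smult_closed)
      then show ?thesis using assms yc by (simp add: a_minus_def smult_r_distr)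
    qed
    ultimately show ?thesis using assms yc by (simp add: coset_eq smult_closed)
  qed
  then have "(\<Union>y\<in>N +>\<^bsub>M\<^esub> x. N +>\<^bsub>M\<^esub> (r \<odot>\<^bsub>M\<^esub> y)) = N +>\<^bsub>M\<^esub> (r \<odot>\<^bsub>M\<^esub> x)"
    by (intro UN_constant_eq[OF coset_self[OF assms(2)]] ballI) (rule eq)
  then show ?thesis by (simp add: quot_mod_def)
qed

lemma quot_left_module: "left_module R (quot_mod M N)"
proof (rule left_moduleI)
  show "abelian_group (quot_mod M N)"
  proof (rule abelian_groupI)
    have "\<zero>\<^bsub>quot_mod M N\<^esub> = N +>\<^bsub>M\<^esub> \<zero>\<^bsub>M\<^esub>"
      using N.a_rcos_const[OF N.zero_closed] by (simp add: quot_zero)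
    then have z: "\<zero>\<^bsub>quot_mod M N\<^esub> = N +>\<^bsub>M\<^esub> \<zero>\<^bsub>M\<^esub>" .
    then show "\<zero>\<^bsub>quot_mod M N\<^esub> \<in> carrier (quot_mod M N)"
      by (simp add: quot_carrier)
    fix x assume "x \<in> carrier (quot_mod M N)"
    then obtain u where u: "u \<in> carrier M" "x = N +>\<^bsub>M\<^esub> u" by (auto simp: quot_carrier)
    then show "\<zero>\<^bsub>quot_mod M N\<^esub> \<oplus>\<^bsub>quot_mod M N\<^esub> x = x" by (simp add: z quot_add)
    from u show "\<exists>y\<in>carrier (quot_mod M N). y \<oplus>\<^bsub>quot_mod M N\<^esub> x = \<zero>\<^bsub>quot_mod M N\<^esub>"
      by (auto simp: z quot_add quot_carrier M.l_neg intro!: bexI[of _ "\<ominus>\<^bsub>M\<^esub> u"])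
  qed (auto simp: quot_carrier quot_add M.a_ac)
qed (auto simp: R.ring_axioms quot_carrier quot_add quot_smult smult_closed smult_l_distr smult_r_distr
    smult_assoc smult_one)

lemma linear_map_proj: "linear_map R M (quot_mod M N) (\<lambda>x. N +>\<^bsub>M\<^esub> x)"
  by (rule linear_mapI) (auto simp: quot_carrier quot_add quot_smult)

text \<open>A linear map that kills \<open>N\<close> is constant on each coset, so its image of a
  coset is a singleton and \<open>the_elem\<close> reads off the value. The induced map has this
  form in order to match the action in \<open>env_mod\<close>.\<close>

lemma quot_factor:
  assumes g: "linear_map R M V g" and V: "left_module R V" and ker: "\<And>x. x \<in> N \<Longrightarrow> g x = \<zero>\<^bsub>V\<^esub>"
  shows quot_factor_proj: "x \<in> carrier M \<Longrightarrow> the_elem (g ` (N +>\<^bsub>M\<^esub> x)) = g x"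
    and linear_map_quot_factor: "linear_map R (quot_mod M N) V (\<lambda>C. the_elem (g ` C))"
proof -
  interpret V: left_module R V by fact
  have *: "the_elem (g ` (N +>\<^bsub>M\<^esub> x)) = g x" if x: "x \<in> carrier M" for x
  proof -
    have "g y = g x" if y: "y \<in> N +>\<^bsub>M\<^esub> x" for y
    proof -
      have yc: "y \<in> carrier M" "y \<ominus>\<^bsub>M\<^esub> x \<in> N" using x y coset_mem by auto
      then have "g y \<ominus>\<^bsub>V\<^esub> g x = \<zero>\<^bsub>V\<^esub>"
        using linear_map_minus[OF g left_module_axioms V, of y x] ker[of "y \<ominus>\<^bsub>M\<^esub> x"] x by simp
      then show ?thesis
        by (rule V.minus_eq_zeroD) (use x yc(1) linear_map_closed[OF g] in auto)
    qed
    then have "g ` (N +>\<^bsub>M\<^esub> x) = {g x}" using coset_self[OF x] by blast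
    then show ?thesis by simp
  qed
  then show "x \<in> carrier M \<Longrightarrow> the_elem (g ` (N +>\<^bsub>M\<^esub> x)) = g x" .
  show "linear_map R (quot_mod M N) V (\<lambda>C. the_elem (g ` C))"
    by (rule linear_mapI) (auto simp: quot_carrier quot_add quot_smult * smult_closed linear_map_closed[OF g]
        linear_map_add[OF g] linear_map_smult[OF g])
qed

end

lemma mod_isomorphicI:
  assumes f: "linear_map R U V f" and bij: "bij_betw f (carrier U) (carrier V)" and U: "left_module R U"
  shows "mod_isomorphic R U V"
proof -
  interpret left_module R U by fact
  have "restrict f (carrier U) \<in> mod_hom R U V"
    using f by (auto simp: mod_hom_def linear_map_def smult_closed)
  then show ?thesis using bij bij_betw_restrict_eq unfolding mod_isomorphic_def by blast
qed

lemma mod_isomorphic_sym: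
  assumes "mod_isomorphic R U V" and U: "left_module R U" and V: "left_module R V"
  shows "mod_isomorphic R V U"
proof -
  obtain f where "f \<in> mod_hom R U V" and f: "bij_betw f (carrier U) (carrier V)"
    using assms by (auto simp: mod_isomorphic_def)
  then show ?thesis
    using linear_map_inv_into[OF _ f U] bij_betw_inv_into[OF f] V
    by (intro mod_isomorphicI) (auto simp: mod_hom_linear)
qed

text \<open>The induced map is the image operation on cosets: additivity sends N + x to f(N) + f(x),
  and an injective f is injective on subsets of the carrier, so neither representatives nor kernels
  are needed.\<close>

lemma quot_mod_isomorphic:
  assumes f: "linear_map R U V f" and bij: "bij_betw f (carrier U) (carrier V)"
    and U: "left_module R U" and V: "left_module R V"
    and N: "submodule N R U"
  shows "mod_isomorphic R (quot_mod U N) (quot_mod V (f ` N))"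
proof -
  interpret U: quotient R U N using U N by (simp add: quotient_def quotient_axioms_def)
  interpret V: quotient R V "f ` N"
    using V submodule_image[OF f U V N] by (simp add: quotient_def quotient_axioms_def)
  have img: "f ` (N +>\<^bsub>U\<^esub> x) = f ` N +>\<^bsub>V\<^esub> f x" if "x \<in> carrier U" for x
    using that U.submoduleD(1)[OF N] by (force simp: a_r_coset_def' linear_map_add[OF f])
  have "linear_map R (quot_mod U N) (quot_mod V (f ` N)) (\<lambda>C. f ` C)"
  proof (rule linear_mapI)
    fix C D assume "C \<in> carrier (quot_mod U N)" "D \<in> carrier (quot_mod U N)"
    then show "f ` (C \<oplus>\<^bsub>quot_mod U N\<^esub> D) = f ` C \<oplus>\<^bsub>quot_mod V (f ` N)\<^esub> f ` D"
      unfolding U.quot_carrier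
      by (elim imageE) (simp add: U.quot_add img V.quot_add linear_map_closed[OF f] linear_map_add[OF f])
  next
    fix r C assume "r \<in> carrier R" "C \<in> carrier (quot_mod U N)"
    then show "f ` (r \<odot>\<^bsub>quot_mod U N\<^esub> C) = r \<odot>\<^bsub>quot_mod V (f ` N)\<^esub> f ` C"
      unfolding U.quot_carrier
      by (elim imageE) (simp add: U.quot_smult img V.quot_smult linear_map_closed[OF f]
          linear_map_smult[OF f] U.smult_closed)
  qed (auto simp: U.quot_carrier img V.quot_carrier linear_map_closed[OF f])
  moreover have "bij_betw (\<lambda>C. f ` C) (carrier (quot_mod U N)) (carrier (quot_mod V (f ` N)))"
    unfolding bij_betw_def
  proof
    have sub: "C \<subseteq> carrier U" if "C \<in> carrier (quot_mod U N)" for C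
      using that by (auto simp: U.quot_carrier U.coset_mem)
    then show "inj_on (\<lambda>C. f ` C) (carrier (quot_mod U N))"
    proof (intro inj_onI)
      fix C D assume "C \<in> carrier (quot_mod U N)" "D \<in> carrier (quot_mod U N)" "f ` C = f ` D"
      then show "C = D"
        using inj_on_image_eq_iff[of f "carrier U" C D] bij sub by (simp add: bij_betw_def)
    qed
    have "(\<lambda>C. f ` C) ` carrier (quot_mod U N) = (\<lambda>x. f ` N +>\<^bsub>V\<^esub> f x) ` carrier U"
      unfolding U.quot_carrier image_image by (intro image_cong refl img)
    also have "\<dots> = carrier (quot_mod V (f ` N))"
    proof -
      have "f ` carrier U = carrier V" using bij by (simp add: bij_betw_def)
      from this[symmetric] show ?thesis unfolding V.quot_carrier by (simp add: image_image)
    qed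
    finally show "(\<lambda>C. f ` C) ` carrier (quot_mod U N) = carrier (quot_mod V (f ` N))" .
  qed
  ultimately show ?thesis by (rule mod_isomorphicI) (rule U.quot_left_module)
qed

section \<open>Free modules and monoid algebras\<close>

text \<open>The sum is taken over the support of f, as in the action of \<open>env_mod\<close>,
  which can thus be recognized as a linear extension by unfolding.\<close>

definition lin_ext ::
  "('r, 'z) ring_scheme \<Rightarrow> ('r, 'm, 'y) module_scheme \<Rightarrow> ('i \<Rightarrow> 'm) \<Rightarrow> ('i \<Rightarrow> 'r) \<Rightarrow> 'm"
  where "lin_ext R M g f = (\<Oplus>\<^bsub>M\<^esub>p \<in> {p. f p \<noteq> \<zero>\<^bsub>R\<^esub>}. f p \<odot>\<^bsub>M\<^esub> g p)"

lemma free_mod_simps [simp]: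
  "\<zero>\<^bsub>free_mod R I\<^esub> = (\<lambda>i. \<zero>\<^bsub>R\<^esub>)"
  "f \<oplus>\<^bsub>free_mod R I\<^esub> g = (\<lambda>i. f i \<oplus>\<^bsub>R\<^esub> g i)"
  "r \<odot>\<^bsub>free_mod R I\<^esub> f = (\<lambda>i. r \<otimes>\<^bsub>R\<^esub> f i)"
  by (simp_all add: free_mod_def)

context ring
begin

lemma free_mod_carrier: "f \<in> carrier (free_mod R I) \<longleftrightarrow>
    (\<forall>i. f i \<in> carrier R) \<and> (\<forall>i. f i \<noteq> \<zero> \<longrightarrow> i \<in> I) \<and> finite {i. f i \<noteq> \<zero>}"
  by (auto simp: free_mod_def)

lemma free_mod_left_module: "left_module R (free_mod R I)"
proof (rule left_moduleI)
  show "abelian_group (free_mod R I)"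
  proof (rule abelian_groupI)
    fix f assume f: "f \<in> carrier (free_mod R I)"
    have "(\<lambda>i. \<ominus> f i) \<in> carrier (free_mod R I)"
    proof -
      have "{i. \<ominus> f i \<noteq> \<zero>} \<subseteq> {i. f i \<noteq> \<zero>}" by auto
      then show ?thesis using f by (auto simp: free_mod_carrier intro: finite_subset)
    qed
    then show "\<exists>g\<in>carrier (free_mod R I). g \<oplus>\<^bsub>free_mod R I\<^esub> f = \<zero>\<^bsub>free_mod R I\<^esub>"
      using f by (intro bexI[of _ "\<lambda>i. \<ominus> f i"]) (auto simp: free_mod_carrier l_neg)
    fix g assume g: "g \<in> carrier (free_mod R I)"
    have "{i. f i \<oplus> g i \<noteq> \<zero>} \<subseteq> {i. f i \<noteq> \<zero>} \<union> {i. g i \<noteq> \<zero>}" by auto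
    moreover have "i \<in> I" if "f i \<oplus> g i \<noteq> \<zero>" for i
      using that f g by (cases "f i = \<zero>") (auto simp: free_mod_carrier)
    ultimately show "f \<oplus>\<^bsub>free_mod R I\<^esub> g \<in> carrier (free_mod R I)"
      using f g by (auto simp: free_mod_carrier intro: finite_subset)
  qed (auto simp: free_mod_carrier a_ac)
next
  fix r f assume rf: "r \<in> carrier R" "f \<in> carrier (free_mod R I)"
  have "{i. r \<otimes> f i \<noteq> \<zero>} \<subseteq> {i. f i \<noteq> \<zero>}" using rf by auto
  moreover have "i \<in> I" if "r \<otimes> f i \<noteq> \<zero>" for i
    using that rf by (cases "f i = \<zero>") (auto simp: free_mod_carrier)
  ultimately show "r \<odot>\<^bsub>free_mod R I\<^esub> f \<in> carrier (free_mod R I)"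
    using rf by (auto simp: free_mod_carrier intro: finite_subset)
qed (auto simp: ring_axioms free_mod_carrier l_distr r_distr m_assoc)

lemma single_closed: "p \<in> I \<Longrightarrow> single R p \<in> carrier (free_mod R I)"
proof -
  assume p: "p \<in> I"
  have "{i. single R p i \<noteq> \<zero>} \<subseteq> {p}" by (auto simp: single_def)
  then show ?thesis using p by (auto simp: free_mod_carrier single_def intro: finite_subset)
qed

text \<open>Induction on the size of the support: resetting one nonzero coordinate to zero removes
  one point, and the function is recovered by adding a multiple of a basis element.\<close>

lemma free_mod_induct [consumes 1, case_names zero add]:
  assumes "f \<in> carrier (free_mod R I)"
    and zero: "P \<zero>\<^bsub>free_mod R I\<^esub>"
    and add: "\<And>f c p. \<lbrakk>f \<in> carrier (free_mod R I); c \<in> carrier R; p \<in> I; P f\<rbrakk> \<Longrightarrow>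
      P (f \<oplus>\<^bsub>free_mod R I\<^esub> c \<odot>\<^bsub>free_mod R I\<^esub> single R p)"
  shows "P f"
  using assms(1)
proof (induction "card {i. f i \<noteq> \<zero>}" arbitrary: f rule: less_induct)
  case less
  show ?case
  proof (cases "\<exists>p. f p \<noteq> \<zero>")
    case False
    then have "f = \<zero>\<^bsub>free_mod R I\<^esub>" by auto
    then show ?thesis using zero by simp
  next
    case True
    then obtain p where p: "f p \<noteq> \<zero>" by auto
    let ?g = "f(p := \<zero>)"
    have g_supp: "{i. ?g i \<noteq> \<zero>} = {i. f i \<noteq> \<zero>} - {p}" by auto
    have fin: "finite {i. f i \<noteq> \<zero>}" using less.prems by (simp add: free_mod_carrier)
    have g: "?g \<in> carrier (free_mod R I)"
      using less.prems unfolding free_mod_carrier g_supp by auto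
    have "P ?g"
      by (rule less.hyps[OF _ g]) (use p fin in \<open>unfold g_supp, intro card_Diff1_less, auto\<close>)
    moreover have "f = ?g \<oplus>\<^bsub>free_mod R I\<^esub> f p \<odot>\<^bsub>free_mod R I\<^esub> single R p"
      using less.prems by (auto simp: single_def free_mod_carrier)
    moreover have "p \<in> I" "f p \<in> carrier R" using p less.prems by (auto simp: free_mod_carrier)
    ultimately show ?thesis using add[OF g, of "f p" p] by simp
  qed
qed

end

lemma linear_map_free_mod_eqI:
  assumes f: "linear_map R (free_mod R I) V f" and g: "linear_map R (free_mod R I) V g"
    and V: "left_module R V"
    and "\<And>p. p \<in> I \<Longrightarrow> f (single R p) = g (single R p)"
    and x: "x \<in> carrier (free_mod R I)"
  shows "f x = g x"
proof -
  interpret V: left_module R V by fact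
  note F = V.R.free_mod_left_module[of I]
  interpret F: left_module R "free_mod R I" by (rule F)
  from x show ?thesis
  proof (induction rule: V.R.free_mod_induct)
    case zero
    show ?case by (simp only: linear_map_zero[OF f F V] linear_map_zero[OF g F V])
  next
    case (add x c p)
    then show ?case
      using V.R.single_closed[of p I] F.smult_closed assms(4)
      by (simp only: linear_map_add[OF f] linear_map_add[OF g] linear_map_smult[OF f] linear_map_smult[OF g])
  qed
qed

context left_module
begin

text \<open>The supports of f, h and f + h differ. Their sums can be compared once all of them range
  over one common finite index set, the added terms being zero.\<close>

lemma lin_ext_superset:
  assumes f: "f \<in> carrier (free_mod R I)" and g: "g \<in> I \<rightarrow> carrier M"
    and S: "finite S" "S \<subseteq> I" "\<And>p. f p \<noteq> \<zero>\<^bsub>R\<^esub> \<Longrightarrow> p \<in> S"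
  shows "lin_ext R M g f = (\<Oplus>\<^bsub>M\<^esub>p\<in>S. f p \<odot>\<^bsub>M\<^esub> g p)"
  unfolding lin_ext_def
  using assms
  by (intro M.add.finprod_mono_neutral_cong_left)
    (auto simp: R.free_mod_carrier smult_zero_left smult_closed Pi_iff subset_iff)

lemma lin_ext_linear:
  assumes g: "g \<in> I \<rightarrow> carrier M"
  shows "linear_map R (free_mod R I) M (lin_ext R M g)"
proof (rule linear_mapI)
  have gI: "p \<in> I \<Longrightarrow> g p \<in> carrier M" for p using g by auto
  interpret F: left_module R "free_mod R I" by (rule R.free_mod_left_module)
  show "lin_ext R M g f \<in> carrier M" if "f \<in> carrier (free_mod R I)" for f
    using that gI unfolding lin_ext_def by (intro M.finsum_closed) (auto simp: R.free_mod_carrier smult_closed)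
  show "lin_ext R M g (f \<oplus>\<^bsub>free_mod R I\<^esub> h) = lin_ext R M g f \<oplus>\<^bsub>M\<^esub> lin_ext R M g h"
    if f: "f \<in> carrier (free_mod R I)" and h: "h \<in> carrier (free_mod R I)" for f h
  proof -
    let ?S = "{p. f p \<noteq> \<zero>\<^bsub>R\<^esub>} \<union> {p. h p \<noteq> \<zero>\<^bsub>R\<^esub>}"
    have S: "finite ?S" "?S \<subseteq> I" using f h by (auto simp: R.free_mod_carrier)
    have "lin_ext R M g (f \<oplus>\<^bsub>free_mod R I\<^esub> h) = (\<Oplus>\<^bsub>M\<^esub>p\<in>?S. (f p \<oplus>\<^bsub>R\<^esub> h p) \<odot>\<^bsub>M\<^esub> g p)"
      using f h by (subst lin_ext_superset[OF F.a_closed[OF f h] g S]) (auto simp: R.free_mod_carrier)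
    also have "\<dots> = (\<Oplus>\<^bsub>M\<^esub>p\<in>?S. f p \<odot>\<^bsub>M\<^esub> g p \<oplus>\<^bsub>M\<^esub> h p \<odot>\<^bsub>M\<^esub> g p)"
      using f h S gI
      by (intro M.finsum_cong') (auto simp: R.free_mod_carrier smult_l_distr smult_closed)
    also have "\<dots> = lin_ext R M g f \<oplus>\<^bsub>M\<^esub> lin_ext R M g h"
      using f h S gI lin_ext_superset[OF f g S] lin_ext_superset[OF h g S]
      by (subst M.finsum_addf) (auto simp: R.free_mod_carrier smult_closed)
    finally show ?thesis .
  qed
  show "lin_ext R M g (r \<odot>\<^bsub>free_mod R I\<^esub> f) = r \<odot>\<^bsub>M\<^esub> lin_ext R M g f"
    if r: "r \<in> carrier R" and f: "f \<in> carrier (free_mod R I)" for r f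
  proof -
    let ?S = "{p. f p \<noteq> \<zero>\<^bsub>R\<^esub>}"
    have S: "finite ?S" "?S \<subseteq> I" using f by (auto simp: R.free_mod_carrier)
    have "lin_ext R M g (r \<odot>\<^bsub>free_mod R I\<^esub> f) = (\<Oplus>\<^bsub>M\<^esub>p\<in>?S. (r \<otimes>\<^bsub>R\<^esub> f p) \<odot>\<^bsub>M\<^esub> g p)"
      using f r by (subst lin_ext_superset[OF F.smult_closed[OF r f] g S]) (auto simp: R.free_mod_carrier)
    also have "\<dots> = (\<Oplus>\<^bsub>M\<^esub>p\<in>?S. r \<odot>\<^bsub>M\<^esub> (f p \<odot>\<^bsub>M\<^esub> g p))"
      using f S gI r
      by (intro M.finsum_cong') (auto simp: R.free_mod_carrier smult_assoc smult_closed)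
    also have "\<dots> = r \<odot>\<^bsub>M\<^esub> (\<Oplus>\<^bsub>M\<^esub>p\<in>?S. f p \<odot>\<^bsub>M\<^esub> g p)"
    proof -
      have "(\<Oplus>\<^bsub>M\<^esub>p\<in>T. r \<odot>\<^bsub>M\<^esub> (f p \<odot>\<^bsub>M\<^esub> g p)) = r \<odot>\<^bsub>M\<^esub> (\<Oplus>\<^bsub>M\<^esub>p\<in>T. f p \<odot>\<^bsub>M\<^esub> g p)"
        if "finite T" "T \<subseteq> I" for T
        using that f r gI
        by (induction T rule: finite_induct)
          (auto simp: smult_zero_right smult_r_distr smult_closed R.free_mod_carrier Pi_iff subset_iff)
      then show ?thesis using S by auto
    qed
    finally show ?thesis by (simp add: lin_ext_def)
  qed
qed

lemma lin_ext_single: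
  assumes "g \<in> I \<rightarrow> carrier M" "p \<in> I"
  shows "lin_ext R M g (single R p) = g p"
proof -
  have "lin_ext R M g (single R p) = (\<Oplus>\<^bsub>M\<^esub>q\<in>{p}. single R p q \<odot>\<^bsub>M\<^esub> g q)"
    using assms by (intro lin_ext_superset R.single_closed) (auto simp: single_def split: if_splits)
  then show ?thesis using assms by (simp add: single_def smult_one Pi_iff)
qed

end

section \<open>Monoid algebras and their convolution product\<close>

lemma monoid_alg_simps [simp]:
  "carrier (monoid_alg k G) = carrier (free_mod k (carrier G))"
  "\<zero>\<^bsub>monoid_alg k G\<^esub> = \<zero>\<^bsub>free_mod k (carrier G)\<^esub>"
  "add (monoid_alg k G) = add (free_mod k (carrier G))"
  "smult (monoid_alg k G) = smult (free_mod k (carrier G))"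
  "\<one>\<^bsub>monoid_alg k G\<^esub> = single k \<one>\<^bsub>G\<^esub>"
  by (simp_all add: monoid_alg_def single_def)

lemma abelian_group_transfer:
  assumes "abelian_group M" and "carrier M' = carrier M" "zero M' = zero M" "add M' = add M"
  shows "abelian_group M'"
proof -
  interpret abelian_group M by fact
  show ?thesis
    by (rule abelian_groupI) (use assms l_neg in \<open>auto simp: a_ac\<close>)
qed

lemma left_module_transfer:
  assumes "left_module R M" and "carrier M' = carrier M" "zero M' = zero M" "add M' = add M"
    and "\<And>r x. \<lbrakk>r \<in> carrier R; x \<in> carrier M\<rbrakk> \<Longrightarrow> smult M' r x = smult M r x"
  shows "left_module R M'"
proof -
  interpret left_module R M by fact
  show ?thesis
    by (rule left_moduleI) (use assms abelian_group_transfer[OF M.abelian_group_axioms assms(2-4)]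
      in \<open>auto simp: R.ring_axioms smult_closed smult_l_distr smult_r_distr smult_assoc smult_one\<close>)
qed

locale monoid_algebra = K: cring k + G: monoid G for k (structure) and G (structure)
begin

abbreviation "F \<equiv> monoid_alg k G"

sublocale F: left_module k F
  by (rule left_module_transfer[OF K.free_mod_left_module]) auto

lemma linear_map_F: "linear_map k F V = linear_map k (free_mod k (carrier G)) V"
  by (intro ext) (simp add: linear_map_def)

lemma single_closed': "p \<in> carrier G \<Longrightarrow> single k p \<in> carrier F"
  by (simp add: K.single_closed)

lemma F_induct [consumes 1, case_names zero add]:
  assumes "f \<in> carrier F" and "P \<zero>\<^bsub>F\<^esub>"
    and "\<And>f c p. \<lbrakk>f \<in> carrier F; c \<in> carrier k; p \<in> carrier G; P f\<rbrakk> \<Longrightarrow>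
      P (f \<oplus>\<^bsub>F\<^esub> c \<odot>\<^bsub>F\<^esub> single k p)"
  shows "P f"
  using K.free_mod_induct[of f "carrier G" P] assms by simp

lemma F_eqI:
  assumes "linear_map k F V f" "linear_map k F V g" "left_module k V"
    and "\<And>p. p \<in> carrier G \<Longrightarrow> f (single k p) = g (single k p)" and "x \<in> carrier F"
  shows "f x = g x"
  using linear_map_free_mod_eqI[of k "carrier G" V f g x] assms by (simp add: linear_map_F)

text \<open>Replaces the index set of the convolution, which depends on p and on the exact supports,
  by a fixed rectangle. Products with different factors then become sums over the same set and can
  be added term by term.\<close>

lemma F_mult_superset:
  assumes f: "f \<in> carrier F" and g: "g \<in> carrier F"
    and S: "finite S" "S \<subseteq> carrier G" "\<And>q. f q \<noteq> \<zero>\<^bsub>k\<^esub> \<Longrightarrow> q \<in> S"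
    and T: "finite T" "T \<subseteq> carrier G" "\<And>q. g q \<noteq> \<zero>\<^bsub>k\<^esub> \<Longrightarrow> q \<in> T"
  shows "(f \<otimes>\<^bsub>F\<^esub> g) p = (\<Oplus>\<^bsub>k\<^esub>r\<in>S \<times> T. if fst r \<otimes>\<^bsub>G\<^esub> snd r = p then f (fst r) \<otimes>\<^bsub>k\<^esub> g (snd r) else \<zero>\<^bsub>k\<^esub>)"
  unfolding monoid_alg_def
  using assms
  by (simp, intro K.add.finprod_mono_neutral_cong_left) (auto simp: K.free_mod_carrier)

lemma supp:
  assumes "f \<in> carrier F"
  shows "finite {q. f q \<noteq> \<zero>\<^bsub>k\<^esub>}" "{q. f q \<noteq> \<zero>\<^bsub>k\<^esub>} \<subseteq> carrier G" "f q \<in> carrier k"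
  using assms by (auto simp: K.free_mod_carrier)

text \<open>Outside the finite set of products of support points every term of the convolution
  vanishes.\<close>

lemma F_mult_closed:
  assumes f: "f \<in> carrier F" and g: "g \<in> carrier F"
  shows "f \<otimes>\<^bsub>F\<^esub> g \<in> carrier F"
proof -
  let ?S = "{q. f q \<noteq> \<zero>\<^bsub>k\<^esub>}" and ?T = "{q. g q \<noteq> \<zero>\<^bsub>k\<^esub>}"
  let ?P = "(\<lambda>r. fst r \<otimes>\<^bsub>G\<^esub> snd r) ` (?S \<times> ?T)"
  note e = F_mult_superset[OF f g supp(1,2)[OF f] _ supp(1,2)[OF g]]
  have "(f \<otimes>\<^bsub>F\<^esub> g) p = \<zero>\<^bsub>k\<^esub>" if "p \<notin> ?P" for p
    using that by (subst e) (force intro!: K.add.finprod_one_eqI)+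
  then have "{p. (f \<otimes>\<^bsub>F\<^esub> g) p \<noteq> \<zero>\<^bsub>k\<^esub>} \<subseteq> ?P" by blast
  moreover have "finite ?P" using supp(1)[OF f] supp(1)[OF g] by auto
  moreover have "?P \<subseteq> carrier G" using supp(2)[OF f] supp(2)[OF g] by (auto simp: subset_iff)
  moreover have "(f \<otimes>\<^bsub>F\<^esub> g) p \<in> carrier k" for p
    using supp(3)[OF f] supp(3)[OF g] by (subst e) (auto intro!: K.finsum_closed)
  ultimately show ?thesis by (auto simp: K.free_mod_carrier intro: finite_subset)
qed

lemma F_mult_linear_left:
  assumes g: "g \<in> carrier F"
  shows "linear_map k F F (\<lambda>f. f \<otimes>\<^bsub>F\<^esub> g)"
proof (rule linear_mapI)
  let ?T = "{q. g q \<noteq> \<zero>\<^bsub>k\<^esub>}"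
  fix f h assume f: "f \<in> carrier F" and h: "h \<in> carrier F"
  let ?S = "{q. f q \<noteq> \<zero>\<^bsub>k\<^esub>} \<union> {q. h q \<noteq> \<zero>\<^bsub>k\<^esub>}"
  have S: "finite ?S" "?S \<subseteq> carrier G" using supp[OF f] supp[OF h] by auto
  note T = supp(1,2)[OF g]
  show "(f \<oplus>\<^bsub>F\<^esub> h) \<otimes>\<^bsub>F\<^esub> g = f \<otimes>\<^bsub>F\<^esub> g \<oplus>\<^bsub>F\<^esub> h \<otimes>\<^bsub>F\<^esub> g"
  proof
    fix p
    have "((f \<oplus>\<^bsub>F\<^esub> h) \<otimes>\<^bsub>F\<^esub> g) p = (\<Oplus>\<^bsub>k\<^esub>r\<in>?S \<times> ?T.
        if fst r \<otimes>\<^bsub>G\<^esub> snd r = p then (f \<oplus>\<^bsub>F\<^esub> h) (fst r) \<otimes>\<^bsub>k\<^esub> g (snd r) else \<zero>\<^bsub>k\<^esub>)"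
      by (rule F_mult_superset[OF F.a_closed[OF f h] g S _ T]) (auto simp: supp(3)[OF f] supp(3)[OF h])
    also have "\<dots> = (\<Oplus>\<^bsub>k\<^esub>r\<in>?S \<times> ?T.
        (if fst r \<otimes>\<^bsub>G\<^esub> snd r = p then f (fst r) \<otimes>\<^bsub>k\<^esub> g (snd r) else \<zero>\<^bsub>k\<^esub>) \<oplus>\<^bsub>k\<^esub>
        (if fst r \<otimes>\<^bsub>G\<^esub> snd r = p then h (fst r) \<otimes>\<^bsub>k\<^esub> g (snd r) else \<zero>\<^bsub>k\<^esub>))"
      by (rule K.finsum_cong') (auto simp: supp(3)[OF f] supp(3)[OF h] supp(3)[OF g] K.l_distr)
    also have "\<dots> = (f \<otimes>\<^bsub>F\<^esub> g \<oplus>\<^bsub>F\<^esub> h \<otimes>\<^bsub>F\<^esub> g) p"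
      using F_mult_superset[OF f g S _ T] F_mult_superset[OF h g S _ T]
      by (subst K.finsum_addf) (auto simp: supp(3)[OF f] supp(3)[OF h] supp(3)[OF g])
    finally show "((f \<oplus>\<^bsub>F\<^esub> h) \<otimes>\<^bsub>F\<^esub> g) p = (f \<otimes>\<^bsub>F\<^esub> g \<oplus>\<^bsub>F\<^esub> h \<otimes>\<^bsub>F\<^esub> g) p" .
  qed
next
  let ?T = "{q. g q \<noteq> \<zero>\<^bsub>k\<^esub>}"
  fix c f assume c: "c \<in> carrier k" and f: "f \<in> carrier F"
  let ?S = "{q. f q \<noteq> \<zero>\<^bsub>k\<^esub>}"
  note S = supp(1,2)[OF f]
  note T = supp(1,2)[OF g]
  show "(c \<odot>\<^bsub>F\<^esub> f) \<otimes>\<^bsub>F\<^esub> g = c \<odot>\<^bsub>F\<^esub> (f \<otimes>\<^bsub>F\<^esub> g)"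
  proof
    fix p
    have "((c \<odot>\<^bsub>F\<^esub> f) \<otimes>\<^bsub>F\<^esub> g) p = (\<Oplus>\<^bsub>k\<^esub>r\<in>?S \<times> ?T.
        if fst r \<otimes>\<^bsub>G\<^esub> snd r = p then (c \<odot>\<^bsub>F\<^esub> f) (fst r) \<otimes>\<^bsub>k\<^esub> g (snd r) else \<zero>\<^bsub>k\<^esub>)"
      by (rule F_mult_superset[OF F.smult_closed[OF c f] g S _ T]) (auto simp: c)
    also have "\<dots> = (\<Oplus>\<^bsub>k\<^esub>r\<in>?S \<times> ?T.
        c \<otimes>\<^bsub>k\<^esub> (if fst r \<otimes>\<^bsub>G\<^esub> snd r = p then f (fst r) \<otimes>\<^bsub>k\<^esub> g (snd r) else \<zero>\<^bsub>k\<^esub>))"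
      by (rule K.finsum_cong') (auto simp: c supp(3)[OF f] supp(3)[OF g] K.m_assoc)
    also have "\<dots> = (c \<odot>\<^bsub>F\<^esub> (f \<otimes>\<^bsub>F\<^esub> g)) p"
      using F_mult_superset[OF f g S _ T] S T c
      by (subst K.finsum_rdistr[symmetric]) (auto simp: supp(3)[OF f] supp(3)[OF g])
    finally show "((c \<odot>\<^bsub>F\<^esub> f) \<otimes>\<^bsub>F\<^esub> g) p = (c \<odot>\<^bsub>F\<^esub> (f \<otimes>\<^bsub>F\<^esub> g)) p" .
  qed
qed (rule F_mult_closed[OF _ g])

lemma F_mult_linear_right:
  assumes f: "f \<in> carrier F"
  shows "linear_map k F F (\<lambda>g. f \<otimes>\<^bsub>F\<^esub> g)"
proof (rule linear_mapI)
  let ?S = "{q. f q \<noteq> \<zero>\<^bsub>k\<^esub>}"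
  fix g h assume g: "g \<in> carrier F" and h: "h \<in> carrier F"
  let ?T = "{q. g q \<noteq> \<zero>\<^bsub>k\<^esub>} \<union> {q. h q \<noteq> \<zero>\<^bsub>k\<^esub>}"
  have T: "finite ?T" "?T \<subseteq> carrier G" using supp[OF g] supp[OF h] by auto
  note S = supp(1,2)[OF f]
  show "f \<otimes>\<^bsub>F\<^esub> (g \<oplus>\<^bsub>F\<^esub> h) = f \<otimes>\<^bsub>F\<^esub> g \<oplus>\<^bsub>F\<^esub> f \<otimes>\<^bsub>F\<^esub> h"
  proof
    fix p
    have "(f \<otimes>\<^bsub>F\<^esub> (g \<oplus>\<^bsub>F\<^esub> h)) p = (\<Oplus>\<^bsub>k\<^esub>r\<in>?S \<times> ?T.
        if fst r \<otimes>\<^bsub>G\<^esub> snd r = p then f (fst r) \<otimes>\<^bsub>k\<^esub> (g \<oplus>\<^bsub>F\<^esub> h) (snd r) else \<zero>\<^bsub>k\<^esub>)"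
      by (rule F_mult_superset[OF f F.a_closed[OF g h] S _ T]) (auto simp: supp(3)[OF g] supp(3)[OF h])
    also have "\<dots> = (\<Oplus>\<^bsub>k\<^esub>r\<in>?S \<times> ?T.
        (if fst r \<otimes>\<^bsub>G\<^esub> snd r = p then f (fst r) \<otimes>\<^bsub>k\<^esub> g (snd r) else \<zero>\<^bsub>k\<^esub>) \<oplus>\<^bsub>k\<^esub>
        (if fst r \<otimes>\<^bsub>G\<^esub> snd r = p then f (fst r) \<otimes>\<^bsub>k\<^esub> h (snd r) else \<zero>\<^bsub>k\<^esub>))"
      by (rule K.finsum_cong') (auto simp: supp(3)[OF f] supp(3)[OF h] supp(3)[OF g] K.r_distr)
    also have "\<dots> = (f \<otimes>\<^bsub>F\<^esub> g \<oplus>\<^bsub>F\<^esub> f \<otimes>\<^bsub>F\<^esub> h) p"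
      using F_mult_superset[OF f g S _ T] F_mult_superset[OF f h S _ T]
      by (subst K.finsum_addf) (auto simp: supp(3)[OF f] supp(3)[OF h] supp(3)[OF g])
    finally show "(f \<otimes>\<^bsub>F\<^esub> (g \<oplus>\<^bsub>F\<^esub> h)) p = (f \<otimes>\<^bsub>F\<^esub> g \<oplus>\<^bsub>F\<^esub> f \<otimes>\<^bsub>F\<^esub> h) p" .
  qed
next
  let ?S = "{q. f q \<noteq> \<zero>\<^bsub>k\<^esub>}"
  fix c g assume c: "c \<in> carrier k" and g: "g \<in> carrier F"
  let ?T = "{q. g q \<noteq> \<zero>\<^bsub>k\<^esub>}"
  note S = supp(1,2)[OF f]
  note T = supp(1,2)[OF g]
  show "f \<otimes>\<^bsub>F\<^esub> (c \<odot>\<^bsub>F\<^esub> g) = c \<odot>\<^bsub>F\<^esub> (f \<otimes>\<^bsub>F\<^esub> g)"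
  proof
    fix p
    have "(f \<otimes>\<^bsub>F\<^esub> (c \<odot>\<^bsub>F\<^esub> g)) p = (\<Oplus>\<^bsub>k\<^esub>r\<in>?S \<times> ?T.
        if fst r \<otimes>\<^bsub>G\<^esub> snd r = p then f (fst r) \<otimes>\<^bsub>k\<^esub> (c \<odot>\<^bsub>F\<^esub> g) (snd r) else \<zero>\<^bsub>k\<^esub>)"
      by (rule F_mult_superset[OF f F.smult_closed[OF c g] S _ T]) (auto simp: c)
    also have "\<dots> = (\<Oplus>\<^bsub>k\<^esub>r\<in>?S \<times> ?T.
        c \<otimes>\<^bsub>k\<^esub> (if fst r \<otimes>\<^bsub>G\<^esub> snd r = p then f (fst r) \<otimes>\<^bsub>k\<^esub> g (snd r) else \<zero>\<^bsub>k\<^esub>))"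
      by (rule K.finsum_cong') (auto simp: c supp(3)[OF f] supp(3)[OF g] K.m_lcomm)
    also have "\<dots> = (c \<odot>\<^bsub>F\<^esub> (f \<otimes>\<^bsub>F\<^esub> g)) p"
      using F_mult_superset[OF f g S _ T] S T c
      by (subst K.finsum_rdistr[symmetric]) (auto simp: supp(3)[OF f] supp(3)[OF g])
    finally show "(f \<otimes>\<^bsub>F\<^esub> (c \<odot>\<^bsub>F\<^esub> g)) p = (c \<odot>\<^bsub>F\<^esub> (f \<otimes>\<^bsub>F\<^esub> g)) p" .
  qed
qed (rule F_mult_closed[OF f])

lemma single_mult:
  assumes "p \<in> carrier G" "q \<in> carrier G"
  shows "single k p \<otimes>\<^bsub>F\<^esub> single k q = single k (p \<otimes>\<^bsub>G\<^esub> q)"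
proof
  fix r
  have "(single k p \<otimes>\<^bsub>F\<^esub> single k q) r = (\<Oplus>\<^bsub>k\<^esub>s\<in>{p} \<times> {q}.
      if fst s \<otimes>\<^bsub>G\<^esub> snd s = r then single k p (fst s) \<otimes>\<^bsub>k\<^esub> single k q (snd s) else \<zero>\<^bsub>k\<^esub>)"
    using assms by (intro F_mult_superset single_closed') (auto simp: single_def split: if_splits)
  then show "(single k p \<otimes>\<^bsub>F\<^esub> single k q) r = single k (p \<otimes>\<^bsub>G\<^esub> q) r"
    by (simp add: single_def K.finsum_insert)
qed

text \<open>Both sides are linear in each variable, so h, g and f are replaced by basis elements one
  after the other; what remains is associativity in \<open>G\<close>.\<close>

lemma F_assoc:
  assumes f: "f \<in> carrier F" and g: "g \<in> carrier F" and h: "h \<in> carrier F"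
  shows "(f \<otimes>\<^bsub>F\<^esub> g) \<otimes>\<^bsub>F\<^esub> h = f \<otimes>\<^bsub>F\<^esub> (g \<otimes>\<^bsub>F\<^esub> h)"
proof -
  note L = F_mult_linear_left and R = F_mult_linear_right and c = F_mult_closed
    and s = single_closed' and F = F.left_module_axioms
  have 1: "(single k p \<otimes>\<^bsub>F\<^esub> single k q) \<otimes>\<^bsub>F\<^esub> h = single k p \<otimes>\<^bsub>F\<^esub> (single k q \<otimes>\<^bsub>F\<^esub> h)"
    if pq: "p \<in> carrier G" "q \<in> carrier G" and h: "h \<in> carrier F" for p q h
    by (rule F_eqI[OF R[OF c[OF s s]] linear_map_comp[OF R[OF s] R[OF s]] F _ h])
      (use pq in \<open>simp_all only: single_mult G.m_assoc G.m_closed\<close>)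
  have 2: "(single k p \<otimes>\<^bsub>F\<^esub> g) \<otimes>\<^bsub>F\<^esub> h = single k p \<otimes>\<^bsub>F\<^esub> (g \<otimes>\<^bsub>F\<^esub> h)"
    if p: "p \<in> carrier G" for p
    by (rule F_eqI[OF linear_map_comp[OF R[OF s] L[OF h]] linear_map_comp[OF L[OF h] R[OF s]] F _ g])
      (use p 1 h in \<open>simp_all only:\<close>)
  show ?thesis
    by (rule F_eqI[OF linear_map_comp[OF L[OF g] L[OF h]] L[OF c[OF g h]] F 2 f])
qed

lemma F_ring: "ring F"
proof (rule ringI)
  show "monoid F"
  proof (rule monoidI)
    show "\<one>\<^bsub>F\<^esub> \<in> carrier F" using single_closed' by simp
    fix f assume f: "f \<in> carrier F"
    have id: "linear_map k F F (\<lambda>x. x)" by (simp add: linear_map_def)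
    show "\<one>\<^bsub>F\<^esub> \<otimes>\<^bsub>F\<^esub> f = f"
      by (rule F_eqI[OF F_mult_linear_right id F.left_module_axioms _ f])
        (simp_all add: single_mult K.single_closed)
    show "f \<otimes>\<^bsub>F\<^esub> \<one>\<^bsub>F\<^esub> = f"
      by (rule F_eqI[OF F_mult_linear_left id F.left_module_axioms _ f])
        (simp_all add: single_mult K.single_closed)
  qed (rule F_mult_closed F_assoc; assumption)+
qed (rule F.M.abelian_group_axioms linear_map_add[OF F_mult_linear_left]
    linear_map_add[OF F_mult_linear_right]; assumption)+

end

section \<open>Tensor products of algebras\<close>

definition bilinear ::
  "('k, 'z) ring_scheme \<Rightarrow> ('k, 'a, 'w) module_scheme \<Rightarrow> ('k, 'b, 'x) module_scheme \<Rightarrow>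
    ('k, 'm, 'y) module_scheme \<Rightarrow> ('a \<times> 'b \<Rightarrow> 'm) \<Rightarrow> bool"
  where "bilinear k A B M \<beta> \<longleftrightarrow>
    (\<forall>y\<in>carrier B. linear_map k A M (\<lambda>x. \<beta> (x, y))) \<and> (\<forall>x\<in>carrier A. linear_map k B M (\<lambda>y. \<beta> (x, y)))"

text \<open>The map on the tensor product induced by a bilinear map: the common value of the linear
  extension on all representatives of the coset. The action of \<open>env_mod\<close> is literally
  of this form.\<close>

definition lift ::
  "('k, 'z) ring_scheme \<Rightarrow> ('k, 'm, 'y) module_scheme \<Rightarrow> ('g \<Rightarrow> 'm) \<Rightarrow> ('g \<Rightarrow> 'k) set \<Rightarrow> 'm"
  where "lift k M \<beta> t = the_elem (lin_ext k M \<beta> ` t)"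

lemma (in k_algebra) alg_left_module: "left_module k A"
  by (rule module_imp_left_module) (rule module_axioms)

locale tensor_algebras = A: k_algebra k A + B: k_algebra k B
  for k :: "('k, 'z) ring_scheme" (structure) and A :: "('k, 'a) module" and B :: "('k, 'b) module"
begin

sublocale monoid_algebra k "A \<times>\<times> B"
  by (intro monoid_algebra.intro A.K.is_cring DirProd_monoid A.A.monoid_axioms B.A.monoid_axioms)

abbreviation "N \<equiv> tensor_kernel k A B"
abbreviation "T \<equiv> tensor k A B"
abbreviation "pure \<equiv> pure_tensor k A B"

lemma carrier_prod: "carrier (A \<times>\<times> B) = carrier A \<times> carrier B"
  by (simp add: DirProd_def)

lemma single_in: "\<lbrakk>x \<in> carrier A; y \<in> carrier B\<rbrakk> \<Longrightarrow> single k (x, y) \<in> carrier F"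
  by (rule single_closed') (simp add: carrier_prod)

lemma tensor_rels_subset: "tensor_rels k A B \<subseteq> carrier F"
  unfolding tensor_rels_def Let_def
  by (auto intro!: F.M.minus_closed F.M.a_closed F.smult_closed single_in simp del: monoid_alg_simps free_mod_simps)

lemma N_submodule: "submodule N k F"
  unfolding tensor_kernel_def by (rule F.lin_span_submodule[OF tensor_rels_subset])

sublocale Q: quotient k F N
  by (intro quotient.intro quotient_axioms.intro N_submodule F.left_module_axioms)

lemma tensor_eq: "T = quot_mod F N"
  by (simp add: tensor_def)

lemma T_left_module: "left_module k T"
  unfolding tensor_eq by (rule Q.quot_left_module)

sublocale T: left_module k T by (rule T_left_module)

lemma pure_eq: "pure x y = N +>\<^bsub>F\<^esub> single k (x, y)"
  by (simp add: pure_tensor_def)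

lemma proj_linear: "linear_map k F T (\<lambda>f. N +>\<^bsub>F\<^esub> f)"
  unfolding tensor_eq by (rule Q.linear_map_proj)

lemma pure_closed: "\<lbrakk>x \<in> carrier A; y \<in> carrier B\<rbrakk> \<Longrightarrow> pure x y \<in> carrier T"
  unfolding pure_eq by (rule linear_map_closed[OF proj_linear single_in])

lemma proj_eqI: "\<lbrakk>f \<ominus>\<^bsub>F\<^esub> g \<in> tensor_rels k A B; f \<in> carrier F; g \<in> carrier F\<rbrakk> \<Longrightarrow>
    N +>\<^bsub>F\<^esub> f = N +>\<^bsub>F\<^esub> g"
  by (subst Q.coset_eq) (auto simp: tensor_kernel_def intro: subsetD[OF lin_span_superset])

lemma pure_add_left:
  assumes "x \<in> carrier A" "x' \<in> carrier A" "y \<in> carrier B"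
  shows "pure (x \<oplus>\<^bsub>A\<^esub> x') y = pure x y \<oplus>\<^bsub>T\<^esub> pure x' y"
proof -
  have "single k (x \<oplus>\<^bsub>A\<^esub> x', y) \<ominus>\<^bsub>F\<^esub> (single k (x, y) \<oplus>\<^bsub>F\<^esub> single k (x', y)) \<in> tensor_rels k A B"
    using assms unfolding tensor_rels_def Let_def by blast
  then show ?thesis
    using assms unfolding pure_eq
    by (simp only: linear_map_add[OF proj_linear, symmetric] single_in)
      (intro proj_eqI F.M.a_closed single_in A.A.a_closed)
qed

lemma pure_add_right:
  assumes "x \<in> carrier A" "y \<in> carrier B" "y' \<in> carrier B"
  shows "pure x (y \<oplus>\<^bsub>B\<^esub> y') = pure x y \<oplus>\<^bsub>T\<^esub> pure x y'"
proof -
  have "single k (x, y \<oplus>\<^bsub>B\<^esub> y') \<ominus>\<^bsub>F\<^esub> (single k (x, y) \<oplus>\<^bsub>F\<^esub> single k (x, y')) \<in> tensor_rels k A B"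
    using assms unfolding tensor_rels_def Let_def by blast
  then show ?thesis
    using assms unfolding pure_eq
    by (simp only: linear_map_add[OF proj_linear, symmetric] single_in)
      (intro proj_eqI F.M.a_closed single_in B.A.a_closed)
qed

lemma pure_smult_left:
  assumes "c \<in> carrier k" "x \<in> carrier A" "y \<in> carrier B"
  shows "pure (c \<odot>\<^bsub>A\<^esub> x) y = c \<odot>\<^bsub>T\<^esub> pure x y"
proof -
  have "single k (c \<odot>\<^bsub>A\<^esub> x, y) \<ominus>\<^bsub>F\<^esub> c \<odot>\<^bsub>F\<^esub> single k (x, y) \<in> tensor_rels k A B"
    using assms unfolding tensor_rels_def Let_def by blast
  then show ?thesis
    using assms unfolding pure_eq
    by (simp only: linear_map_smult[OF proj_linear, symmetric] single_in)
      (intro proj_eqI F.smult_closed single_in A.smult_closed)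
qed

lemma pure_smult_right:
  assumes "c \<in> carrier k" "x \<in> carrier A" "y \<in> carrier B"
  shows "pure x (c \<odot>\<^bsub>B\<^esub> y) = c \<odot>\<^bsub>T\<^esub> pure x y"
proof -
  have "single k (x, c \<odot>\<^bsub>B\<^esub> y) \<ominus>\<^bsub>F\<^esub> c \<odot>\<^bsub>F\<^esub> single k (x, y) \<in> tensor_rels k A B"
    using assms unfolding tensor_rels_def Let_def by blast
  then show ?thesis
    using assms unfolding pure_eq
    by (simp only: linear_map_smult[OF proj_linear, symmetric] single_in)
      (intro proj_eqI F.smult_closed single_in B.smult_closed)
qed

lemma bilinear_closed: "bilinear k A B M \<beta> \<Longrightarrow> \<beta> \<in> carrier A \<times> carrier B \<rightarrow> carrier M"
  by (auto simp: bilinear_def linear_map_def)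

lemma lin_ext_F:
  assumes "bilinear k A B M \<beta>" "left_module k M"
  shows lin_ext_F_linear: "linear_map k F M (lin_ext k M \<beta>)"
    and lin_ext_F_single: "\<lbrakk>x \<in> carrier A; y \<in> carrier B\<rbrakk> \<Longrightarrow> lin_ext k M \<beta> (single k (x, y)) = \<beta> (x, y)"
proof -
  interpret M: left_module k M by fact
  have \<beta>: "\<beta> \<in> carrier (A \<times>\<times> B) \<rightarrow> carrier M" using bilinear_closed[OF assms(1)] by (simp add: carrier_prod)
  show "linear_map k F M (lin_ext k M \<beta>)" unfolding linear_map_F by (rule M.lin_ext_linear[OF \<beta>])
  show "lin_ext k M \<beta> (single k (x, y)) = \<beta> (x, y)" if "x \<in> carrier A" "y \<in> carrier B"
    by (rule M.lin_ext_single[OF \<beta>]) (use that in \<open>simp add: carrier_prod\<close>)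
qed

text \<open>By bilinearity each relation is a difference of two elements on which the linear
  extension takes the same value. The zero set of the extension is a submodule, so with the
  relations it contains their span.\<close>

lemma lin_ext_kernel:
  assumes \<beta>: "bilinear k A B M \<beta>" and M: "left_module k M" and u: "u \<in> N"
  shows "lin_ext k M \<beta> u = \<zero>\<^bsub>M\<^esub>"
proof -
  interpret M: left_module k M by fact
  note lin = lin_ext_F_linear[OF \<beta> M] and s = lin_ext_F_single[OF \<beta> M]
  have *: "\<beta> (x, y) \<in> carrier M" if "x \<in> carrier A" "y \<in> carrier B" for x y
    using bilinear_closed[OF \<beta>] that by auto
  have minus: "lin_ext k M \<beta> (f \<ominus>\<^bsub>F\<^esub> g) = \<zero>\<^bsub>M\<^esub>"
    if "f \<in> carrier F" "g \<in> carrier F" "lin_ext k M \<beta> f = lin_ext k M \<beta> g" for f g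
    using that linear_map_minus[OF lin F.left_module_axioms M] linear_map_closed[OF lin]
    by (simp add: a_minus_def M.M.r_neg)
  have "lin_ext k M \<beta> r = \<zero>\<^bsub>M\<^esub>" if "r \<in> tensor_rels k A B" for r
    using that unfolding tensor_rels_def Let_def
    by (elim UnE CollectE exE conjE; hypsubst; intro minus;
        use \<beta> in \<open>simp add: linear_map_add[OF lin] linear_map_smult[OF lin] s single_in bilinear_def
          linear_map_def F.M.a_closed F.smult_closed A.smult_closed B.smult_closed
          del: monoid_alg_simps free_mod_simps\<close>)
  moreover have "submodule {x \<in> carrier F. lin_ext k M \<beta> x \<in> {\<zero>\<^bsub>M\<^esub>}} k F"
    by (rule submodule_vimage[OF lin F.left_module_axioms M])
      (rule M.submoduleI; simp add: M.smult_zero_right)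
  ultimately have "N \<subseteq> {x \<in> carrier F. lin_ext k M \<beta> x \<in> {\<zero>\<^bsub>M\<^esub>}}"
    unfolding tensor_kernel_def using tensor_rels_subset by (intro lin_span_least) auto
  then show ?thesis using u by auto
qed

lemma lift:
  assumes "bilinear k A B M \<beta>" "left_module k M"
  shows lift_linear: "linear_map k T M (lift k M \<beta>)"
    and lift_pure: "\<lbrakk>x \<in> carrier A; y \<in> carrier B\<rbrakk> \<Longrightarrow> lift k M \<beta> (pure x y) = \<beta> (x, y)"
proof -
  note lin = lin_ext_F_linear[OF assms] and ker = lin_ext_kernel[OF assms]
  show "linear_map k T M (lift k M \<beta>)"
    unfolding lift_def[abs_def] tensor_eq by (rule Q.linear_map_quot_factor[OF lin assms(2) ker])
  show "lift k M \<beta> (pure x y) = \<beta> (x, y)" if "x \<in> carrier A" "y \<in> carrier B"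
    using Q.quot_factor_proj[OF lin assms(2) ker single_in] lin_ext_F_single[OF assms] that
    by (simp add: lift_def pure_eq)
qed

text \<open>The coefficient of a basis element is absorbed into the first tensor factor, so adding
  pure tensors without coefficients reaches everything.\<close>

lemma T_induct [consumes 1, case_names zero add]:
  assumes "t \<in> carrier T" and "P \<zero>\<^bsub>T\<^esub>"
    and "\<And>t x y. \<lbrakk>t \<in> carrier T; x \<in> carrier A; y \<in> carrier B; P t\<rbrakk> \<Longrightarrow> P (t \<oplus>\<^bsub>T\<^esub> pure x y)"
  shows "P t"
proof -
  obtain f where f: "f \<in> carrier F" "t = N +>\<^bsub>F\<^esub> f"
    using assms(1) unfolding tensor_eq Q.quot_carrier by auto
  from f(1) have "P (N +>\<^bsub>F\<^esub> f)"
  proof (induction rule: F_induct)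
    case zero
    then show ?case
      using assms(2) linear_map_zero[OF proj_linear F.left_module_axioms T_left_module] by (simp only:)
  next
    case (add f c p)
    then obtain x y where p: "p = (x, y)" "x \<in> carrier A" "y \<in> carrier B" by (auto simp: carrier_prod)
    have "N +>\<^bsub>F\<^esub> (f \<oplus>\<^bsub>F\<^esub> c \<odot>\<^bsub>F\<^esub> single k p) = (N +>\<^bsub>F\<^esub> f) \<oplus>\<^bsub>T\<^esub> pure (c \<odot>\<^bsub>A\<^esub> x) y"
      using add p single_in[OF p(2,3)] F.smult_closed[OF add(2)]
      by (simp only: linear_map_add[OF proj_linear] linear_map_smult[OF proj_linear] pure_smult_left pure_eq[symmetric])
    then show ?case
      using add p assms(3)[OF linear_map_closed[OF proj_linear add(1)] A.smult_closed, of c x y] by metis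
  qed
  then show ?thesis using f by simp
qed

lemma T_eqI:
  assumes f: "linear_map k T V f" and g: "linear_map k T V g" and V: "left_module k V"
    and "\<And>x y. \<lbrakk>x \<in> carrier A; y \<in> carrier B\<rbrakk> \<Longrightarrow> f (pure x y) = g (pure x y)" and "t \<in> carrier T"
  shows "f t = g t"
  using assms(5)
proof (induction rule: T_induct)
  case zero
  show ?case using linear_map_zero[OF f T_left_module V] linear_map_zero[OF g T_left_module V] by simp
next
  case (add t x y)
  then show ?case using assms(4) by (simp add: linear_map_add[OF f] linear_map_add[OF g] pure_closed)
qed

text \<open>Gives a tensor the shape in which the Higman ideal is defined, a sum of pure tensors
  indexed by an initial segment of the naturals.\<close>

lemma T_finite_sum:
  assumes "t \<in> carrier T"
  obtains n :: nat and x y where "\<And>i. i < n \<Longrightarrow> x i \<in> carrier A \<and> y i \<in> carrier B"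
    "t = (\<Oplus>\<^bsub>T\<^esub>i\<in>{..<n}. pure (x i) (y i))"
proof -
  from assms have "\<exists>(n::nat) x y. (\<forall>i<n. x i \<in> carrier A \<and> y i \<in> carrier B) \<and>
      t = (\<Oplus>\<^bsub>T\<^esub>i\<in>{..<n}. pure (x i) (y i))"
  proof (induction rule: T_induct)
    case zero
    show ?case by (rule exI[of _ 0]) (simp add: T.M.finsum_empty)
  next
    case (add t a b)
    then obtain n :: nat and x y where xy: "\<forall>i<n. x i \<in> carrier A \<and> y i \<in> carrier B"
      and t: "t = (\<Oplus>\<^bsub>T\<^esub>i\<in>{..<n}. pure (x i) (y i))" by auto
    let ?x = "x(n := a)" and ?y = "y(n := b)"
    have "(\<Oplus>\<^bsub>T\<^esub>i\<in>{..<n}. pure (?x i) (?y i)) = t"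
      unfolding t by (rule T.M.finsum_cong') (use xy pure_closed in auto)
    moreover have "(\<Oplus>\<^bsub>T\<^esub>i\<in>{..<Suc n}. pure (?x i) (?y i)) =
        pure a b \<oplus>\<^bsub>T\<^esub> (\<Oplus>\<^bsub>T\<^esub>i\<in>{..<n}. pure (?x i) (?y i))"
      unfolding lessThan_Suc using xy add pure_closed
      by (subst T.M.finsum_insert) auto
    ultimately have "t \<oplus>\<^bsub>T\<^esub> pure a b = (\<Oplus>\<^bsub>T\<^esub>i\<in>{..<Suc n}. pure (?x i) (?y i))"
      using add pure_closed by (simp add: T.M.a_comm)
    then show ?case using xy add by (intro exI[of _ "Suc n"] exI[of _ ?x] exI[of _ ?y]) auto
  qed
  then show ?thesis using that by blast
qed

section \<open>The algebra structure of the tensor product\<close>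

lemma proj_zero_iff: "f \<in> carrier F \<Longrightarrow> N +>\<^bsub>F\<^esub> f = \<zero>\<^bsub>T\<^esub> \<longleftrightarrow> f \<in> N"
  using Q.coset_self[of f] Q.N.a_rcos_const[of f] by (auto simp: tensor_eq Q.quot_zero)

text \<open>Multiplying by the basis element of a pair (a, b) and projecting to the tensor product
  is the linear extension of a bilinear map, on the left (x, y) \<mapsto> a x \<otimes> b y, and
  therefore kills \<open>N\<close>. Linearity in the multiplier extends this from basis elements to
  all of \<open>F\<close>.\<close>

lemma N_ideal: "ideal N F"
proof (rule ideal.intro)
  show "additive_subgroup N F" by (rule Q.N.additive_subgroup_axioms)
  show "ring F" by (rule F_ring)
  have zero_map: "linear_map k F T (\<lambda>f. \<zero>\<^bsub>T\<^esub>)"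
    by (rule linear_mapI) (simp_all add: T.smult_zero_right)
  show "ideal_axioms N F"
  proof
    fix u f assume u: "u \<in> N" and f: "f \<in> carrier F"
    have uF: "u \<in> carrier F" using u F.submoduleD(1)[OF N_submodule] by auto
    have 1: "N +>\<^bsub>F\<^esub> (single k p \<otimes>\<^bsub>F\<^esub> u) = \<zero>\<^bsub>T\<^esub>" if pc: "p \<in> carrier (A \<times>\<times> B)" for p
    proof -
      obtain a b where p: "p = (a, b)" "a \<in> carrier A" "b \<in> carrier B" using pc by (auto simp: carrier_prod)
      let ?\<beta> = "\<lambda>q. pure (a \<otimes>\<^bsub>A\<^esub> fst q) (b \<otimes>\<^bsub>B\<^esub> snd q)"
      have \<beta>: "bilinear k A B T ?\<beta>"
        using p by (auto simp: bilinear_def pure_closed pure_add_left pure_add_right pure_smult_left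
            pure_smult_right A.A.r_distr B.A.r_distr A.smult_mult_right B.smult_mult_right intro!: linear_mapI)
      have "N +>\<^bsub>F\<^esub> (single k p \<otimes>\<^bsub>F\<^esub> u) = lin_ext k T ?\<beta> u"
      proof (rule F_eqI[OF linear_map_comp[OF F_mult_linear_right[OF single_closed'[OF pc]] proj_linear]
            lin_ext_F_linear[OF \<beta> T_left_module] T_left_module _ uF])
        fix q assume "q \<in> carrier (A \<times>\<times> B)"
        then show "N +>\<^bsub>F\<^esub> (single k p \<otimes>\<^bsub>F\<^esub> single k q) = lin_ext k T ?\<beta> (single k q)"
          using p pc lin_ext_F_single[OF \<beta> T_left_module]
          by (cases q) (simp add: single_mult carrier_prod pure_eq)
      qed
      then show ?thesis using lin_ext_kernel[OF \<beta> T_left_module u] by simp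
    qed
    have "N +>\<^bsub>F\<^esub> (f \<otimes>\<^bsub>F\<^esub> u) = \<zero>\<^bsub>T\<^esub>"
      by (rule F_eqI[OF linear_map_comp[OF F_mult_linear_left[OF uF] proj_linear] zero_map T_left_module 1 f])
    then show "f \<otimes>\<^bsub>F\<^esub> u \<in> N" using proj_zero_iff F_mult_closed[OF f uF] by simp
    have 2: "N +>\<^bsub>F\<^esub> (u \<otimes>\<^bsub>F\<^esub> single k p) = \<zero>\<^bsub>T\<^esub>" if pc: "p \<in> carrier (A \<times>\<times> B)" for p
    proof -
      obtain a b where p: "p = (a, b)" "a \<in> carrier A" "b \<in> carrier B" using pc by (auto simp: carrier_prod)
      let ?\<beta> = "\<lambda>q. pure (fst q \<otimes>\<^bsub>A\<^esub> a) (snd q \<otimes>\<^bsub>B\<^esub> b)"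
      have \<beta>: "bilinear k A B T ?\<beta>"
        using p by (auto simp: bilinear_def pure_closed pure_add_left pure_add_right pure_smult_left
            pure_smult_right A.A.l_distr B.A.l_distr A.smult_mult_left B.smult_mult_left intro!: linear_mapI)
      have "N +>\<^bsub>F\<^esub> (u \<otimes>\<^bsub>F\<^esub> single k p) = lin_ext k T ?\<beta> u"
      proof (rule F_eqI[OF linear_map_comp[OF F_mult_linear_left[OF single_closed'[OF pc]] proj_linear]
            lin_ext_F_linear[OF \<beta> T_left_module] T_left_module _ uF])
        fix q assume "q \<in> carrier (A \<times>\<times> B)"
        then show "N +>\<^bsub>F\<^esub> (single k q \<otimes>\<^bsub>F\<^esub> single k p) = lin_ext k T ?\<beta> (single k q)"
          using p pc lin_ext_F_single[OF \<beta> T_left_module]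
          by (cases q) (simp add: single_mult carrier_prod pure_eq)
      qed
      then show ?thesis using lin_ext_kernel[OF \<beta> T_left_module u] by simp
    qed
    have "N +>\<^bsub>F\<^esub> (u \<otimes>\<^bsub>F\<^esub> f) = \<zero>\<^bsub>T\<^esub>"
      by (rule F_eqI[OF linear_map_comp[OF F_mult_linear_right[OF uF] proj_linear] zero_map T_left_module 2 f])
    then show "u \<otimes>\<^bsub>F\<^esub> f \<in> N" using proj_zero_iff F_mult_closed[OF uF f] by simp
  qed
qed

lemma proj_mult: "\<lbrakk>f \<in> carrier F; g \<in> carrier F\<rbrakk> \<Longrightarrow>
    (N +>\<^bsub>F\<^esub> f) \<otimes>\<^bsub>T\<^esub> (N +>\<^bsub>F\<^esub> g) = N +>\<^bsub>F\<^esub> (f \<otimes>\<^bsub>F\<^esub> g)"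
  using ideal.rcoset_mult_add[OF N_ideal] by (simp add: tensor_eq quot_mod_def)

lemma proj_one: "\<one>\<^bsub>T\<^esub> = N +>\<^bsub>F\<^esub> \<one>\<^bsub>F\<^esub>"
  by (simp add: tensor_eq quot_mod_def)

lemma one_T: "\<one>\<^bsub>T\<^esub> = pure \<one>\<^bsub>A\<^esub> \<one>\<^bsub>B\<^esub>"
  unfolding proj_one pure_eq by simp

lemma pure_mult:
  assumes "x \<in> carrier A" "y \<in> carrier B" "x' \<in> carrier A" "y' \<in> carrier B"
  shows "pure x y \<otimes>\<^bsub>T\<^esub> pure x' y' = pure (x \<otimes>\<^bsub>A\<^esub> x') (y \<otimes>\<^bsub>B\<^esub> y')"
  using assms unfolding pure_eq by (subst proj_mult) (auto simp: single_in single_mult carrier_prod simp del: monoid_alg_simps)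

lemma carrier_T: "carrier T = (\<lambda>f. N +>\<^bsub>F\<^esub> f) ` carrier F"
  unfolding tensor_eq by (rule Q.quot_carrier)

lemma T_ring: "ring T"
proof -
  interpret FR: ring F by (rule F_ring)
  note add = linear_map_add[OF proj_linear, symmetric]
  show ?thesis
  proof (rule ringI)
    show "abelian_group T" by (rule T.M.abelian_group_axioms)
    show "monoid T"
      by (rule monoidI)
        (auto simp: carrier_T proj_mult proj_one FR.m_assoc FR.m_closed simp del: monoid_alg_simps)
  qed (auto simp: carrier_T proj_mult add FR.l_distr FR.r_distr simp del: monoid_alg_simps free_mod_simps)
qed

lemma T_k_algebra: "k_algebra k T"
proof (intro k_algebra.intro k_algebra_axioms.intro)
  note smult = linear_map_smult[OF proj_linear, symmetric]
  fix c x y assume c: "c \<in> carrier k" and "x \<in> carrier T" "y \<in> carrier T"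
  then obtain f g where fg: "f \<in> carrier F" "g \<in> carrier F" "x = N +>\<^bsub>F\<^esub> f" "y = N +>\<^bsub>F\<^esub> g"
    unfolding carrier_T by auto
  show "(c \<odot>\<^bsub>T\<^esub> x) \<otimes>\<^bsub>T\<^esub> y = c \<odot>\<^bsub>T\<^esub> (x \<otimes>\<^bsub>T\<^esub> y)"
    using fg c by (simp only: smult proj_mult F.smult_closed F_mult_closed linear_map_smult[OF F_mult_linear_left])
  show "x \<otimes>\<^bsub>T\<^esub> (c \<odot>\<^bsub>T\<^esub> y) = c \<odot>\<^bsub>T\<^esub> (x \<otimes>\<^bsub>T\<^esub> y)"
    using fg c by (simp only: smult proj_mult F.smult_closed F_mult_closed linear_map_smult[OF F_mult_linear_right])
qed (rule A.K.field_axioms T_ring left_module_imp_module[OF A.K.is_cring T_left_module])+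

end

section \<open>Bimodules\<close>

lemma op_alg_simps [simp]:
  "carrier (op_alg A) = carrier A" "zero (op_alg A) = zero A" "one (op_alg A) = one A"
  "add (op_alg A) = add A" "smult (op_alg A) = smult A" "x \<otimes>\<^bsub>op_alg A\<^esub> y = y \<otimes>\<^bsub>A\<^esub> x"
  by (simp_all add: op_alg_def)

text \<open>Algebra axioms are symmetric under reversing the product, so one statement covers a
  change of record and the passage to the opposite algebra.\<close>

lemma (in k_algebra) k_algebra_transfer:
  assumes "carrier A' = carrier A" "zero A' = zero A" "one A' = one A" "add A' = add A"
    and "\<And>c x. \<lbrakk>c \<in> carrier k; x \<in> carrier A\<rbrakk> \<Longrightarrow> smult A' c x = smult A c x"
    and "mult A' = mult A \<or> mult A' = (\<lambda>x y. y \<otimes>\<^bsub>A\<^esub> x)"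
  shows "k_algebra k A'"
proof (intro k_algebra.intro k_algebra_axioms.intro)
  have M: "left_module k A'"
    by (rule left_module_transfer[OF alg_left_module]) (use assms in auto)
  then show "module k A'" by (intro left_module_imp_module K.is_cring)
  interpret M: left_module k A' by (rule M)
  have "monoid A'"
    by (rule monoidI) (use assms(6) in \<open>auto simp: assms(1-4) A.m_assoc\<close>)
  then show "ring A'"
    by (rule ringI[OF M.M.abelian_group_axioms])
      (use assms(6) in \<open>auto simp: assms(1-4) A.l_distr A.r_distr\<close>)
qed (use assms(5,6) in \<open>auto simp: assms(1-4) K.field_axioms smult_mult_left smult_mult_right\<close>)

lemma (in k_algebra) mult_linear_left: "y \<in> carrier A \<Longrightarrow> linear_map k A A (\<lambda>x. x \<otimes>\<^bsub>A\<^esub> y)"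
  by (rule linear_mapI) (auto simp: A.l_distr smult_mult_left)

lemma (in k_algebra) mult_linear_right: "y \<in> carrier A \<Longrightarrow> linear_map k A A (\<lambda>x. y \<otimes>\<^bsub>A\<^esub> x)"
  by (rule linear_mapI) (auto simp: A.r_distr smult_mult_right)

lemma linear_map_plus:
  assumes "linear_map k U V f" "linear_map k U V g" "left_module k V"
  shows "linear_map k U V (\<lambda>x. f x \<oplus>\<^bsub>V\<^esub> g x)"
proof -
  interpret V: left_module k V by fact
  show ?thesis
    by (rule linear_mapI)
      (simp_all add: linear_map_closed[OF assms(1)] linear_map_closed[OF assms(2)] linear_map_add[OF assms(1)]
        linear_map_add[OF assms(2)] linear_map_smult[OF assms(1)] linear_map_smult[OF assms(2)]
        V.M.a_ac V.smult_r_distr)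
qed

text \<open>The tensor products over \<open>A\<close> and its opposite differ in their multiplication only.\<close>

lemma tensor_op:
  shows tensor_op_pure: "pure_tensor k A (op_alg A) = pure_tensor k A A"
    and tensor_op_finsum: "finsum (tensor k A (op_alg A)) = finsum (tensor k A A)"
proof -
  let ?F = "monoid_alg k (A \<times>\<times> op_alg A)" and ?G = "monoid_alg k (A \<times>\<times> A)"
  have add: "add_monoid ?F = add_monoid ?G" by simp
  have minus: "x \<ominus>\<^bsub>?F\<^esub> y = x \<ominus>\<^bsub>?G\<^esub> y" for x y
    unfolding a_minus_def a_inv_def add by simp
  have rels: "tensor_rels k A (op_alg A) = tensor_rels k A A"
    unfolding tensor_rels_def Let_def minus by simp
  have sub: "submodule H k ?F \<longleftrightarrow> submodule H k ?G" for H
    unfolding submodule_def submodule_axioms_def add by simp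
  have ker: "tensor_kernel k A (op_alg A) = tensor_kernel k A A"
    unfolding tensor_kernel_def lin_span_def rels sub by simp
  show "pure_tensor k A (op_alg A) = pure_tensor k A A"
    unfolding pure_tensor_def ker a_r_coset_def add by simp
  show "finsum (tensor k A (op_alg A)) = finsum (tensor k A A)"
    unfolding finsum_def tensor_def quot_mod_def ker A_RCOSETS_def set_add_def add by simp
qed

locale env_algebra = k_algebra k A for k :: "('k, 'z) ring_scheme" (structure) and A :: "('k, 'a) module"
begin

abbreviation "E \<equiv> env k A"
abbreviation pure (infixl "\<otimes>\<^sub>e" 75) where "x \<otimes>\<^sub>e y \<equiv> pure_tensor k A (op_alg A) x y"

lemma op_k_algebra: "k_algebra k (op_alg A)"
  by (rule k_algebra_transfer) (auto simp: op_alg_def)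

sublocale E: tensor_algebras k A "op_alg A"
  rewrites "tensor k A (op_alg A) = E"
  by (intro tensor_algebras.intro k_algebra_axioms op_k_algebra) (simp add: env_def)

sublocale EA: k_algebra k E by (rule E.T_k_algebra)

end

text \<open>Linearity over k in each variable is what lets the two actions descend jointly to the
  tensor product. It also forces a scalar c to act as c 1 of \<open>A\<close> from either
  side.\<close>

locale bimod = env_algebra k A + M: module k M
  for k :: "('k, 'z) ring_scheme" (structure) and A :: "('k, 'a) module" and M :: "('k, 'a, 'm) bimodule" +
  assumes lact_linear: "a \<in> carrier A \<Longrightarrow> linear_map k M M (\<lambda>m. lact M a m)"
    and lact_linear': "m \<in> carrier M \<Longrightarrow> linear_map k A M (\<lambda>a. lact M a m)"
    and ract_linear: "a \<in> carrier A \<Longrightarrow> linear_map k M M (\<lambda>m. ract M m a)"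
    and ract_linear': "m \<in> carrier M \<Longrightarrow> linear_map k A M (\<lambda>a. ract M m a)"
    and lact_mult: "\<lbrakk>a \<in> carrier A; b \<in> carrier A; m \<in> carrier M\<rbrakk> \<Longrightarrow>
      lact M (a \<otimes>\<^bsub>A\<^esub> b) m = lact M a (lact M b m)"
    and ract_mult: "\<lbrakk>a \<in> carrier A; b \<in> carrier A; m \<in> carrier M\<rbrakk> \<Longrightarrow>
      ract M m (a \<otimes>\<^bsub>A\<^esub> b) = ract M (ract M m a) b"
    and lact_one: "m \<in> carrier M \<Longrightarrow> lact M \<one>\<^bsub>A\<^esub> m = m"
    and ract_one: "m \<in> carrier M \<Longrightarrow> ract M m \<one>\<^bsub>A\<^esub> = m"
    and lact_ract: "\<lbrakk>a \<in> carrier A; b \<in> carrier A; m \<in> carrier M\<rbrakk> \<Longrightarrow>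
      lact M a (ract M m b) = ract M (lact M a m) b"
begin

abbreviation "ME \<equiv> env_mod k A M"

lemma ME_simps [simp]: "carrier ME = carrier M" "zero ME = zero M" "add ME = add M"
  by (simp_all add: env_mod_def)

lemma M_left_module: "left_module k M"
  by (rule module_imp_left_module) (rule M.module_axioms)

lemma lact_closed: "\<lbrakk>a \<in> carrier A; m \<in> carrier M\<rbrakk> \<Longrightarrow> lact M a m \<in> carrier M"
  using lact_linear linear_map_closed by fastforce

lemma ract_closed: "\<lbrakk>a \<in> carrier A; m \<in> carrier M\<rbrakk> \<Longrightarrow> ract M m a \<in> carrier M"
  using ract_linear linear_map_closed by fastforce

lemma bilinear_act: "m \<in> carrier M \<Longrightarrow> bilinear k A (op_alg A) M (\<lambda>p. lact M (fst p) (ract M m (snd p)))"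
proof -
  assume m: "m \<in> carrier M"
  have "linear_map k (op_alg A) M (ract M m)" using ract_linear'[OF m] by (simp add: linear_map_def)
  then show ?thesis
    using m linear_map_comp[OF _ lact_linear] by (auto simp: bilinear_def lact_linear' ract_closed)
qed

text \<open>Identifies the action, defined through representatives of a coset, with the map induced
  by the bilinear map (a, b) \<mapsto> a m b; independence of representatives follows from
  this.\<close>

lemma act_eq: "t \<odot>\<^bsub>ME\<^esub> m = lift k M (\<lambda>p. lact M (fst p) (ract M m (snd p))) t"
  by (simp add: env_mod_def lift_def lin_ext_def[abs_def])

lemma act_linear: "m \<in> carrier M \<Longrightarrow> linear_map k E M (\<lambda>t. t \<odot>\<^bsub>ME\<^esub> m)"
  unfolding act_eq by (rule E.lift_linear[OF bilinear_act M_left_module])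

lemma act_pure: "\<lbrakk>a \<in> carrier A; b \<in> carrier A; m \<in> carrier M\<rbrakk> \<Longrightarrow>
    (a \<otimes>\<^sub>e b) \<odot>\<^bsub>ME\<^esub> m = lact M a (ract M m b)"
  unfolding act_eq by (subst E.lift_pure[OF bilinear_act M_left_module]) auto

lemma act_closed: "\<lbrakk>t \<in> carrier E; m \<in> carrier M\<rbrakk> \<Longrightarrow> t \<odot>\<^bsub>ME\<^esub> m \<in> carrier M"
  by (rule linear_map_closed[OF act_linear])

text \<open>Scalars in \<open>hom_space\<close> act through c 1 of \<open>E\<close>; on a bimodule
  this is the original scalar multiplication.\<close>

lemma act_scalar: "\<lbrakk>c \<in> carrier k; m \<in> carrier M\<rbrakk> \<Longrightarrow> (c \<odot>\<^bsub>E\<^esub> \<one>\<^bsub>E\<^esub>) \<odot>\<^bsub>ME\<^esub> m = c \<odot>\<^bsub>M\<^esub> m"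
  by (simp add: linear_map_smult[OF act_linear] E.one_T E.pure_closed act_pure lact_one ract_one)

lemma act_pure_linear:
  assumes "a \<in> carrier A" "b \<in> carrier A"
  shows "linear_map k M M (\<lambda>m. (a \<otimes>\<^sub>e b) \<odot>\<^bsub>ME\<^esub> m)"
  using linear_map_comp[OF ract_linear[OF assms(2)] lact_linear[OF assms(1)]] assms
  by (simp add: linear_map_def act_pure M.smult_closed Pi_iff)

lemma act_add:
  assumes m: "m \<in> carrier M" and n: "n \<in> carrier M" and t: "t \<in> carrier E"
  shows "t \<odot>\<^bsub>ME\<^esub> (m \<oplus>\<^bsub>M\<^esub> n) = t \<odot>\<^bsub>ME\<^esub> m \<oplus>\<^bsub>M\<^esub> t \<odot>\<^bsub>ME\<^esub> n"
  by (rule E.T_eqI[OF act_linear[OF M.M.a_closed[OF m n]]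
        linear_map_plus[OF act_linear[OF m] act_linear[OF n] M_left_module] M_left_module _ t])
    (simp add: linear_map_add[OF act_pure_linear] m n)

text \<open>By linearity in s and then in t it is enough to treat pure tensors. There the product a
  \<otimes> b times c \<otimes> d is ac \<otimes> db, the second factor being opposite, and (ac) m
  (db) = a (c m d) b.\<close>

lemma act_assoc:
  assumes s: "s \<in> carrier E" and t: "t \<in> carrier E" and m: "m \<in> carrier M"
  shows "(s \<otimes>\<^bsub>E\<^esub> t) \<odot>\<^bsub>ME\<^esub> m = s \<odot>\<^bsub>ME\<^esub> (t \<odot>\<^bsub>ME\<^esub> m)"
proof (rule E.T_eqI[OF linear_map_comp[OF EA.mult_linear_left[OF t] act_linear[OF m]]
      act_linear[OF act_closed[OF t m]] M_left_module _ s])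
  fix a b assume ab: "a \<in> carrier A" "b \<in> carrier (op_alg A)"
  then have abE: "a \<otimes>\<^sub>e b \<in> carrier E" and b: "b \<in> carrier A" by (auto intro: E.pure_closed)
  show "((a \<otimes>\<^sub>e b) \<otimes>\<^bsub>E\<^esub> t) \<odot>\<^bsub>ME\<^esub> m = (a \<otimes>\<^sub>e b) \<odot>\<^bsub>ME\<^esub> (t \<odot>\<^bsub>ME\<^esub> m)"
  proof (rule E.T_eqI[OF linear_map_comp[OF EA.mult_linear_right[OF abE] act_linear[OF m]]
      linear_map_comp[OF act_linear[OF m] act_pure_linear[OF ab(1) b]] M_left_module _ t])
    fix c d assume "c \<in> carrier A" "d \<in> carrier (op_alg A)"
    then show "((a \<otimes>\<^sub>e b) \<otimes>\<^bsub>E\<^esub> (c \<otimes>\<^sub>e d)) \<odot>\<^bsub>ME\<^esub> m = (a \<otimes>\<^sub>e b) \<odot>\<^bsub>ME\<^esub> ((c \<otimes>\<^sub>e d) \<odot>\<^bsub>ME\<^esub> m)"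
      using ab m by (simp add: E.pure_mult act_pure lact_closed ract_closed lact_mult ract_mult lact_ract)
  qed
qed

lemma ME_left_module: "left_module E ME"
proof (rule left_moduleI)
  show "abelian_group ME"
    by (rule abelian_group_transfer[OF M.M.abelian_group_axioms]) simp_all
qed (auto simp: EA.ring_axioms act_closed linear_map_add[OF act_linear] act_add act_assoc E.one_T act_pure
    lact_one ract_one)

end

section \<open>Homomorphisms of bimodules as homomorphisms over the enveloping algebra\<close>

locale bimod_pair = M: bimod k A M + M': bimod k A M'
  for k :: "('k, 'z) ring_scheme" (structure) and A :: "('k, 'a) module" and M :: "('k, 'a, 'm) bimodule"
    and M' :: "('k, 'a, 'n) bimodule"
begin

text \<open>Compatibility with both actions is linearity for pure tensors; the remaining elements of
  \<open>E\<close> follow because both sides are k-linear in t.\<close>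

lemma env_linearI:
  assumes f: "linear_map k M M' f"
    and "\<And>a m. \<lbrakk>a \<in> carrier A; m \<in> carrier M\<rbrakk> \<Longrightarrow> f (lact M a m) = lact M' a (f m)"
    and "\<And>a m. \<lbrakk>a \<in> carrier A; m \<in> carrier M\<rbrakk> \<Longrightarrow> f (ract M m a) = ract M' (f m) a"
  shows "linear_map M.E M.ME M'.ME f"
proof (rule linear_mapI)
  fix t m assume t: "t \<in> carrier M.E" and "m \<in> carrier M.ME"
  then have m: "m \<in> carrier M" by simp
  show "f (t \<odot>\<^bsub>M.ME\<^esub> m) = t \<odot>\<^bsub>M'.ME\<^esub> f m"
    by (rule M.E.T_eqI[OF linear_map_comp[OF M.act_linear[OF m] f] M'.act_linear M'.M_left_module _ t])
      (use m assms(2,3) in \<open>simp_all add: linear_map_closed[OF f] M.act_pure M'.act_pure M.ract_closed\<close>)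
qed (use linear_map_closed[OF f] linear_map_add[OF f] in auto)

text \<open>The left and right actions are recovered from a \<otimes> 1 and 1 \<otimes> a. Linearity
  over k is then the left action of the elements r 1 of \<open>A\<close>.\<close>

lemma env_linearD:
  assumes f: "linear_map M.E M.ME M'.ME f"
  shows env_linear_k: "linear_map k M M' f"
    and env_linear_lact: "\<lbrakk>a \<in> carrier A; m \<in> carrier M\<rbrakk> \<Longrightarrow> f (lact M a m) = lact M' a (f m)"
    and env_linear_ract: "\<lbrakk>a \<in> carrier A; m \<in> carrier M\<rbrakk> \<Longrightarrow> f (ract M m a) = ract M' (f m) a"
proof -
  have c: "f m \<in> carrier M'" if "m \<in> carrier M" for m using linear_map_closed[OF f] that by simp
  have p: "f ((a \<otimes>\<^sub>e b) \<odot>\<^bsub>M.ME\<^esub> m) = (a \<otimes>\<^sub>e b) \<odot>\<^bsub>M'.ME\<^esub> f m"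
    if "a \<in> carrier A" "b \<in> carrier A" "m \<in> carrier M" for a b m
    using linear_map_smult[OF f, of "a \<otimes>\<^sub>e b" m] M.E.pure_closed that by simp
  show l: "f (lact M a m) = lact M' a (f m)" if "a \<in> carrier A" "m \<in> carrier M" for a m
    using p[of a "\<one>\<^bsub>A\<^esub>" m] that c by (simp add: M.act_pure M'.act_pure M.ract_one M'.ract_one)
  show "f (ract M m a) = ract M' (f m) a" if "a \<in> carrier A" "m \<in> carrier M" for a m
    using p[of "\<one>\<^bsub>A\<^esub>" a m] that c
    by (simp add: M.act_pure M'.act_pure M.lact_one M'.lact_one M.ract_closed M'.ract_closed)
  show "linear_map k M M' f"
  proof (rule linear_mapI)
    fix r m assume r: "r \<in> carrier k" and m: "m \<in> carrier M"
    have "lact M (r \<odot>\<^bsub>A\<^esub> \<one>\<^bsub>A\<^esub>) m = r \<odot>\<^bsub>M\<^esub> m"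
      using r m by (simp add: linear_map_smult[OF M.lact_linear'] M.lact_one)
    moreover have "lact M' (r \<odot>\<^bsub>A\<^esub> \<one>\<^bsub>A\<^esub>) (f m) = r \<odot>\<^bsub>M'\<^esub> f m"
      using r c[OF m] by (simp add: linear_map_smult[OF M'.lact_linear'] M'.lact_one)
    ultimately show "f (r \<odot>\<^bsub>M\<^esub> m) = r \<odot>\<^bsub>M'\<^esub> f m" using l[of "r \<odot>\<^bsub>A\<^esub> \<one>\<^bsub>A\<^esub>" m] r m by simp
  qed (use c linear_map_add[OF f] in auto)
qed

end

lemma (in env_algebra) twisted_bimod:
  assumes \<nu>: "\<nu> \<in> ring_hom A A" "\<And>c x. \<lbrakk>c \<in> carrier k; x \<in> carrier A\<rbrakk> \<Longrightarrow> \<nu> (c \<odot>\<^bsub>A\<^esub> x) = c \<odot>\<^bsub>A\<^esub> \<nu> x"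
  shows "bimod k A (twisted_bimod A \<nu>)"
proof (intro bimod.intro bimod_axioms.intro)
  let ?M = "twisted_bimod A \<nu>"
  have [simp]: "carrier ?M = carrier A" "add ?M = add A" "zero ?M = zero A" "smult ?M = smult A"
    "lact ?M = (\<lambda>a x. a \<otimes>\<^bsub>A\<^esub> x)" "ract ?M = (\<lambda>x b. x \<otimes>\<^bsub>A\<^esub> \<nu> b)"
    by (simp_all add: twisted_bimod_def)
  have lin: "linear_map k U ?M f \<longleftrightarrow> linear_map k U A f" "linear_map k ?M V f' \<longleftrightarrow> linear_map k A V f'"
    for U V f f'
    by (simp_all add: linear_map_def)
  note h = ring_hom_closed[OF \<nu>(1)] ring_hom_add[OF \<nu>(1)] ring_hom_mult[OF \<nu>(1)] ring_hom_one[OF \<nu>(1)]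
  have nu: "linear_map k A A \<nu>" by (rule linear_mapI) (auto simp: h \<nu>(2))
  show "env_algebra k A" by (rule env_algebra_axioms)
  show "module k ?M"
    by (rule left_module_imp_module[OF K.is_cring left_module_transfer[OF alg_left_module]]) auto
  show "linear_map k ?M ?M (\<lambda>m. lact ?M a m)" "linear_map k ?M ?M (\<lambda>m. ract ?M m a)" if "a \<in> carrier A" for a
    using that by (simp_all add: lin h mult_linear_left mult_linear_right)
  show "linear_map k A ?M (\<lambda>a. lact ?M a m)" "linear_map k A ?M (\<lambda>a. ract ?M m a)" if "m \<in> carrier ?M" for m
    using that linear_map_comp[OF nu mult_linear_right] by (simp_all add: lin mult_linear_left)
  show "lact ?M \<one>\<^bsub>A\<^esub> m = m" "ract ?M m \<one>\<^bsub>A\<^esub> = m" if "m \<in> carrier ?M" for m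
    using that by (simp_all add: h)
  fix a b m assume a: "a \<in> carrier A" and b: "b \<in> carrier A" and m: "m \<in> carrier ?M"
  show "lact ?M (a \<otimes>\<^bsub>A\<^esub> b) m = lact ?M a (lact ?M b m)" "ract ?M m (a \<otimes>\<^bsub>A\<^esub> b) = ract ?M (ract ?M m a) b"
    "lact ?M a (ract ?M m b) = ract ?M (lact ?M a m) b"
    using a b m by (simp_all add: h A.m_assoc)
qed

section \<open>Spaces of homomorphisms\<close>

lemma hom_space_simps [simp]:
  "carrier (hom_space E U V) = mod_hom E U V"
  "zero (hom_space E U V) = (\<lambda>x\<in>carrier U. \<zero>\<^bsub>V\<^esub>)"
  "f \<oplus>\<^bsub>hom_space E U V\<^esub> g = (\<lambda>x\<in>carrier U. f x \<oplus>\<^bsub>V\<^esub> g x)"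
  "c \<odot>\<^bsub>hom_space E U V\<^esub> f = (\<lambda>x\<in>carrier U. (c \<odot>\<^bsub>E\<^esub> \<one>\<^bsub>E\<^esub>) \<odot>\<^bsub>V\<^esub> f x)"
  by (simp_all add: hom_space_def)

lemma mod_hom_eqI:
  "\<lbrakk>f \<in> mod_hom E U V; g \<in> mod_hom E U V; \<And>x. x \<in> carrier U \<Longrightarrow> f x = g x\<rbrakk> \<Longrightarrow> f = g"
  by (auto simp: mod_hom_eq intro: extensionalityI)

lemma restrict_mod_hom: "\<lbrakk>left_module E U; linear_map E U V f\<rbrakk> \<Longrightarrow> restrict f (carrier U) \<in> mod_hom E U V"
proof -
  assume "left_module E U" and f: "linear_map E U V f"
  then interpret left_module E U by simp
  show ?thesis using f by (auto simp: mod_hom_def linear_map_def smult_closed)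
qed

text \<open>The elements c 1 are central in \<open>E\<close>, so multiplying the values of an
  \<open>E\<close>-linear map by them leaves it \<open>E\<close>-linear. For general elements of
  \<open>E\<close> this would fail.\<close>

lemma hom_space_left_module:
  assumes E: "k_algebra k E" and U: "left_module E U" and V: "left_module E V"
  shows "left_module k (hom_space E U V)"
proof -
  interpret E: k_algebra k E by fact
  interpret U: left_module E U by fact
  interpret V: left_module E V by fact
  let ?H = "hom_space E U V"
  have plus: "(\<lambda>x\<in>carrier U. f x \<oplus>\<^bsub>V\<^esub> g x) \<in> mod_hom E U V" if "f \<in> mod_hom E U V" "g \<in> mod_hom E U V" for f g
    by (rule restrict_mod_hom[OF U linear_map_plus[OF _ _ V]]) (use that mod_hom_linear in auto)
  have smult: "(\<lambda>x\<in>carrier U. (c \<odot>\<^bsub>E\<^esub> \<one>\<^bsub>E\<^esub>) \<odot>\<^bsub>V\<^esub> f x) \<in> mod_hom E U V"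
    if c: "c \<in> carrier k" and f: "f \<in> mod_hom E U V" for c f
  proof (rule restrict_mod_hom[OF U], rule linear_mapI)
    note lin = mod_hom_linear[OF f]
    fix r x assume r: "r \<in> carrier E" and x: "x \<in> carrier U"
    have "(c \<odot>\<^bsub>E\<^esub> \<one>\<^bsub>E\<^esub>) \<otimes>\<^bsub>E\<^esub> r = r \<otimes>\<^bsub>E\<^esub> (c \<odot>\<^bsub>E\<^esub> \<one>\<^bsub>E\<^esub>)"
      using c r by (simp add: E.smult_mult_left E.smult_mult_right)
    then show "(c \<odot>\<^bsub>E\<^esub> \<one>\<^bsub>E\<^esub>) \<odot>\<^bsub>V\<^esub> f (r \<odot>\<^bsub>U\<^esub> x) = r \<odot>\<^bsub>V\<^esub> ((c \<odot>\<^bsub>E\<^esub> \<one>\<^bsub>E\<^esub>) \<odot>\<^bsub>V\<^esub> f x)"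
      using c r x linear_map_closed[OF lin]
      by (simp add: linear_map_smult[OF lin] V.smult_assoc[symmetric])
  qed (use c linear_map_closed[OF mod_hom_linear[OF f]] linear_map_add[OF mod_hom_linear[OF f]]
      in \<open>auto simp: V.smult_closed V.smult_r_distr\<close>)
  have zero: "(\<lambda>x\<in>carrier U. \<zero>\<^bsub>V\<^esub>) \<in> mod_hom E U V"
    by (rule restrict_mod_hom[OF U], rule linear_mapI) (auto simp: V.smult_zero_right)
  have cl: "f x \<in> carrier V" if "f \<in> mod_hom E U V" "x \<in> carrier U" for f x
    using linear_map_closed[OF mod_hom_linear] that by metis
  have ext: "restrict f (carrier U) = f" if "f \<in> mod_hom E U V" for f
    using mod_hom_extensional[OF that] by (rule extensional_restrict)
  show ?thesis
  proof (rule left_moduleI)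
    show "ring k" by (rule E.K.ring_axioms)
    show "abelian_group ?H"
    proof (rule abelian_groupI)
      fix f g h assume f: "f \<in> carrier ?H" and g: "g \<in> carrier ?H" and h: "h \<in> carrier ?H"
      show "f \<oplus>\<^bsub>?H\<^esub> g \<oplus>\<^bsub>?H\<^esub> h = f \<oplus>\<^bsub>?H\<^esub> (g \<oplus>\<^bsub>?H\<^esub> h)"
        using f g h cl by (auto simp: V.M.a_assoc intro!: restrict_ext)
      show "f \<oplus>\<^bsub>?H\<^esub> g = g \<oplus>\<^bsub>?H\<^esub> f"
        using f g cl by (auto simp: V.M.a_comm intro!: restrict_ext)
      show "\<zero>\<^bsub>?H\<^esub> \<oplus>\<^bsub>?H\<^esub> f = f"
        by (rule mod_hom_eqI[of _ E U V]) (use f plus[OF zero] cl in simp_all)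
      show "\<exists>g\<in>carrier ?H. g \<oplus>\<^bsub>?H\<^esub> f = \<zero>\<^bsub>?H\<^esub>"
      proof
        let ?g = "(\<ominus>\<^bsub>k\<^esub> \<one>\<^bsub>k\<^esub>) \<odot>\<^bsub>?H\<^esub> f"
        have m: "(\<ominus>\<^bsub>k\<^esub> \<one>\<^bsub>k\<^esub>) \<odot>\<^bsub>E\<^esub> \<one>\<^bsub>E\<^esub> = \<ominus>\<^bsub>E\<^esub> \<one>\<^bsub>E\<^esub>"
          using E.smult_l_minus[of "\<one>\<^bsub>k\<^esub>" "\<one>\<^bsub>E\<^esub>"] by simp
        show g: "?g \<in> carrier ?H" using smult f by simp
        show "?g \<oplus>\<^bsub>?H\<^esub> f = \<zero>\<^bsub>?H\<^esub>"
          by (rule mod_hom_eqI[of _ E U V])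
            (use f plus[OF smult[of "\<ominus>\<^bsub>k\<^esub> \<one>\<^bsub>k\<^esub>" f]] zero cl in \<open>simp_all add: m V.smult_neg_one V.M.l_neg\<close>)
      qed
    qed (use plus zero in simp_all)
  next
    show "\<one>\<^bsub>k\<^esub> \<odot>\<^bsub>?H\<^esub> f = f" if f: "f \<in> carrier ?H" for f
      by (rule mod_hom_eqI[of _ E U V]) (use f smult[of "\<one>\<^bsub>k\<^esub>" f] cl in \<open>simp_all add: V.smult_one\<close>)
    fix c f assume c: "c \<in> carrier k" and f: "f \<in> carrier ?H"
    show "c \<odot>\<^bsub>?H\<^esub> f \<in> carrier ?H" using smult c f by simp
    show "c \<odot>\<^bsub>?H\<^esub> (f \<oplus>\<^bsub>?H\<^esub> g) = c \<odot>\<^bsub>?H\<^esub> f \<oplus>\<^bsub>?H\<^esub> c \<odot>\<^bsub>?H\<^esub> g" if g: "g \<in> carrier ?H" for g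
      using c f g cl by (auto simp: V.smult_r_distr intro!: restrict_ext)
    fix d assume d: "d \<in> carrier k"
    show "(c \<oplus>\<^bsub>k\<^esub> d) \<odot>\<^bsub>?H\<^esub> f = c \<odot>\<^bsub>?H\<^esub> f \<oplus>\<^bsub>?H\<^esub> d \<odot>\<^bsub>?H\<^esub> f"
      using c d f cl by (auto simp: E.smult_l_distr V.smult_l_distr intro!: restrict_ext)
    have "(c \<otimes>\<^bsub>k\<^esub> d) \<odot>\<^bsub>E\<^esub> \<one>\<^bsub>E\<^esub> = (c \<odot>\<^bsub>E\<^esub> \<one>\<^bsub>E\<^esub>) \<otimes>\<^bsub>E\<^esub> (d \<odot>\<^bsub>E\<^esub> \<one>\<^bsub>E\<^esub>)"
      using c d by (simp add: E.smult_assoc1 E.smult_mult_left)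
    then show "(c \<otimes>\<^bsub>k\<^esub> d) \<odot>\<^bsub>?H\<^esub> f = c \<odot>\<^bsub>?H\<^esub> (d \<odot>\<^bsub>?H\<^esub> f)"
      using c d f cl by (auto simp: V.smult_assoc intro!: restrict_ext)
  qed
qed

section \<open>Dual spaces and the dual bimodule\<close>

lemma left_regular_simps [simp]:
  "carrier (left_regular R) = carrier R" "zero (left_regular R) = zero R" "one (left_regular R) = one R"
  "add (left_regular R) = add R" "mult (left_regular R) = mult R" "smult (left_regular R) = mult R"
  by (simp_all add: left_regular_def)

lemma left_regular_k_algebra:
  assumes "field k"
  shows "k_algebra k (left_regular k)"
proof -
  interpret field k by fact
  have M: "left_module k (left_regular k)"
    by (rule left_moduleI) (auto simp: ring_axioms l_distr r_distr m_assoc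
        intro: abelian_group_transfer[OF abelian_group_axioms])
  then interpret M: left_module k "left_regular k" .
  have "monoid (left_regular k)" by (rule monoidI) (auto simp: m_assoc)
  then have "ring (left_regular k)"
    by (rule ringI[OF M.M.abelian_group_axioms]) (auto simp: l_distr r_distr)
  then show ?thesis
    using left_module_imp_module[OF is_cring M] field_axioms
    by (auto simp: k_algebra_def k_algebra_axioms_def m_assoc m_lcomm)
qed

lemma left_regular_left_module:
  assumes "field k" "left_module k M"
  shows "left_module (left_regular k) M"
proof -
  interpret K: k_algebra k "left_regular k" by (rule left_regular_k_algebra) fact
  interpret left_module k M by fact
  show ?thesis
    by (rule left_moduleI)
      (auto simp: K.A.ring_axioms M.abelian_group_axioms smult_closed smult_l_distr smult_r_distr smult_assoc smult_one)
qed

lemma dual_left_module: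
  assumes "field k" "left_module k M"
  shows "left_module k (dual k M)"
proof -
  interpret K: k_algebra k "left_regular k" by (rule left_regular_k_algebra) fact
  show ?thesis
    unfolding dual_def
    by (intro hom_space_left_module left_regular_left_module K.alg_left_module K.k_algebra_axioms assms)
qed

lemma dual_carrier: "f \<in> carrier (dual k M) \<longleftrightarrow>
    linear_map k M (left_regular k) f \<and> f \<in> extensional (carrier M)"
  by (simp add: dual_def mod_hom_eq linear_map_def)

lemma dual_simps:
  "\<zero>\<^bsub>dual k M\<^esub> = (\<lambda>x\<in>carrier M. \<zero>\<^bsub>k\<^esub>)"
  "f \<oplus>\<^bsub>dual k M\<^esub> g = (\<lambda>x\<in>carrier M. f x \<oplus>\<^bsub>k\<^esub> g x)"
  "c \<odot>\<^bsub>dual k M\<^esub> f = (\<lambda>x\<in>carrier M. (c \<otimes>\<^bsub>k\<^esub> \<one>\<^bsub>k\<^esub>) \<otimes>\<^bsub>k\<^esub> f x)"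
  by (simp_all add: dual_def)

lemma dual_bimod_simps [simp]:
  "carrier (dual_bimod k A) = carrier (dual k A)" "zero (dual_bimod k A) = zero (dual k A)"
  "add (dual_bimod k A) = add (dual k A)" "smult (dual_bimod k A) = smult (dual k A)"
  "lact (dual_bimod k A) = (\<lambda>a f. \<lambda>x\<in>carrier A. f (x \<otimes>\<^bsub>A\<^esub> a))"
  "ract (dual_bimod k A) = (\<lambda>f b. \<lambda>x\<in>carrier A. f (b \<otimes>\<^bsub>A\<^esub> x))"
  by (simp_all add: dual_bimod_def)

text \<open>The left action precomposes with right multiplication and the right action with left
  multiplication. Precomposition reverses order, which restores the correct order of the actions;
  associativity of \<open>A\<close> makes them commute.\<close>

lemma (in env_algebra) dual_bimod: "bimod k A (dual_bimod k A)"
proof (intro bimod.intro bimod_axioms.intro)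
  let ?M = "dual_bimod k A"
  have restr: "restrict f (carrier A) \<in> carrier (dual k A)" if "linear_map k A (left_regular k) f" for f
    using that by (auto simp: dual_carrier linear_map_def)
  have f: "\<lbrakk>x \<in> carrier A; y \<in> carrier A\<rbrakk> \<Longrightarrow> f (x \<oplus>\<^bsub>A\<^esub> y) = f x \<oplus>\<^bsub>k\<^esub> f y"
    "\<lbrakk>x \<in> carrier A; c \<in> carrier k\<rbrakk> \<Longrightarrow> f (c \<odot>\<^bsub>A\<^esub> x) = c \<otimes>\<^bsub>k\<^esub> f x"
    if "f \<in> carrier (dual k A)" for f x y c
    using that by (auto simp: dual_carrier linear_map_def)
  have cl: "lact ?M a f \<in> carrier (dual k A)" "ract ?M f a \<in> carrier (dual k A)"
    if a: "a \<in> carrier A" and "f \<in> carrier (dual k A)" for a f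
  proof -
    have lin: "linear_map k A (left_regular k) f" using that by (simp add: dual_carrier)
    show "lact ?M a f \<in> carrier (dual k A)" "ract ?M f a \<in> carrier (dual k A)"
      using restr[OF linear_map_comp[OF mult_linear_left[OF a] lin]]
        restr[OF linear_map_comp[OF mult_linear_right[OF a] lin]] by simp_all
  qed
  show "env_algebra k A" by (rule env_algebra_axioms)
  show "module k ?M"
    by (rule left_module_imp_module[OF K.is_cring left_module_transfer[OF
          dual_left_module[OF K.field_axioms alg_left_module]]]) auto
  show "linear_map k ?M ?M (\<lambda>m. lact ?M a m)" "linear_map k ?M ?M (\<lambda>m. ract ?M m a)" if a: "a \<in> carrier A" for a
    by (rule linear_mapI; use a cl in \<open>auto simp: dual_simps intro!: restrict_ext\<close>)+
  show "linear_map k A ?M (\<lambda>a. lact ?M a m)" if m: "m \<in> carrier ?M" for m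
    by (rule linear_mapI)
      (use m cl f in \<open>auto simp: dual_simps A.r_distr smult_mult_right intro!: restrict_ext\<close>)
  show "linear_map k A ?M (\<lambda>a. ract ?M m a)" if m: "m \<in> carrier ?M" for m
    by (rule linear_mapI)
      (use m cl f in \<open>auto simp: dual_simps A.l_distr smult_mult_left intro!: restrict_ext\<close>)
  show "lact ?M \<one>\<^bsub>A\<^esub> m = m" "ract ?M m \<one>\<^bsub>A\<^esub> = m" if m: "m \<in> carrier ?M" for m
    using m by (auto simp: dual_carrier extensional_def)
  fix a b m assume a: "a \<in> carrier A" and b: "b \<in> carrier A"
  show "lact ?M (a \<otimes>\<^bsub>A\<^esub> b) m = lact ?M a (lact ?M b m)" "ract ?M m (a \<otimes>\<^bsub>A\<^esub> b) = ract ?M (ract ?M m a) b"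
    "lact ?M a (ract ?M m b) = ract ?M (lact ?M a m) b"
    using a b by (auto simp: A.m_assoc intro!: restrict_ext)
qed

section \<open>Twisted centre and twisted Higman ideal\<close>

lemma (in ring) linear_map_free_mod_single:
  "linear_map R (free_mod R {i}) (free_mod R {j}) (\<lambda>f p. if p = j then f i else \<zero>)"
proof (rule linear_mapI)
  fix f assume f: "f \<in> carrier (free_mod R {i})"
  have "{p. (if p = j then f i else \<zero>) \<noteq> \<zero>} \<subseteq> {j}" by auto
  then show "(\<lambda>p. if p = j then f i else \<zero>) \<in> carrier (free_mod R {j})"
    using f by (auto simp: free_mod_carrier intro: finite_subset)
qed (auto simp: free_mod_carrier fun_eq_iff)

text \<open>\<open>projective\<close> asks for a free module whose basis is indexed by elements of
  the carrier type of the module itself, here functions. An arbitrary element \<open>?u\<close> of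
  that type serves as the only index, and the single coordinate is moved from i to \<open>?u\<close>
  and back.\<close>

lemma (in ring) projective_free_mod_single:
  fixes i :: 'i
  shows "projective R (free_mod R {i})"
  unfolding projective_def
proof (intro conjI free_mod_left_module exI)
  let ?u = "undefined :: 'i \<Rightarrow> 'a"
  let ?F = "free_mod R {i}" and ?G = "free_mod R {?u}"
  let ?i = "\<lambda>f p. if p = ?u then f i else \<zero>" and ?q = "\<lambda>f p. if p = i then f ?u else \<zero>"
  have "restrict ?q (carrier ?G) (restrict ?i (carrier ?F) f) = f" if f: "f \<in> carrier ?F" for f
  proof -
    have "f x = \<zero>" if "x \<noteq> i" for x using f that by (auto simp: free_mod_carrier)
    then have "?q (?i f) = f" by auto
    then show ?thesis using f linear_map_closed[OF linear_map_free_mod_single[of i ?u] f] by simp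
  qed
  then show "\<exists>j\<in>mod_hom R ?F ?G. \<exists>q\<in>mod_hom R ?G ?F. \<forall>x\<in>carrier ?F. q (j x) = x"
    by (intro bexI[of _ "restrict ?i (carrier ?F)"] bexI[of _ "restrict ?q (carrier ?G)"] ballI
        restrict_mod_hom free_mod_left_module linear_map_free_mod_single)
qed

section \<open>A Nakayama automorphism together with a bimodule isomorphism onto the twisted
  bimodule\<close>

locale nakayama = env_algebra k A
  for k :: "('k, 'z) ring_scheme" (structure) and A :: "('k, 'a) module" +
  fixes \<nu> :: "'a \<Rightarrow> 'a" and \<phi> :: "('a \<Rightarrow> 'k) \<Rightarrow> 'a"
  assumes nu_iso: "\<nu> \<in> ring_iso A A"
    and nu_smult: "\<And>c x. \<lbrakk>c \<in> carrier k; x \<in> carrier A\<rbrakk> \<Longrightarrow> \<nu> (c \<odot>\<^bsub>A\<^esub> x) = c \<odot>\<^bsub>A\<^esub> \<nu> x"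
    and phi_linear: "linear_map E (env_mod k A (dual_bimod k A)) (env_mod k A (twisted_bimod A \<nu>)) \<phi>"
    and phi_bij: "bij_betw \<phi> (carrier (dual k A)) (carrier A)"
begin

abbreviation "Z \<equiv> twisted_center A \<nu>"
abbreviation "H \<equiv> twisted_higman k A \<nu>"
abbreviation "AZ \<equiv> A\<lparr>carrier := Z\<rparr>"

lemma nu_hom: "\<nu> \<in> ring_hom A A" and nu_bij: "bij_betw \<nu> (carrier A) (carrier A)"
  using nu_iso by (auto simp: ring_iso_def)

lemmas nu_simps = ring_hom_closed[OF nu_hom] ring_hom_add[OF nu_hom] ring_hom_mult[OF nu_hom]
  ring_hom_one[OF nu_hom] nu_smult

lemma nu_linear: "linear_map k A A \<nu>"
  by (rule linear_mapI) (auto simp: nu_simps)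

sublocale D: bimod k A "dual_bimod k A" by (rule dual_bimod)
sublocale W: bimod k A "twisted_bimod A \<nu>" by (rule twisted_bimod[OF nu_hom nu_smult])
sublocale R: bimod k A "regular_bimod A"
  unfolding regular_bimod_def by (rule twisted_bimod) (auto intro: ring_hom_memI)

sublocale DW: bimod_pair k A "dual_bimod k A" "twisted_bimod A \<nu>" ..
sublocale RW: bimod_pair k A "regular_bimod A" "twisted_bimod A \<nu>" ..
sublocale RD: bimod_pair k A "regular_bimod A" "dual_bimod k A" ..
sublocale WD: bimod_pair k A "twisted_bimod A \<nu>" "dual_bimod k A" ..

lemma twisted_simps [simp]:
  "carrier (twisted_bimod A \<mu>) = carrier A" "add (twisted_bimod A \<mu>) = add A" "zero (twisted_bimod A \<mu>) = zero A"
  "smult (twisted_bimod A \<mu>) = smult A" "lact (twisted_bimod A \<mu>) = (\<lambda>a x. a \<otimes>\<^bsub>A\<^esub> x)"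
  "ract (twisted_bimod A \<mu>) = (\<lambda>x b. x \<otimes>\<^bsub>A\<^esub> \<mu> b)"
  by (simp_all add: twisted_bimod_def)

lemma regular_simps [simp]:
  "carrier (regular_bimod A) = carrier A" "add (regular_bimod A) = add A" "zero (regular_bimod A) = zero A"
  "smult (regular_bimod A) = smult A" "lact (regular_bimod A) = (\<lambda>a x. a \<otimes>\<^bsub>A\<^esub> x)"
  "ract (regular_bimod A) = (\<lambda>x b. x \<otimes>\<^bsub>A\<^esub> b)"
  by (simp_all add: regular_bimod_def)

text \<open>A global name for the inverse of \<phi>; it is \<open>E\<close>-linear as well and
  carries elements of the twisted bimodule back to functionals.\<close>

definition "\<psi> = inv_into (carrier (dual k A)) \<phi>"

lemma psi_phi: "f \<in> carrier (dual k A) \<Longrightarrow> \<psi> (\<phi> f) = f"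
  and phi_psi: "x \<in> carrier A \<Longrightarrow> \<phi> (\<psi> x) = x"
  using phi_bij by (auto simp: \<psi>_def bij_betw_def f_inv_into_f)

lemma psi_linear: "linear_map E W.ME D.ME \<psi>"
  using linear_map_inv_into[OF phi_linear _ D.ME_left_module] phi_bij by (simp add: \<psi>_def)

lemma phi_closed: "f \<in> carrier (dual k A) \<Longrightarrow> \<phi> f \<in> carrier A"
  using linear_map_closed[OF phi_linear] by simp

lemma psi_closed: "x \<in> carrier A \<Longrightarrow> \<psi> x \<in> carrier (dual k A)"
  using linear_map_closed[OF psi_linear] by simp

lemma ZD: "z \<in> Z \<Longrightarrow> z \<in> carrier A" "\<lbrakk>z \<in> Z; a \<in> carrier A\<rbrakk> \<Longrightarrow> z \<otimes>\<^bsub>A\<^esub> \<nu> a = a \<otimes>\<^bsub>A\<^esub> z"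
  by (auto simp: twisted_center_def)

lemma Z_submodule: "submodule Z k A"
  by (rule left_module.submoduleI[OF alg_left_module])
    (auto simp: twisted_center_def nu_simps A.l_distr A.r_distr smult_mult_left smult_mult_right)

lemma AZ_left_module: "left_module k AZ"
  by (rule left_module.submodule_left_module[OF alg_left_module Z_submodule])

section \<open>Casimir elements and linear maps on the enveloping algebra\<close>

definition "\<mu> = lift k A (\<lambda>p. fst p \<otimes>\<^bsub>A\<^esub> snd p)"
text \<open>\<open>lmul a\<close> and \<open>rtwist a\<close> are the two sides of the balancing
  condition in \<open>twisted_higman\<close>, as maps on tensors instead of operations on a
  representing sum.\<close>

definition "lmul a = lift k E (\<lambda>p. (a \<otimes>\<^bsub>A\<^esub> fst p) \<otimes>\<^sub>e snd p)"
definition "rtwist a = lift k E (\<lambda>p. fst p \<otimes>\<^sub>e (snd p \<otimes>\<^bsub>A\<^esub> \<nu> a))"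
text \<open>Built so that \<mu> applied to \<open>absorb z t\<close> gives t z in the twisted
  bimodule: on x \<otimes> y both are x z \<nu>(y).\<close>

definition "absorb z = lift k E (\<lambda>p. (fst p \<otimes>\<^bsub>A\<^esub> z) \<otimes>\<^sub>e \<nu> (snd p))"
definition "\<nu>' = inv_into (carrier A) \<nu>"
definition "untwist = lift k E (\<lambda>p. fst p \<otimes>\<^sub>e \<nu>' (snd p))"

lemma nu'_hom: "\<nu>' \<in> ring_hom A A" and nu'_linear: "linear_map k A A \<nu>'"
  and nu'_nu: "x \<in> carrier A \<Longrightarrow> \<nu>' (\<nu> x) = x" and nu_nu': "x \<in> carrier A \<Longrightarrow> \<nu> (\<nu>' x) = x"
proof -
  show "\<nu>' \<in> ring_hom A A"
    using ring_iso_set_sym[OF A.ring_axioms nu_iso] by (simp add: ring_iso_def \<nu>'_def)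
  show "linear_map k A A \<nu>'"
    unfolding \<nu>'_def by (rule linear_map_inv_into[OF nu_linear nu_bij alg_left_module])
  show "x \<in> carrier A \<Longrightarrow> \<nu>' (\<nu> x) = x" "x \<in> carrier A \<Longrightarrow> \<nu> (\<nu>' x) = x"
    using nu_bij by (auto simp: \<nu>'_def bij_betw_def f_inv_into_f)
qed

text \<open>The common source of \<open>lmul\<close>, \<open>rtwist\<close>, \<open>absorb\<close>
  and \<open>untwist\<close>, each of which is f \<otimes> g for two k-linear maps of
  \<open>A\<close>.\<close>

lemma bilinear_pure_comp:
  assumes f: "linear_map k A A f" and g: "linear_map k A A g"
  shows "bilinear k A (op_alg A) E (\<lambda>p. f (fst p) \<otimes>\<^sub>e g (snd p))"
  using linear_mapD[OF f] linear_mapD[OF g]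
  by (auto simp: bilinear_def E.pure_closed E.pure_add_left E.pure_add_right E.pure_smult_left
      E.pure_smult_right[simplified] E.pure_add_right[simplified] intro!: linear_mapI)

lemma id_linear: "linear_map k A A (\<lambda>x. x)"
  by (simp add: linear_map_def)

lemma E_left_module: "left_module k E" by (rule E.T_left_module)

lemma mu_bilinear: "bilinear k A (op_alg A) A (\<lambda>p. fst p \<otimes>\<^bsub>A\<^esub> snd p)"
  using mult_linear_left mult_linear_right by (auto simp: bilinear_def linear_map_def)

lemmas mu_linear = E.lift_linear[OF mu_bilinear alg_left_module, folded \<mu>_def]
lemmas mu_pure = E.lift_pure[OF mu_bilinear alg_left_module, folded \<mu>_def, simplified]

lemma lmul:
  assumes "a \<in> carrier A"
  shows lmul_linear: "linear_map k E E (lmul a)"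
    and lmul_pure: "\<lbrakk>x \<in> carrier A; y \<in> carrier A\<rbrakk> \<Longrightarrow> lmul a (x \<otimes>\<^sub>e y) = (a \<otimes>\<^bsub>A\<^esub> x) \<otimes>\<^sub>e y"
  using E.lift_linear[OF bilinear_pure_comp[OF mult_linear_right[OF assms] id_linear] E_left_module]
    E.lift_pure[OF bilinear_pure_comp[OF mult_linear_right[OF assms] id_linear] E_left_module]
  by (simp_all add: lmul_def)

lemma rtwist:
  assumes "a \<in> carrier A"
  shows rtwist_linear: "linear_map k E E (rtwist a)"
    and rtwist_pure: "\<lbrakk>x \<in> carrier A; y \<in> carrier A\<rbrakk> \<Longrightarrow> rtwist a (x \<otimes>\<^sub>e y) = x \<otimes>\<^sub>e (y \<otimes>\<^bsub>A\<^esub> \<nu> a)"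
  using E.lift_linear[OF bilinear_pure_comp[OF id_linear mult_linear_left] E_left_module]
    E.lift_pure[OF bilinear_pure_comp[OF id_linear mult_linear_left] E_left_module] assms
  by (simp_all add: rtwist_def nu_simps)

lemma absorb:
  assumes "z \<in> carrier A"
  shows absorb_linear: "linear_map k E E (absorb z)"
    and absorb_pure: "\<lbrakk>x \<in> carrier A; y \<in> carrier A\<rbrakk> \<Longrightarrow> absorb z (x \<otimes>\<^sub>e y) = (x \<otimes>\<^bsub>A\<^esub> z) \<otimes>\<^sub>e \<nu> y"
  using E.lift_linear[OF bilinear_pure_comp[OF mult_linear_left[OF assms] nu_linear] E_left_module]
    E.lift_pure[OF bilinear_pure_comp[OF mult_linear_left[OF assms] nu_linear] E_left_module]
  by (simp_all add: absorb_def)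

lemma untwist:
  shows untwist_linear: "linear_map k E E untwist"
    and untwist_pure: "\<lbrakk>x \<in> carrier A; y \<in> carrier A\<rbrakk> \<Longrightarrow> untwist (x \<otimes>\<^sub>e y) = x \<otimes>\<^sub>e \<nu>' y"
  using E.lift_linear[OF bilinear_pure_comp[OF id_linear nu'_linear] E_left_module]
    E.lift_pure[OF bilinear_pure_comp[OF id_linear nu'_linear] E_left_module]
  by (simp_all add: untwist_def)

definition "twisted_casimir = {t \<in> carrier E. \<forall>a\<in>carrier A. lmul a t = rtwist a t}"
text \<open>In \<open>E\<close> the left multiple of x \<otimes> y by 1 \<otimes> a is x \<otimes> y
  a, so the condition reads a t = t a. It is phrased by multiplication in \<open>E\<close> because
  the coordinates of elements of free modules satisfy it in that form.\<close>

definition "casimir = {t \<in> carrier E. \<forall>a\<in>carrier A.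
    (a \<otimes>\<^sub>e \<one>\<^bsub>A\<^esub>) \<otimes>\<^bsub>E\<^esub> t = (\<one>\<^bsub>A\<^esub> \<otimes>\<^sub>e a) \<otimes>\<^bsub>E\<^esub> t}"

lemma pure_closed: "\<lbrakk>x \<in> carrier A; y \<in> carrier A\<rbrakk> \<Longrightarrow> x \<otimes>\<^sub>e y \<in> carrier E"
  by (rule E.pure_closed) simp_all

text \<open>Every tensor is a finite sum of pure ones, and \<mu>, \<open>lmul a\<close> and
  \<open>rtwist a\<close> commute with finite sums. So the representing families disappear, and the
  Higman ideal becomes the image of a subspace under a linear map.\<close>

lemma higman_eq: "H = \<mu> ` twisted_casimir"
proof
  have sums: "lmul a (\<Oplus>\<^bsub>E\<^esub>i\<in>{..<n}. x i \<otimes>\<^sub>e y i) = (\<Oplus>\<^bsub>E\<^esub>i\<in>{..<n}. (a \<otimes>\<^bsub>A\<^esub> x i) \<otimes>\<^sub>e y i)"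
    "rtwist a (\<Oplus>\<^bsub>E\<^esub>i\<in>{..<n}. x i \<otimes>\<^sub>e y i) = (\<Oplus>\<^bsub>E\<^esub>i\<in>{..<n}. x i \<otimes>\<^sub>e (y i \<otimes>\<^bsub>A\<^esub> \<nu> a))"
    "\<mu> (\<Oplus>\<^bsub>E\<^esub>i\<in>{..<n}. x i \<otimes>\<^sub>e y i) = (\<Oplus>\<^bsub>A\<^esub>i\<in>{..<n}. x i \<otimes>\<^bsub>A\<^esub> y i)"
    if xy: "\<forall>i<n. x i \<in> carrier A \<and> y i \<in> carrier A" and a: "a \<in> carrier A" for n :: nat and x y a
  proof -
    have p: "(\<lambda>i. x i \<otimes>\<^sub>e y i) \<in> {..<n} \<rightarrow> carrier E" using xy pure_closed by auto
    show "lmul a (\<Oplus>\<^bsub>E\<^esub>i\<in>{..<n}. x i \<otimes>\<^sub>e y i) = (\<Oplus>\<^bsub>E\<^esub>i\<in>{..<n}. (a \<otimes>\<^bsub>A\<^esub> x i) \<otimes>\<^sub>e y i)"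
      unfolding linear_map_finsum[OF lmul_linear[OF a] E_left_module E_left_module finite_lessThan p]
      using xy a by (intro E.T.M.finsum_cong') (auto simp: lmul_pure pure_closed)
    show "rtwist a (\<Oplus>\<^bsub>E\<^esub>i\<in>{..<n}. x i \<otimes>\<^sub>e y i) = (\<Oplus>\<^bsub>E\<^esub>i\<in>{..<n}. x i \<otimes>\<^sub>e (y i \<otimes>\<^bsub>A\<^esub> \<nu> a))"
      unfolding linear_map_finsum[OF rtwist_linear[OF a] E_left_module E_left_module finite_lessThan p]
      using xy a by (intro E.T.M.finsum_cong') (auto simp: rtwist_pure pure_closed nu_simps)
    show "\<mu> (\<Oplus>\<^bsub>E\<^esub>i\<in>{..<n}. x i \<otimes>\<^sub>e y i) = (\<Oplus>\<^bsub>A\<^esub>i\<in>{..<n}. x i \<otimes>\<^bsub>A\<^esub> y i)"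
      unfolding linear_map_finsum[OF mu_linear E_left_module alg_left_module finite_lessThan p]
      using xy a by (intro A.finsum_cong') (auto simp: mu_pure)
  qed
  \<comment> \<open>The Higman ideal is defined with the tensor product of \<open>A\<close> with
    \<open>A\<close>, the maps above with that of \<open>A\<close> and its opposite; pure tensors
    and finite sums are the same in both.\<close>
  note T = tensor_op_pure[of k A, symmetric] tensor_op_finsum[of k A, symmetric, folded env_def]
  show "H \<subseteq> \<mu> ` twisted_casimir"
  proof
    fix h assume "h \<in> H"
    then obtain n :: nat and x y where h: "h = (\<Oplus>\<^bsub>A\<^esub>i\<in>{..<n}. x i \<otimes>\<^bsub>A\<^esub> y i)"
      and xy: "\<forall>i<n. x i \<in> carrier A \<and> y i \<in> carrier A"
      and bal: "\<forall>a\<in>carrier A. (\<Oplus>\<^bsub>E\<^esub>i\<in>{..<n}. (a \<otimes>\<^bsub>A\<^esub> x i) \<otimes>\<^sub>e y i) =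
        (\<Oplus>\<^bsub>E\<^esub>i\<in>{..<n}. x i \<otimes>\<^sub>e (y i \<otimes>\<^bsub>A\<^esub> \<nu> a))"
      unfolding twisted_higman_def T by blast
    let ?t = "\<Oplus>\<^bsub>E\<^esub>i\<in>{..<n}. x i \<otimes>\<^sub>e y i"
    have "?t \<in> carrier E" using xy by (intro E.T.M.finsum_closed) (auto simp: pure_closed)
    moreover have "lmul a ?t = rtwist a ?t" if a: "a \<in> carrier A" for a
      unfolding sums(1,2)[OF xy a] using bal a by blast
    ultimately have "?t \<in> twisted_casimir" by (simp add: twisted_casimir_def)
    then have "\<mu> ?t \<in> \<mu> ` twisted_casimir" by (rule imageI)
    then show "h \<in> \<mu> ` twisted_casimir" using sums(3)[OF xy A.one_closed] h by simp
  qed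
  show "\<mu> ` twisted_casimir \<subseteq> H"
  proof
    fix h assume "h \<in> \<mu> ` twisted_casimir"
    then obtain t where t: "t \<in> carrier E" "\<forall>a\<in>carrier A. lmul a t = rtwist a t" and h: "h = \<mu> t"
      by (auto simp: twisted_casimir_def)
    obtain n :: nat and x y where xy: "\<And>i. i < n \<Longrightarrow> x i \<in> carrier A \<and> y i \<in> carrier (op_alg A)"
      and te: "t = (\<Oplus>\<^bsub>E\<^esub>i\<in>{..<n}. x i \<otimes>\<^sub>e y i)"
      by (rule E.T_finite_sum[OF t(1)]) blast
    have xy': "\<forall>i<n. x i \<in> carrier A \<and> y i \<in> carrier A" using xy by simp
    have "h = (\<Oplus>\<^bsub>A\<^esub>i\<in>{..<n}. x i \<otimes>\<^bsub>A\<^esub> y i)" using sums(3)[OF xy' A.one_closed] h te by simp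
    moreover have "\<forall>a\<in>carrier A. (\<Oplus>\<^bsub>E\<^esub>i\<in>{..<n}. (a \<otimes>\<^bsub>A\<^esub> x i) \<otimes>\<^sub>e y i) =
        (\<Oplus>\<^bsub>E\<^esub>i\<in>{..<n}. x i \<otimes>\<^sub>e (y i \<otimes>\<^bsub>A\<^esub> \<nu> a))"
    proof
      fix a assume a: "a \<in> carrier A"
      then show "(\<Oplus>\<^bsub>E\<^esub>i\<in>{..<n}. (a \<otimes>\<^bsub>A\<^esub> x i) \<otimes>\<^sub>e y i) =
          (\<Oplus>\<^bsub>E\<^esub>i\<in>{..<n}. x i \<otimes>\<^sub>e (y i \<otimes>\<^bsub>A\<^esub> \<nu> a))"
        unfolding sums(1,2)[OF xy' a, symmetric] te[symmetric] using t(2) by blast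
    qed
    ultimately show "h \<in> H" using xy' unfolding twisted_higman_def T by blast
  qed
qed

lemma twisted_casimir_submodule: "submodule twisted_casimir k E"
proof -
  have "submodule {t \<in> carrier E. lmul a t = rtwist a t} k E" if "a \<in> carrier A" for a
    by (rule submodule_equalizer[OF lmul_linear[OF that] rtwist_linear[OF that] E_left_module E_left_module])
  note s = left_module.submoduleD[OF E_left_module this]
  show ?thesis
    by (rule left_module.submoduleI[OF E_left_module])
      (use s(2,3,4) A.one_closed in \<open>auto simp: twisted_casimir_def\<close>)
qed

lemma H_submodule: "submodule H k A"
  unfolding higman_eq by (rule submodule_image[OF mu_linear E_left_module alg_left_module twisted_casimir_submodule])

text \<open>Under \<mu> the map \<open>lmul a\<close> becomes left multiplication by a, and
  \<open>rtwist a\<close> becomes right multiplication by \<nu>(a). A tensor on which the two agree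
  has its image in the twisted center.\<close>

lemma H_subset_Z: "H \<subseteq> Z"
proof -
  have "\<mu> t \<otimes>\<^bsub>A\<^esub> \<nu> a = a \<otimes>\<^bsub>A\<^esub> \<mu> t" if t: "t \<in> twisted_casimir" and a: "a \<in> carrier A" for t a
  proof -
    have tE: "t \<in> carrier E" and LR: "lmul a t = rtwist a t" using t a by (auto simp: twisted_casimir_def)
    have "\<mu> (lmul a t) = a \<otimes>\<^bsub>A\<^esub> \<mu> t"
      by (rule E.T_eqI[OF linear_map_comp[OF lmul_linear[OF a] mu_linear]
            linear_map_comp[OF mu_linear mult_linear_right[OF a]] alg_left_module _ tE])
        (use a in \<open>simp add: lmul_pure mu_pure A.m_assoc\<close>)
    moreover have "\<mu> (rtwist a t) = \<mu> t \<otimes>\<^bsub>A\<^esub> \<nu> a"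
      by (rule E.T_eqI[OF linear_map_comp[OF rtwist_linear[OF a] mu_linear]
            linear_map_comp[OF mu_linear mult_linear_left] alg_left_module _ tE])
        (use a in \<open>simp_all add: rtwist_pure mu_pure A.m_assoc nu_simps\<close>)
    ultimately show ?thesis using LR by simp
  qed
  then show ?thesis
    using linear_map_closed[OF mu_linear] by (auto simp: higman_eq twisted_center_def twisted_casimir_def)
qed

lemma H_submodule_Z: "submodule H k AZ"
  by (rule left_module.submoduleI[OF AZ_left_module])
    (use H_subset_Z left_module.submoduleD[OF alg_left_module H_submodule] in auto)

text \<open>\<open>absorb z\<close> turns left multiplication by a \<otimes> 1 into
  \<open>lmul a\<close> and left multiplication by 1 \<otimes> a into \<open>rtwist a\<close>, so it
  sends Casimir elements to twisted ones. Any z of \<open>A\<close> is allowed, since it is inserted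
  between the two places where a acts.\<close>

lemma act_central_higman:
  assumes t: "t \<in> casimir" and z: "z \<in> carrier A"
  shows "t \<odot>\<^bsub>W.ME\<^esub> z \<in> H"
proof -
  have tE: "t \<in> carrier E" using t by (simp add: casimir_def)
  have "lmul a (absorb z t) = rtwist a (absorb z t)" if a: "a \<in> carrier A" for a
  proof -
    have "lmul a (absorb z t) = absorb z ((a \<otimes>\<^sub>e \<one>\<^bsub>A\<^esub>) \<otimes>\<^bsub>E\<^esub> t)"
      by (rule E.T_eqI[OF linear_map_comp[OF absorb_linear[OF z] lmul_linear[OF a]]
            linear_map_comp[OF EA.mult_linear_right absorb_linear[OF z]] E_left_module _ tE])
        (use a z in \<open>simp_all add: lmul_pure absorb_pure E.pure_mult pure_closed nu_simps A.m_assoc\<close>)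
    also have "\<dots> = absorb z ((\<one>\<^bsub>A\<^esub> \<otimes>\<^sub>e a) \<otimes>\<^bsub>E\<^esub> t)" using t a by (simp add: casimir_def)
    also have "\<dots> = rtwist a (absorb z t)"
      by (rule E.T_eqI[OF linear_map_comp[OF EA.mult_linear_right absorb_linear[OF z]]
            linear_map_comp[OF absorb_linear[OF z] rtwist_linear[OF a]] E_left_module _ tE])
        (use a z in \<open>simp_all add: rtwist_pure absorb_pure E.pure_mult pure_closed nu_simps A.m_assoc\<close>)
    finally show ?thesis .
  qed
  then have "absorb z t \<in> twisted_casimir" using linear_map_closed[OF absorb_linear[OF z] tE] by (simp add: twisted_casimir_def)
  moreover have "t \<odot>\<^bsub>W.ME\<^esub> z = \<mu> (absorb z t)"
  proof (rule E.T_eqI[OF _ linear_map_comp[OF absorb_linear[OF z] mu_linear] alg_left_module _ tE])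
    show "linear_map k E A (\<lambda>t. t \<odot>\<^bsub>W.ME\<^esub> z)"
      using W.act_linear[of z] z by (simp add: linear_map_def)
  qed (use z in \<open>simp_all add: W.act_pure absorb_pure mu_pure nu_simps A.m_assoc\<close>)
  ultimately show ?thesis by (simp add: higman_eq)
qed

section \<open>Bimodule maps from the algebra to its dual, and the twisted center\<close>

abbreviation "HS \<equiv> hom_space E R.ME D.ME"
abbreviation "PM T \<equiv> proj_maps T E R.ME D.ME"

definition "\<Psi> f = \<phi> (f \<one>\<^bsub>A\<^esub>)"

lemma HS_left_module: "left_module k HS"
  by (rule hom_space_left_module[OF EA.k_algebra_axioms R.ME_left_module D.ME_left_module])

text \<open>Writing a as a 1 and as 1 a expresses f(a) through f(1) from both sides. Transported by
  \<phi>, the two expressions differ exactly by the twist, and comparing them gives the defining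
  equation of the twisted center.\<close>

lemma phi_hom:
  assumes f: "f \<in> mod_hom E R.ME D.ME" and a: "a \<in> carrier A"
  shows phi_hom_left: "\<phi> (f a) = a \<otimes>\<^bsub>A\<^esub> \<Psi> f" and phi_hom_right: "\<phi> (f a) = \<Psi> f \<otimes>\<^bsub>A\<^esub> \<nu> a"
proof -
  note lin = mod_hom_linear[OF f]
  have f1: "f \<one>\<^bsub>A\<^esub> \<in> carrier (dual k A)" using linear_map_closed[OF lin] by simp
  show "\<phi> (f a) = a \<otimes>\<^bsub>A\<^esub> \<Psi> f"
    using RD.env_linear_lact[OF lin a, of "\<one>\<^bsub>A\<^esub>"] DW.env_linear_lact[OF phi_linear a, of "f \<one>\<^bsub>A\<^esub>"] f1 a
    by (simp add: \<Psi>_def)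
  show "\<phi> (f a) = \<Psi> f \<otimes>\<^bsub>A\<^esub> \<nu> a"
    using RD.env_linear_ract[OF lin a, of "\<one>\<^bsub>A\<^esub>"] DW.env_linear_ract[OF phi_linear a, of "f \<one>\<^bsub>A\<^esub>"] f1 a
    by (simp add: \<Psi>_def)
qed

lemma hom_closed: "\<lbrakk>f \<in> mod_hom E R.ME D.ME; a \<in> carrier A\<rbrakk> \<Longrightarrow> f a \<in> carrier (dual k A)"
  using linear_map_closed[OF mod_hom_linear] by fastforce

lemma Psi_in_Z:
  assumes f: "f \<in> mod_hom E R.ME D.ME"
  shows "\<Psi> f \<in> Z"
proof -
  have "\<Psi> f \<in> carrier A" unfolding \<Psi>_def by (intro phi_closed hom_closed[OF f] A.one_closed)
  moreover have "\<Psi> f \<otimes>\<^bsub>A\<^esub> \<nu> a = a \<otimes>\<^bsub>A\<^esub> \<Psi> f" if "a \<in> carrier A" for a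
    using phi_hom_left[OF f that] phi_hom_right[OF f that] by simp
  ultimately show ?thesis by (simp add: twisted_center_def)
qed

lemma Psi_linear: "linear_map k HS AZ \<Psi>"
proof (rule linear_mapI)
  fix c f assume c: "c \<in> carrier k" and "f \<in> carrier HS"
  then have "f \<one>\<^bsub>A\<^esub> \<in> carrier (dual k A)" using hom_closed by simp
  then show "\<Psi> (c \<odot>\<^bsub>HS\<^esub> f) = c \<odot>\<^bsub>AZ\<^esub> \<Psi> f"
    using c linear_map_smult[OF DW.env_linear_k[OF phi_linear], of c "f \<one>\<^bsub>A\<^esub>"]
    by (simp add: \<Psi>_def D.act_scalar)
next
  fix f g assume "f \<in> carrier HS" "g \<in> carrier HS"
  then have "f \<one>\<^bsub>A\<^esub> \<in> carrier (dual k A)" "g \<one>\<^bsub>A\<^esub> \<in> carrier (dual k A)" using hom_closed by simp_all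
  then show "\<Psi> (f \<oplus>\<^bsub>HS\<^esub> g) = \<Psi> f \<oplus>\<^bsub>AZ\<^esub> \<Psi> g"
    using linear_map_add[OF phi_linear, of "f \<one>\<^bsub>A\<^esub>" "g \<one>\<^bsub>A\<^esub>"] by (simp add: \<Psi>_def)
qed (simp add: Psi_in_Z)

text \<open>The map b \<mapsto> b z is left linear for every z. It is right linear into the twisted
  bimodule because (b a) z = b (a z) = b z \<nu>(a), the last step being the equation of the twisted
  center.\<close>

lemma hom_of_center:
  assumes z: "z \<in> Z"
  shows "(\<lambda>b\<in>carrier A. \<psi> (b \<otimes>\<^bsub>A\<^esub> z)) \<in> mod_hom E R.ME D.ME"
proof -
  have "linear_map E R.ME W.ME (\<lambda>b. b \<otimes>\<^bsub>A\<^esub> z)"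
    by (rule RW.env_linearI)
      (use ZD[OF z] mult_linear_left[OF ZD(1)[OF z]] in \<open>simp_all add: linear_map_def A.m_assoc nu_simps\<close>)
  from restrict_mod_hom[OF R.ME_left_module linear_map_comp[OF this psi_linear]]
  show ?thesis by simp
qed

text \<open>A map is recovered from its value at 1 by f(a) = \<psi> (a \<Psi>(f)), which gives
  injectivity; the same formula with z in place of \<Psi>(f) defines a preimage of z.\<close>

lemma Psi_bij: "bij_betw \<Psi> (carrier HS) (carrier AZ)"
proof (rule bij_betwI')
  fix f g assume f: "f \<in> carrier HS" and g: "g \<in> carrier HS"
  have "f = g" if "\<Psi> f = \<Psi> g"
  proof (rule mod_hom_eqI)
    show "f \<in> mod_hom E R.ME D.ME" "g \<in> mod_hom E R.ME D.ME" using f g by simp_all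
    then show "f x = g x" if "x \<in> carrier R.ME" for x
      using phi_hom_left[of f x] phi_hom_left[of g x] \<open>\<Psi> f = \<Psi> g\<close> that hom_closed psi_phi
      by (metis R.ME_simps(1) regular_simps(1))
  qed
  then show "\<Psi> f = \<Psi> g \<longleftrightarrow> f = g" by auto
next
  fix z assume "z \<in> carrier AZ"
  then have z: "z \<in> Z" by simp
  have "\<Psi> (\<lambda>b\<in>carrier A. \<psi> (b \<otimes>\<^bsub>A\<^esub> z)) = z" using ZD(1)[OF z] by (simp add: \<Psi>_def phi_psi)
  from this[symmetric] show "\<exists>f\<in>carrier HS. z = \<Psi> f"
    by (rule bexI[where x = "\<lambda>b\<in>carrier A. \<psi> (b \<otimes>\<^bsub>A\<^esub> z)"]) (simp add: hom_of_center[OF z])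
qed (simp add: Psi_in_Z)

section \<open>Maps through projective modules and the Higman ideal\<close>

lemma proj_maps_subset: "(PM TYPE('i \<Rightarrow> ('a \<times> 'a \<Rightarrow> 'k) set)) \<subseteq> mod_hom E R.ME D.ME"
proof
  fix f assume "f \<in> (PM TYPE('i \<Rightarrow> ('a \<times> 'a \<Rightarrow> 'k) set))"
  then obtain P g h where g: "g \<in> mod_hom E R.ME (P :: (('a \<times> 'a \<Rightarrow> 'k) set, 'i \<Rightarrow> ('a \<times> 'a \<Rightarrow> 'k) set) module)" and h: "h \<in> mod_hom E P D.ME"
    and f: "f = compose (carrier R.ME) h g"
    by (auto simp: proj_maps_def)
  show "f \<in> mod_hom E R.ME D.ME"
    unfolding f compose_def
    by (rule restrict_mod_hom[OF R.ME_left_module linear_map_comp[OF mod_hom_linear[OF g] mod_hom_linear[OF h]]])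
qed

text \<open>A splitting of the projective module replaces it by a free one. The image w of 1 there
  has finitely many nonzero coordinates, all of them Casimir elements, and \<Psi>(f) is the sum of
  w_p acting on the value of the second map at the p-th basis element.\<close>

lemma Psi_proj_maps:
  assumes "f \<in> (PM TYPE('i \<Rightarrow> ('a \<times> 'a \<Rightarrow> 'k) set))"
  shows "\<Psi> f \<in> H"
proof -
  obtain P g h where P: "projective E (P :: (('a \<times> 'a \<Rightarrow> 'k) set, 'i \<Rightarrow> ('a \<times> 'a \<Rightarrow> 'k) set) module)" and g: "g \<in> mod_hom E R.ME P"
    and h: "h \<in> mod_hom E P D.ME" and f: "f = compose (carrier R.ME) h g"
    using assms by (auto simp: proj_maps_def)
  obtain I :: "('i \<Rightarrow> ('a \<times> 'a \<Rightarrow> 'k) set) set" and i q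
    where i: "i \<in> mod_hom E P (free_mod E I)" and q: "q \<in> mod_hom E (free_mod E I) P"
    and qi: "\<And>x. x \<in> carrier P \<Longrightarrow> q (i x) = x"
    using P by (auto simp: projective_def)
  let ?G = "\<lambda>a. i (g a)" and ?Q = "\<lambda>w. \<phi> (h (q w))"
  have G: "linear_map E R.ME (free_mod E I) ?G"
    by (rule linear_map_comp[OF mod_hom_linear[OF g] mod_hom_linear[OF i]])
  have Q: "linear_map E (free_mod E I) W.ME ?Q"
    by (rule linear_map_comp[OF linear_map_comp[OF mod_hom_linear[OF q] mod_hom_linear[OF h]] phi_linear])
  let ?w = "?G \<one>\<^bsub>A\<^esub>"
  have w: "?w \<in> carrier (free_mod E I)" using linear_map_closed[OF G] by simp
  \<comment> \<open>In the regular bimodule a \<otimes> 1 and 1 \<otimes> a both send 1 to a, so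
    they also agree on the image of 1. In a free module this equality holds coordinate by
    coordinate.\<close>
  have "(a \<otimes>\<^sub>e \<one>\<^bsub>A\<^esub>) \<odot>\<^bsub>free_mod E I\<^esub> ?w = (\<one>\<^bsub>A\<^esub> \<otimes>\<^sub>e a) \<odot>\<^bsub>free_mod E I\<^esub> ?w" if a: "a \<in> carrier A" for a
    using a linear_map_smult[OF G, of "a \<otimes>\<^sub>e \<one>\<^bsub>A\<^esub>" "\<one>\<^bsub>A\<^esub>", symmetric]
      linear_map_smult[OF G, of "\<one>\<^bsub>A\<^esub> \<otimes>\<^sub>e a" "\<one>\<^bsub>A\<^esub>", symmetric]
    by (simp add: pure_closed R.act_pure del: free_mod_simps)
  then have w_casimir: "?w p \<in> casimir" for p
    using w EA.free_mod_carrier[of ?w I] by (auto simp: casimir_def dest: fun_cong)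
  interpret WE: left_module E W.ME by (rule W.ME_left_module)
  have Qs: "(\<lambda>p. ?Q (single E p)) \<in> I \<rightarrow> carrier W.ME"
    using linear_map_closed[OF Q EA.single_closed] by auto
  \<comment> \<open>\<open>?Q\<close> is the linear extension of its own values on the basis, which
    makes its value at w a finite sum.\<close>
  have "?Q ?w = lin_ext E W.ME (\<lambda>p. ?Q (single E p)) ?w"
    by (rule linear_map_free_mod_eqI[OF Q WE.lin_ext_linear[OF Qs] W.ME_left_module _ w])
      (simp add: WE.lin_ext_single[OF Qs])
  also have "\<dots> \<in> H"
  proof -
    have fin: "finite {p. ?w p \<noteq> \<zero>\<^bsub>E\<^esub>}" and sub: "{p. ?w p \<noteq> \<zero>\<^bsub>E\<^esub>} \<subseteq> I"
      using w EA.free_mod_carrier[of ?w I] by auto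
    have summand: "?w p \<odot>\<^bsub>W.ME\<^esub> ?Q (single E p) \<in> H" if "p \<in> {p. ?w p \<noteq> \<zero>\<^bsub>E\<^esub>}" for p
    proof -
      have "p \<in> I" using sub that by blast
      then show ?thesis using Qs by (intro act_central_higman w_casimir) auto
    qed
    have zero: "\<zero>\<^bsub>A\<^esub> \<in> H" and add: "\<And>x y. x \<in> H \<Longrightarrow> y \<in> H \<Longrightarrow> x \<oplus>\<^bsub>A\<^esub> y \<in> H" and HA: "H \<subseteq> carrier A"
      using left_module.submoduleD[OF alg_left_module H_submodule] by auto
    have "(\<Oplus>\<^bsub>W.ME\<^esub>p\<in>T. ?w p \<odot>\<^bsub>W.ME\<^esub> ?Q (single E p)) \<in> H"
      if "finite T" "T \<subseteq> {p. ?w p \<noteq> \<zero>\<^bsub>E\<^esub>}" for T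
      using that
    proof (induction T rule: finite_induct)
      case (insert p T)
      then show ?case
        using summand HA by (subst WE.M.finsum_insert) (auto intro!: add simp: subset_iff Pi_iff)
    qed (use zero in simp)
    then show ?thesis unfolding lin_ext_def using fin by blast
  qed
  moreover have "\<Psi> f = ?Q ?w"
    using linear_map_closed[OF mod_hom_linear[OF g]] qi by (simp add: \<Psi>_def f compose_def)
  ultimately show ?thesis by simp
qed

text \<open>With \<xi> the untwisted tensor, f is the composite of b \<mapsto> (b \<otimes> 1) \<xi>
  and s \<mapsto> \<psi> (s 1). The Casimir property of \<xi> makes the former linear over
  \<open>E\<close>; the latter is so for any choice of \<xi>.\<close>

lemma proj_mapsI:
  assumes f: "f \<in> mod_hom E R.ME D.ME" and "\<Psi> f \<in> H"
  shows "f \<in> (PM TYPE('i \<Rightarrow> ('a \<times> 'a \<Rightarrow> 'k) set))"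
proof -
  obtain t where t: "t \<in> twisted_casimir" and Psi: "\<Psi> f = \<mu> t" using assms(2) by (auto simp: higman_eq)
  have tE: "t \<in> carrier E" using t by (simp add: twisted_casimir_def)
  define \<xi> where "\<xi> = untwist t"
  have \<xi>E: "\<xi> \<in> carrier E" unfolding \<xi>_def by (rule linear_map_closed[OF untwist_linear tE])
  note n' = ring_hom_closed[OF nu'_hom] ring_hom_mult[OF nu'_hom] nu_nu' nu'_nu
  have \<xi>: "(a \<otimes>\<^sub>e \<one>\<^bsub>A\<^esub>) \<otimes>\<^bsub>E\<^esub> \<xi> = (\<one>\<^bsub>A\<^esub> \<otimes>\<^sub>e a) \<otimes>\<^bsub>E\<^esub> \<xi>" if a: "a \<in> carrier A" for a
  proof -
    have "(a \<otimes>\<^sub>e \<one>\<^bsub>A\<^esub>) \<otimes>\<^bsub>E\<^esub> untwist t = untwist (lmul a t)"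
      by (rule E.T_eqI[OF linear_map_comp[OF untwist_linear EA.mult_linear_right]
            linear_map_comp[OF lmul_linear[OF a] untwist_linear] E_left_module _ tE])
        (use a in \<open>simp_all add: lmul_pure untwist_pure E.pure_mult pure_closed n'\<close>)
    also have "\<dots> = untwist (rtwist a t)" using t a by (simp add: twisted_casimir_def)
    also have "\<dots> = (\<one>\<^bsub>A\<^esub> \<otimes>\<^sub>e a) \<otimes>\<^bsub>E\<^esub> untwist t"
      by (rule E.T_eqI[OF linear_map_comp[OF rtwist_linear[OF a] untwist_linear]
            linear_map_comp[OF untwist_linear EA.mult_linear_right] E_left_module _ tE])
        (use a in \<open>simp_all add: rtwist_pure untwist_pure E.pure_mult pure_closed n' nu_simps\<close>)
    finally show ?thesis by (simp add: \<xi>_def)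
  qed
  \<comment> \<open>On x \<otimes> y untwisting and acting on 1 give x \<nu>(\<nu>'(y)) = x y: the
    twist of the right action cancels the inverse, and \<mu> remains.\<close>
  have \<xi>1: "\<xi> \<odot>\<^bsub>W.ME\<^esub> \<one>\<^bsub>A\<^esub> = \<Psi> f"
    unfolding Psi \<xi>_def
  proof (rule E.T_eqI[OF linear_map_comp[OF untwist_linear] mu_linear alg_left_module _ tE])
    show "linear_map k E A (\<lambda>t. t \<odot>\<^bsub>W.ME\<^esub> \<one>\<^bsub>A\<^esub>)"
      using W.act_linear[of "\<one>\<^bsub>A\<^esub>"] by (simp add: linear_map_def)
  qed (simp_all add: W.act_pure untwist_pure mu_pure n' nu_simps)
  \<comment> \<open>A single copy of \<open>A\<^sup>e\<close> suffices, so every index type \<open>'i\<close> gives the same maps.\<close>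
  let ?i = "undefined :: 'i"
  let ?P = "free_mod E {?i}"
  let ?g = "\<lambda>b j. if j = ?i then (b \<otimes>\<^sub>e \<one>\<^bsub>A\<^esub>) \<otimes>\<^bsub>E\<^esub> \<xi> else \<zero>\<^bsub>E\<^esub>"
  let ?h = "\<lambda>w. \<psi> (w ?i \<odot>\<^bsub>W.ME\<^esub> \<one>\<^bsub>A\<^esub>)"
  have pure_lin: "linear_map k A E (\<lambda>b. b \<otimes>\<^sub>e \<one>\<^bsub>A\<^esub>)"
    by (rule linear_mapI) (simp_all add: pure_closed E.pure_add_left E.pure_smult_left)
  \<comment> \<open>For x \<otimes> y the claim is (x b y \<otimes> 1) \<xi> = (x b \<otimes> y)
    \<xi>. The factor y \<otimes> 1 standing next to \<xi> may be exchanged for 1 \<otimes> y, and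
    this is the only use of the Casimir property.\<close>
  have act: "((t \<odot>\<^bsub>R.ME\<^esub> b) \<otimes>\<^sub>e \<one>\<^bsub>A\<^esub>) \<otimes>\<^bsub>E\<^esub> \<xi> = t \<otimes>\<^bsub>E\<^esub> ((b \<otimes>\<^sub>e \<one>\<^bsub>A\<^esub>) \<otimes>\<^bsub>E\<^esub> \<xi>)"
    if t: "t \<in> carrier E" and b: "b \<in> carrier A" for t b
  proof (rule E.T_eqI[OF linear_map_comp[OF linear_map_comp[OF _ pure_lin] EA.mult_linear_left[OF \<xi>E]]
        EA.mult_linear_left E_left_module _ t])
    show "linear_map k E A (\<lambda>t. t \<odot>\<^bsub>R.ME\<^esub> b)"
      using R.act_linear[of b] b by (simp add: linear_map_def)
    show "(b \<otimes>\<^sub>e \<one>\<^bsub>A\<^esub>) \<otimes>\<^bsub>E\<^esub> \<xi> \<in> carrier E" using b \<xi>E pure_closed by simp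
    fix x y assume x: "x \<in> carrier A" and "y \<in> carrier (op_alg A)"
    then have y: "y \<in> carrier A" by simp
    have "((x \<otimes>\<^bsub>A\<^esub> (b \<otimes>\<^bsub>A\<^esub> y)) \<otimes>\<^sub>e \<one>\<^bsub>A\<^esub>) \<otimes>\<^bsub>E\<^esub> \<xi> =
        ((x \<otimes>\<^bsub>A\<^esub> b) \<otimes>\<^sub>e \<one>\<^bsub>A\<^esub>) \<otimes>\<^bsub>E\<^esub> ((y \<otimes>\<^sub>e \<one>\<^bsub>A\<^esub>) \<otimes>\<^bsub>E\<^esub> \<xi>)"
      using x y b \<xi>E by (simp add: EA.A.m_assoc[symmetric] pure_closed E.pure_mult A.m_assoc)
    also have "\<dots> = ((x \<otimes>\<^sub>e y) \<otimes>\<^bsub>E\<^esub> (b \<otimes>\<^sub>e \<one>\<^bsub>A\<^esub>)) \<otimes>\<^bsub>E\<^esub> \<xi>"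
      using x y b \<xi>E by (simp add: \<xi> EA.A.m_assoc[symmetric] pure_closed E.pure_mult)
    also have "\<dots> = (x \<otimes>\<^sub>e y) \<otimes>\<^bsub>E\<^esub> ((b \<otimes>\<^sub>e \<one>\<^bsub>A\<^esub>) \<otimes>\<^bsub>E\<^esub> \<xi>)"
      using x y b \<xi>E by (simp add: EA.A.m_assoc pure_closed)
    finally show "(((x \<otimes>\<^sub>e y) \<odot>\<^bsub>R.ME\<^esub> b) \<otimes>\<^sub>e \<one>\<^bsub>A\<^esub>) \<otimes>\<^bsub>E\<^esub> \<xi> =
        (x \<otimes>\<^sub>e y) \<otimes>\<^bsub>E\<^esub> ((b \<otimes>\<^sub>e \<one>\<^bsub>A\<^esub>) \<otimes>\<^bsub>E\<^esub> \<xi>)"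
      using x y b by (simp add: R.act_pure)
  qed
  have gE: "(b \<otimes>\<^sub>e \<one>\<^bsub>A\<^esub>) \<otimes>\<^bsub>E\<^esub> \<xi> \<in> carrier E" if "b \<in> carrier A" for b
    using that \<xi>E pure_closed by simp
  have g: "linear_map E R.ME ?P ?g"
  proof (rule linear_mapI)
    fix b assume "b \<in> carrier R.ME"
    moreover have "{j. ?g b j \<noteq> \<zero>\<^bsub>E\<^esub>} \<subseteq> {?i}" by auto
    ultimately show "?g b \<in> carrier ?P"
      using gE by (auto simp: EA.free_mod_carrier intro: finite_subset)
  qed (auto simp: fun_eq_iff E.pure_add_left pure_closed EA.l_distr \<xi>E act)
  have h: "linear_map E ?P D.ME ?h"
  proof (rule linear_map_comp[OF _ psi_linear], rule linear_mapI)
    show "w ?i \<odot>\<^bsub>W.ME\<^esub> \<one>\<^bsub>A\<^esub> \<in> carrier W.ME" if "w \<in> carrier ?P" for w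
      using that W.act_closed[of "w ?i" "\<one>\<^bsub>A\<^esub>"] by (simp add: EA.free_mod_carrier)
  qed (use W.act_assoc[of _ _ "\<one>\<^bsub>A\<^esub>"] linear_map_add[OF W.act_linear[of "\<one>\<^bsub>A\<^esub>"]] in
      \<open>auto simp: EA.free_mod_carrier\<close>)
  have "f = compose (carrier R.ME) (restrict ?h (carrier ?P)) (restrict ?g (carrier R.ME))"
  proof (rule extensionalityI[OF mod_hom_extensional[OF f]])
    show "compose (carrier R.ME) (restrict ?h (carrier ?P)) (restrict ?g (carrier R.ME)) \<in> extensional (carrier R.ME)"
      by (rule compose_extensional)
    fix b assume b: "b \<in> carrier R.ME"
    then have bA: "b \<in> carrier A" by simp
    \<comment> \<open>Associativity of the action moves b \<otimes> 1 outside, where it acts on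
      \<xi> 1 = \<Psi>(f) as left multiplication by b. This is the formula that determines
      f.\<close>
    have "((b \<otimes>\<^sub>e \<one>\<^bsub>A\<^esub>) \<otimes>\<^bsub>E\<^esub> \<xi>) \<odot>\<^bsub>W.ME\<^esub> \<one>\<^bsub>A\<^esub> = b \<otimes>\<^bsub>A\<^esub> \<Psi> f"
      using W.act_assoc[of "b \<otimes>\<^sub>e \<one>\<^bsub>A\<^esub>" \<xi> "\<one>\<^bsub>A\<^esub>"] bA \<xi>E \<xi>1 ZD(1)[OF Psi_in_Z[OF f]]
      by (simp add: pure_closed W.act_pure nu_simps)
    also have "\<dots> = \<phi> (f b)" using phi_hom_left[OF f bA] by simp
    finally show "f b = compose (carrier R.ME) (restrict ?h (carrier ?P)) (restrict ?g (carrier R.ME)) b"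
      using b linear_map_closed[OF g b] psi_phi[OF hom_closed[OF f bA]] by (simp add: compose_def)
  qed
  then show ?thesis
    using EA.projective_free_mod_single[of ?i] restrict_mod_hom[OF R.ME_left_module g]
      restrict_mod_hom[OF EA.free_mod_left_module h]
    unfolding proj_maps_def by blast
qed

lemma proj_maps_eq: "(PM TYPE('i \<Rightarrow> ('a \<times> 'a \<Rightarrow> 'k) set)) = {f \<in> carrier HS. \<Psi> f \<in> H}"
  using proj_maps_subset Psi_proj_maps proj_mapsI by auto

text \<open>As the preimage of \<open>H\<close> under the linear map \<Psi> the set is closed under
  addition, although two of its elements may factor through different projective modules.\<close>

lemma proj_maps_submodule: "submodule (PM TYPE('i \<Rightarrow> ('a \<times> 'a \<Rightarrow> 'k) set)) k HS"
  unfolding proj_maps_eq by (rule submodule_vimage[OF Psi_linear HS_left_module AZ_left_module H_submodule_Z])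

lemma Psi_image_proj_maps: "\<Psi> ` (PM TYPE('i \<Rightarrow> ('a \<times> 'a \<Rightarrow> 'k) set)) = H"
proof
  show "H \<subseteq> \<Psi> ` (PM TYPE('i \<Rightarrow> ('a \<times> 'a \<Rightarrow> 'k) set))"
  proof
    fix z assume z: "z \<in> H"
    then obtain f where "f \<in> carrier HS" "z = \<Psi> f"
      using H_subset_Z Psi_bij by (auto simp: bij_betw_def)
    then show "z \<in> \<Psi> ` (PM TYPE('i \<Rightarrow> ('a \<times> 'a \<Rightarrow> 'k) set))" using z proj_mapsI by auto
  qed
qed (use Psi_proj_maps in auto)

lemma stable_hom_isomorphic:
  "mod_isomorphic k (stable_hom TYPE('i \<Rightarrow> ('a \<times> 'a \<Rightarrow> 'k) set) E R.ME D.ME) (quot_mod AZ H)"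
  using quot_mod_isomorphic[OF Psi_linear Psi_bij HS_left_module AZ_left_module proj_maps_submodule]
  by (simp add: stable_hom_def Psi_image_proj_maps)

end

section \<open>The twisted center and trace functionals\<close>

context nakayama
begin

abbreviation "K \<equiv> commutator_space k A"

lemma K_quotient: "quotient k A K"
proof (intro quotient.intro quotient_axioms.intro alg_left_module)
  show "submodule K k A"
    unfolding commutator_space_def
    by (rule left_module.lin_span_submodule[OF alg_left_module]) auto
qed

sublocale Q: quotient k A K by (rule K_quotient)

lemma quot_commutator:
  assumes "x \<in> carrier A" "y \<in> carrier A"
  shows "K +>\<^bsub>A\<^esub> (x \<otimes>\<^bsub>A\<^esub> y) = K +>\<^bsub>A\<^esub> (y \<otimes>\<^bsub>A\<^esub> x)"
proof -
  have "x \<otimes>\<^bsub>A\<^esub> y \<ominus>\<^bsub>A\<^esub> y \<otimes>\<^bsub>A\<^esub> x \<in> K"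
    unfolding commutator_space_def using assms by (intro subsetD[OF lin_span_superset]) blast
  then show ?thesis using assms by (simp add: Q.coset_eq)
qed

text \<open>A map with the trace property kills commutators, and its zero set is a submodule, hence
  contains their span.\<close>

lemma commutator_kernel:
  assumes f: "linear_map k A V f" and V: "left_module k V"
    and fxy: "\<And>x y. \<lbrakk>x \<in> carrier A; y \<in> carrier A\<rbrakk> \<Longrightarrow> f (x \<otimes>\<^bsub>A\<^esub> y) = f (y \<otimes>\<^bsub>A\<^esub> x)"
    and x: "x \<in> K"
  shows "f x = \<zero>\<^bsub>V\<^esub>"
proof -
  interpret V: left_module k V by fact
  have "submodule {\<zero>\<^bsub>V\<^esub>} k V"
    by (rule V.submoduleI) (auto simp: V.smult_zero_right)
  from submodule_vimage[OF f alg_left_module V this]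
  have "K \<subseteq> {x \<in> carrier A. f x \<in> {\<zero>\<^bsub>V\<^esub>}}"
    unfolding commutator_space_def
  proof (rule lin_span_least)
    show "{x \<otimes>\<^bsub>A\<^esub> y \<ominus>\<^bsub>A\<^esub> y \<otimes>\<^bsub>A\<^esub> x |x y. x \<in> carrier A \<and> y \<in> carrier A} \<subseteq> {x \<in> carrier A. f x \<in> {\<zero>\<^bsub>V\<^esub>}}"
    proof clarsimp
      fix x y assume xy: "x \<in> carrier A" "y \<in> carrier A"
      then show "f (x \<otimes>\<^bsub>A\<^esub> y \<ominus>\<^bsub>A\<^esub> y \<otimes>\<^bsub>A\<^esub> x) = \<zero>\<^bsub>V\<^esub>"
        using fxy[OF xy] linear_map_closed[OF f, of "y \<otimes>\<^bsub>A\<^esub> x"]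
        by (subst linear_map_minus[OF f alg_left_module V]) (simp_all add: a_minus_def V.M.r_neg)
    qed
  qed
  then show ?thesis using x by auto
qed

text \<open>Pulls a functional on A/[A,A] back to a trace functional on \<open>A\<close> and reads
  it in \<open>A\<close> through \<phi>.\<close>

definition "\<Theta> g = \<phi> (\<lambda>x\<in>carrier A. g (K +>\<^bsub>A\<^esub> x))"

lemma trace_dual:
  assumes g: "g \<in> carrier (dual k (quot_mod A K))"
  shows "(\<lambda>x\<in>carrier A. g (K +>\<^bsub>A\<^esub> x)) \<in> carrier (dual k A)"
proof -
  have "linear_map k A (left_regular k) (\<lambda>x. g (K +>\<^bsub>A\<^esub> x))"
    using g by (intro linear_map_comp[OF Q.linear_map_proj]) (simp add: dual_carrier)
  then show ?thesis by (auto simp: dual_carrier linear_map_def)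
qed

text \<open>\<phi> sends f a to \<phi>(f) \<nu>(a) and a f to a \<phi>(f). Being injective, it
  translates membership in the twisted center into f a = a f for all a, and evaluating at x turns
  this into f(a x) = f(x a).\<close>

lemma central_iff:
  assumes f: "f \<in> carrier (dual k A)"
  shows "\<phi> f \<in> Z \<longleftrightarrow> (\<forall>x\<in>carrier A. \<forall>y\<in>carrier A. f (x \<otimes>\<^bsub>A\<^esub> y) = f (y \<otimes>\<^bsub>A\<^esub> x))"
proof -
  have cl: "lact (dual_bimod k A) a f \<in> carrier (dual k A)" "ract (dual_bimod k A) f a \<in> carrier (dual k A)"
    if "a \<in> carrier A" for a
    using D.lact_closed[OF that, of f] D.ract_closed[OF that, of f] f by simp_all
  have "\<phi> f \<in> Z \<longleftrightarrow> (\<forall>a\<in>carrier A. \<phi> (ract (dual_bimod k A) f a) = \<phi> (lact (dual_bimod k A) a f))"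
    using DW.env_linear_lact[OF phi_linear] DW.env_linear_ract[OF phi_linear] f phi_closed[OF f]
    by (simp add: twisted_center_def)
  also have "\<dots> \<longleftrightarrow> (\<forall>a\<in>carrier A. ract (dual_bimod k A) f a = lact (dual_bimod k A) a f)"
    using psi_phi[OF cl(1)] psi_phi[OF cl(2)] by metis
  also have "\<dots> \<longleftrightarrow> (\<forall>a\<in>carrier A. \<forall>x\<in>carrier A. f (a \<otimes>\<^bsub>A\<^esub> x) = f (x \<otimes>\<^bsub>A\<^esub> a))"
    by (simp add: restrict_def fun_eq_iff) blast
  finally show ?thesis .
qed

lemma Theta_linear: "linear_map k (dual k (quot_mod A K)) AZ \<Theta>"
proof (rule linear_mapI)
  note lin = DW.env_linear_k[OF phi_linear]
  have proj: "K +>\<^bsub>A\<^esub> x \<in> carrier (quot_mod A K)" if "x \<in> carrier A" for x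
    using that by (simp add: Q.quot_carrier)
  fix g assume g: "g \<in> carrier (dual k (quot_mod A K))"
  show "\<Theta> g \<in> carrier AZ"
    using central_iff[OF trace_dual[OF g]] quot_commutator by (simp add: \<Theta>_def)
  show "\<Theta> (c \<odot>\<^bsub>dual k (quot_mod A K)\<^esub> g) = c \<odot>\<^bsub>AZ\<^esub> \<Theta> g" if c: "c \<in> carrier k" for c
  proof -
    have "(\<lambda>x\<in>carrier A. (c \<odot>\<^bsub>dual k (quot_mod A K)\<^esub> g) (K +>\<^bsub>A\<^esub> x)) =
        c \<odot>\<^bsub>dual_bimod k A\<^esub> (\<lambda>x\<in>carrier A. g (K +>\<^bsub>A\<^esub> x))"
      using proj by (auto simp: dual_simps intro!: restrict_ext)
    then show ?thesis
      using linear_map_smult[OF lin c, of "\<lambda>x\<in>carrier A. g (K +>\<^bsub>A\<^esub> x)"] trace_dual[OF g]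
      by (simp add: \<Theta>_def)
  qed
  fix h assume h: "h \<in> carrier (dual k (quot_mod A K))"
  have "(\<lambda>x\<in>carrier A. (g \<oplus>\<^bsub>dual k (quot_mod A K)\<^esub> h) (K +>\<^bsub>A\<^esub> x)) =
      (\<lambda>x\<in>carrier A. g (K +>\<^bsub>A\<^esub> x)) \<oplus>\<^bsub>dual_bimod k A\<^esub> (\<lambda>x\<in>carrier A. h (K +>\<^bsub>A\<^esub> x))"
    using proj by (auto simp: dual_simps intro!: restrict_ext)
  then show "\<Theta> (g \<oplus>\<^bsub>dual k (quot_mod A K)\<^esub> h) = \<Theta> g \<oplus>\<^bsub>AZ\<^esub> \<Theta> h"
    using linear_map_add[OF lin, of "\<lambda>x\<in>carrier A. g (K +>\<^bsub>A\<^esub> x)" "\<lambda>x\<in>carrier A. h (K +>\<^bsub>A\<^esub> x)"]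
      trace_dual[OF g] trace_dual[OF h]
    by (simp add: \<Theta>_def)
qed

text \<open>A functional on the quotient is determined by its pullback, since the projection is
  onto, and \<psi> recovers the pullback from its image under \<phi>. Conversely the functional
  \<psi> z of a twisted central z has the trace property and factors through the quotient.\<close>

lemma Theta_bij: "bij_betw \<Theta> (carrier (dual k (quot_mod A K))) (carrier AZ)"
proof (rule bij_betwI')
  fix g h assume g: "g \<in> carrier (dual k (quot_mod A K))" and h: "h \<in> carrier (dual k (quot_mod A K))"
  have "g = h" if "\<Theta> g = \<Theta> h"
  proof (rule extensionalityI)
    show "g \<in> extensional (carrier (quot_mod A K))" "h \<in> extensional (carrier (quot_mod A K))"
      using g h by (simp_all add: dual_carrier)
    have eq: "(\<lambda>x\<in>carrier A. g (K +>\<^bsub>A\<^esub> x)) = (\<lambda>x\<in>carrier A. h (K +>\<^bsub>A\<^esub> x))"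
      using arg_cong[OF that, of \<psi>]
      unfolding \<Theta>_def psi_phi[OF trace_dual[OF g]] psi_phi[OF trace_dual[OF h]] .
    fix C assume "C \<in> carrier (quot_mod A K)"
    then obtain x where "x \<in> carrier A" "C = K +>\<^bsub>A\<^esub> x" by (auto simp: Q.quot_carrier)
    then show "g C = h C" using fun_cong[OF eq, of x] by simp
  qed
  then show "\<Theta> g = \<Theta> h \<longleftrightarrow> g = h" by auto
next
  show "\<And>g. g \<in> carrier (dual k (quot_mod A K)) \<Longrightarrow> \<Theta> g \<in> carrier AZ"
    by (rule linear_map_closed[OF Theta_linear])
next
  fix z assume "z \<in> carrier AZ"
  then have z: "z \<in> Z" by simp
  define f where "f = \<psi> z"
  have fA: "f \<in> carrier (dual k A)" and fz: "\<phi> f = z"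
    using psi_closed phi_psi ZD(1)[OF z] by (simp_all add: f_def)
  have V: "left_module k (left_regular k)"
    by (rule k_algebra.alg_left_module[OF left_regular_k_algebra[OF K.field_axioms]])
  have lin: "linear_map k A (left_regular k) f" using fA by (simp add: dual_carrier)
  have "f (x \<otimes>\<^bsub>A\<^esub> y) = f (y \<otimes>\<^bsub>A\<^esub> x)" if "x \<in> carrier A" "y \<in> carrier A" for x y
    using central_iff[OF fA] fz z that by blast
  note ker = commutator_kernel[OF lin V this]
  \<comment> \<open>The factorization of f through A/[A,A], restricted because elements of the dual
    are extensional functions on the carrier of the quotient.\<close>
  let ?g = "\<lambda>C\<in>carrier (quot_mod A K). the_elem (f ` C)"
  have g: "?g \<in> carrier (dual k (quot_mod A K))"
    using restrict_mod_hom[OF Q.quot_left_module Q.linear_map_quot_factor[OF lin V ker]]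
    by (simp add: dual_carrier mod_hom_eq)
  have "(\<lambda>x\<in>carrier A. ?g (K +>\<^bsub>A\<^esub> x)) = f"
  proof (rule extensionalityI)
    fix x assume x: "x \<in> carrier A"
    then show "(\<lambda>x\<in>carrier A. ?g (K +>\<^bsub>A\<^esub> x)) x = f x"
      using Q.quot_factor_proj[OF lin V ker x] by (simp add: Q.quot_carrier)
  qed (use fA in \<open>simp_all add: dual_carrier\<close>)
  then have "z = \<Theta> ?g" using fz by (simp only: \<Theta>_def)
  then show "\<exists>g\<in>carrier (dual k (quot_mod A K)). z = \<Theta> g" using g by (rule bexI)
qed

lemma center_isomorphic: "mod_isomorphic k AZ (dual k (quot_mod A K))"
proof -
  have dual: "left_module k (dual k (quot_mod A K))"
    by (rule dual_left_module[OF K.field_axioms Q.quot_left_module])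
  show ?thesis
    by (rule mod_isomorphic_sym[OF mod_isomorphicI[OF Theta_linear Theta_bij dual] dual AZ_left_module])
qed

end

text \<open>\<open>quot_mod\<close> is defined for arbitrary subsets, so the submodule clauses are
  what makes the quotients in the first isomorphism genuine vector spaces. The index type
  \<open>'i\<close> is arbitrary, so the quotient on the right is the same for every universe of
  this form.\<close>

theorem proposition7p12:
  fixes k :: "('k, 'z) ring_scheme" and A :: "('k, 'a) module" and \<nu> :: "'a \<Rightarrow> 'a"
  assumes "frobenius_algebra k A"
    and "separable_algebra k (quot_mod A (jacobson_radical A))"
    and "nakayama_automorphism k A \<nu>"
  shows "submodule (twisted_center A \<nu>) k A \<and>
    submodule (twisted_higman k A \<nu>) k (A\<lparr>carrier := twisted_center A \<nu>\<rparr>) \<and>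
    submodule
      (proj_maps TYPE('i \<Rightarrow> ('a \<times> 'a \<Rightarrow> 'k) set) (env k A)
        (env_mod k A (regular_bimod A)) (env_mod k A (dual_bimod k A)))
      k (hom_space (env k A) (env_mod k A (regular_bimod A)) (env_mod k A (dual_bimod k A))) \<and>
    mod_isomorphic k
      (stable_hom TYPE('i \<Rightarrow> ('a \<times> 'a \<Rightarrow> 'k) set) (env k A)
        (env_mod k A (regular_bimod A)) (env_mod k A (dual_bimod k A)))
      (quot_mod (A\<lparr>carrier := twisted_center A \<nu>\<rparr>) (twisted_higman k A \<nu>)) \<and>
    mod_isomorphic k (A\<lparr>carrier := twisted_center A \<nu>\<rparr>)
      (dual k (quot_mod A (commutator_space k A)))"
proof -
  interpret k_algebra k A
    using assms(1) by (simp add: frobenius_algebra_def)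
  interpret env_algebra k A ..
  obtain \<phi> where phi: "\<phi> \<in> mod_hom (env k A) (env_mod k A (dual_bimod k A)) (env_mod k A (twisted_bimod A \<nu>))"
    and bij: "bij_betw \<phi> (carrier (env_mod k A (dual_bimod k A))) (carrier (env_mod k A (twisted_bimod A \<nu>)))"
    using assms(3) by (auto simp: nakayama_automorphism_def mod_isomorphic_def)
  interpret nakayama k A \<nu> \<phi>
  proof
    show "\<nu> \<in> ring_iso A A"
      "\<And>c x. \<lbrakk>c \<in> carrier k; x \<in> carrier A\<rbrakk> \<Longrightarrow> \<nu> (c \<odot>\<^bsub>A\<^esub> x) = c \<odot>\<^bsub>A\<^esub> \<nu> x"
      using assms(3) by (auto simp: nakayama_automorphism_def)
    show "linear_map (env k A) (env_mod k A (dual_bimod k A)) (env_mod k A (twisted_bimod A \<nu>)) \<phi>"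
      by (rule mod_hom_linear[OF phi])
    show "bij_betw \<phi> (carrier (dual k A)) (carrier A)"
      using bij by (simp add: env_mod_def twisted_bimod_def)
  qed
  show ?thesis
    by (intro conjI Z_submodule H_submodule_Z proj_maps_submodule stable_hom_isomorphic center_isomorphic)
qed

end
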